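(* Let $M$ be a finite dimensional $\mathrm{GL}_n$-equivariant $kE$-module, let $1\le r\le n$, and let $U_0=kx_1+\cdots+kx_r\subset\mathbb V$. Then for any $\ell$, $1\le\ell\le r(p-1)$, there are isomorphisms of $\mathrm{GL}_n$-equivariant algebraic vector bundles on $\operatorname{Grass}(r,\mathbb V)$ $$\mathcal{K}er^\ell(M)\simeq\mathcal L(\operatorname{Soc}^\ell_{U_0}(M)),\qquad \mathcal{I}m^\ell(M)\simeq\mathcal L(\operatorname{Rad}^\ell_{U_0}(M)).$$
   Context: $k$ is an algebraically closed field of characteristic $p>0$, $E$ an elementary abelian $p$-group of rank $n\ge1$, $\mathbb V\subset\operatorname{Rad}(kE)$ a linear subspace with basis $x_1,\dots,x_n$ such that $\mathbb V\hookrightarrow\operatorname{Rad}(kE)\to\operatorname{Rad}(kE)/\operatorname{Rad}^2(kE)$ is an isomorphism; this identifies $kE$ with $S^*(\mathbb V)/\langle v^p,v\in\mathbb V\rangle=k[x_1,\dots,x_n]/(x_i^p)$, on which $\mathrm{GL}_n\cong\mathrm{GL}(\mathbb V)$ acts by algebra automorphisms induced by its standard action on $\mathbb V$. A $kE$-module $M$ is $\mathrm{GL}_n$-equivariant if it is provided with a rational (algebraic) linear action of $\mathrm{GL}(\mathbb V)$ such that $g(xm)=(gx)(gm)$ for $g\in\mathrm{GL}(\mathbb V)$, $x\in kE$, $m\in M$. For an $r$-dimensional subspace $U\subset\mathbb V$, $\operatorname{Rad}^\ell_U(M)$ is the span of all $u_1\cdots u_\ell m$ ($u_i\in U$, $m\in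 M$) and $\operatorname{Soc}^\ell_U(M)=\{m\in M:u_1\cdots u_\ell m=0\ \forall u_i\in U\}$. Let $P_0=\operatorname{Stab}(U_0)\subset\mathrm{GL}(\mathbb V)$, a parabolic subgroup; for $M$ $\mathrm{GL}_n$-equivariant, $\operatorname{Rad}^\ell_{U_0}(M)$ and $\operatorname{Soc}^\ell_{U_0}(M)$ are $P_0$-submodules of $M$. $\operatorname{Grass}(r,\mathbb V)\cong\mathrm{GL}(\mathbb V)/P_0$ is the Grassmannian of $r$-dimensional subspaces of $\mathbb V$, with structure sheaf $\mathcal O_{Gr}$. For a finite dimensional rational $P_0$-module $N$, $\mathcal L(N)$ is the sheaf of sections of $\mathrm{GL}(\mathbb V)\times^{P_0}N\to\mathrm{GL}(\mathbb V)/P_0$, a $\mathrm{GL}_n$-equivariant algebraic vector bundle (locally free coherent sheaf) on $\operatorname{Grass}(r,\mathbb V)$. The sheaves $\mathcal{K}er^\ell(M),\mathcal{I}m^\ell(M)$: identify $\operatorname{Grass}(r,\mathbb V)$ with $M^o_{n,r}/\mathrm{GL}_r$, where $M^o_{n,r}$ is the variety of $n\times r$ matrices of rank $r$ (a matrix represents the span of its columns). For $\Sigma=\{i_1<\dots<i_r\}\subset\{1,\dots,n\}$, $\mathcal U_\Sigma$ is the affine open subset of those $U$ represented by matrices with invertible $\Sigma$-submatrix (rows indexed by $\Sigma$); each such $U$ has a unique representative with $\Sigma$-submatrix the identity, and $k[\mathcal U_\Sigma]=k[Y^\Sigma_{i,j}]_{i\notin\Sigma,1\le j\le r}$ with $Y^\Sigma_{i,j}$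 its $(i,j)$ entry; also $Y^\Sigma_{i_j,j}=1$, $Y^\Sigma_{i_{j'},j}=0$ for $j'\ne j$. Let $\theta^\Sigma_j(m\otimes f)=\sum_i x_im\otimes Y^\Sigma_{i,j}f$ on $M\otimes k[\mathcal U_\Sigma]$. $\mathcal{K}er^\ell(M)$ and $\mathcal{I}m^\ell(M)$ are the unique subsheaves of $M\otimes\mathcal O_{Gr}$ whose restrictions to each $\mathcal U_\Sigma$ are $\bigcap_{1\le j_1,\dots,j_\ell\le r}\ker(\theta^\Sigma_{j_1}\cdots\theta^\Sigma_{j_\ell})$ and $\sum_{1\le j_1,\dots,j_\ell\le r}\operatorname{im}(\theta^\Sigma_{j_1}\cdots\theta^\Sigma_{j_\ell})$ respectively. For $M$ $\mathrm{GL}_n$-equivariant they are stable under the diagonal action of $\mathrm{GL}_n$ on $M\otimes\mathcal O_{Gr}$, and this is their $\mathrm{GL}_n$-equivariant structure. *)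

theory Defs
  imports
    "HOL-Library.Poly_Mapping"
    "HOL-Algebra.Group_Action"
    "HOL-Computational_Algebra.Polynomial"
    "Jordan_Normal_Form.DL_Rank"
    "Jordan_Normal_Form.DL_Submatrix"
begin

section \<open>The group algebra and its modules\<close>

text \<open>
  For a finite abelian group \<open>E\<close>, written additively as a type \<open>'e\<close>, the type \<open>'e \<Rightarrow>\<^sub>0 'k\<close> with its
  library multiplication (convolution) is the group algebra \<open>kE\<close>.
\<close>

definition elementary_abelian :: "'e::{ab_group_add,finite} itself \<Rightarrow> nat \<Rightarrow> nat \<Rightarrow> bool" where
  "elementary_abelian _ p n \<longleftrightarrow> prime p \<and> (\<forall>e::'e. (\<Sum>i<p. e) = 0) \<and> card (UNIV :: 'e set) = p ^ n"

definition kscale :: "'k::field \<Rightarrow> ('e::ab_group_add \<Rightarrow>\<^sub>0 'k) \<Rightarrow> ('e \<Rightarrow>\<^sub>0 'k)" where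
  "kscale c a = Poly_Mapping.single 0 c * a"

definition mscale :: "(('e::ab_group_add \<Rightarrow>\<^sub>0 'k::field) \<Rightarrow> 'm \<Rightarrow> 'm) \<Rightarrow> 'k \<Rightarrow> 'm::ab_group_add \<Rightarrow> 'm" where
  "mscale act c m = act (Poly_Mapping.single 0 c) m"

definition maximal_ideal :: "'a::comm_ring_1 set \<Rightarrow> bool" where
  "maximal_ideal I \<longleftrightarrow> Modules.module.subspace (*) I \<and> I \<noteq> UNIV \<and>
     (\<forall>J. Modules.module.subspace (*) J \<and> I \<subseteq> J \<longrightarrow> J = I \<or> J = UNIV)"

definition Rad :: "'a::comm_ring_1 set" where
  "Rad = \<Inter>{I. maximal_ideal I}"

definition Rad2 :: "'a::comm_ring_1 set" where
  "Rad2 = Modules.module.span (*) {a * b |a b. a \<in> Rad \<and> b \<in> Rad}"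

text \<open>
  \<open>V\<close> has basis \<open>x 0, \<dots>, x (n - 1)\<close>; the last conjunct says that the composite of the inclusion
  \<open>V \<rightarrow> Rad(kE)\<close> with \<open>Rad(kE) \<rightarrow> Rad(kE)/Rad\<^sup>2(kE)\<close> is bijective.
\<close>

definition generating_subspace ::
    "('e::ab_group_add \<Rightarrow>\<^sub>0 'k::field) set \<Rightarrow> nat \<Rightarrow> (nat \<Rightarrow> ('e \<Rightarrow>\<^sub>0 'k)) \<Rightarrow> bool" where
  "generating_subspace V n x \<longleftrightarrow>
     V \<subseteq> Rad \<and> Modules.module.subspace kscale V \<and>
     inj_on x {..<n} \<and> \<not> Modules.module.dependent kscale (x ` {..<n}) \<and>
     Modules.module.span kscale (x ` {..<n}) = V \<and>
     (\<forall>a\<in>Rad. \<exists>!v. v \<in> V \<and> a - v \<in> Rad2)"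

definition Rad_pow :: "(('e::ab_group_add \<Rightarrow>\<^sub>0 'k::field) \<Rightarrow> 'm \<Rightarrow> 'm) \<Rightarrow> ('e \<Rightarrow>\<^sub>0 'k) set \<Rightarrow> nat
    \<Rightarrow> 'm::ab_group_add set" where
  "Rad_pow act U l = Modules.module.span (mscale act)
     {act (prod_list us) m |us m. length us = l \<and> set us \<subseteq> U}"

definition Soc_pow :: "(('e::ab_group_add \<Rightarrow>\<^sub>0 'k::field) \<Rightarrow> 'm \<Rightarrow> 'm) \<Rightarrow> ('e \<Rightarrow>\<^sub>0 'k) set \<Rightarrow> nat
    \<Rightarrow> 'm::ab_group_add set" where
  "Soc_pow act U l = {m. \<forall>us. length us = l \<and> set us \<subseteq> U \<longrightarrow> act (prod_list us) m = 0}"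

section \<open>Varieties as spaces with functions\<close>

text \<open>
  Over an algebraically closed field a variety is given by its closed points, its Zariski open
  sets and the regular functions on them.  A regular function on \<open>W\<close> is represented by a function
  on the whole type, whose values outside \<open>W\<close> are irrelevant.
\<close>

record ('u, 'k) fspace =
  pts :: "'u set"
  opens :: "'u set set"
  regular :: "'u set \<Rightarrow> ('u \<Rightarrow> 'k) set"

inductive_set polyfuns :: "('u \<Rightarrow> 'k::comm_ring_1) set \<Rightarrow> ('u \<Rightarrow> 'k) set"
  for C :: "('u \<Rightarrow> 'k) set" where
  const: "(\<lambda>_. c) \<in> polyfuns C"
| coord: "f \<in> C \<Longrightarrow> f \<in> polyfuns C"
| add: "f \<in> polyfuns C \<Longrightarrow> g \<in> polyfuns C \<Longrightarrow> (\<lambda>a. f a + g a) \<in> polyfuns C"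
| mult: "f \<in> polyfuns C \<Longrightarrow> g \<in> polyfuns C \<Longrightarrow> (\<lambda>a. f a * g a) \<in> polyfuns C"

text \<open>The subset \<open>X\<close> of an affine space with coordinate functions \<open>C\<close>.\<close>

definition zariski_opens :: "('u \<Rightarrow> 'k::field) set \<Rightarrow> 'u set \<Rightarrow> 'u set set" where
  "zariski_opens C X = {W. \<exists>F \<subseteq> polyfuns C. W = {a \<in> X. \<exists>q\<in>F. q a \<noteq> 0}}"

definition zariski_space :: "('u \<Rightarrow> 'k::field) set \<Rightarrow> 'u set \<Rightarrow> ('u, 'k) fspace" where
  "zariski_space C X = \<lparr>pts = X, opens = zariski_opens C X,
     regular = (\<lambda>W. {f. \<forall>a\<in>W. \<exists>W'\<in>zariski_opens C X. a \<in> W' \<and> W' \<subseteq> W \<and>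
        (\<exists>g\<in>polyfuns C. \<exists>h\<in>polyfuns C. \<forall>b\<in>W'. h b \<noteq> 0 \<and> f b = g b / h b)})\<rparr>"

definition quotient_space :: "('u \<Rightarrow> 'v) \<Rightarrow> ('u, 'k) fspace \<Rightarrow> ('v, 'k) fspace" where
  "quotient_space \<pi> X = \<lparr>pts = \<pi> ` pts X,
     opens = {W. W \<subseteq> \<pi> ` pts X \<and> {a \<in> pts X. \<pi> a \<in> W} \<in> opens X},
     regular = (\<lambda>W. {f. (\<lambda>a. f (\<pi> a)) \<in> regular X {a \<in> pts X. \<pi> a \<in> W}})\<rparr>"

definition open_subspace :: "('u, 'k) fspace \<Rightarrow> 'u set \<Rightarrow> ('u, 'k) fspace" where
  "open_subspace X W = \<lparr>pts = W, opens = {W' \<in> opens X. W' \<subseteq> W}, regular = regular X\<rparr>"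

definition morphism :: "('u, 'k) fspace \<Rightarrow> ('v, 'k) fspace \<Rightarrow> ('u \<Rightarrow> 'v) \<Rightarrow> bool" where
  "morphism X Y \<phi> \<longleftrightarrow> \<phi> ` pts X \<subseteq> pts Y \<and>
     (\<forall>W\<in>opens Y. {a \<in> pts X. \<phi> a \<in> W} \<in> opens X \<and>
        (\<forall>f\<in>regular Y W. (\<lambda>a. f (\<phi> a)) \<in> regular X {a \<in> pts X. \<phi> a \<in> W}))"

section \<open>Equivariant vector bundles\<close>

text \<open>
  Sections over \<open>W\<close> are functions on points normalised to a default value outside \<open>W\<close>
  (\<open>0\<close>, or the empty set for set-valued sections), so equality of sections is equality of
  functions.  The field \<open>sact g\<close> maps sections over \<open>W\<close> to sections over \<open>g W\<close>.
\<close>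

record ('u, 'k, 's) msheaf =
  sections :: "'u set \<Rightarrow> 's set"
  srestr :: "'u set \<Rightarrow> 's \<Rightarrow> 's"
  sadd :: "'s \<Rightarrow> 's \<Rightarrow> 's"
  smul :: "('u \<Rightarrow> 'k) \<Rightarrow> 's \<Rightarrow> 's"

record ('u, 'k, 's, 'g) eqsheaf = "('u, 'k, 's) msheaf" +
  sact :: "'g \<Rightarrow> 's \<Rightarrow> 's"

definition sheaf_iso_on :: "('u, 'k) fspace \<Rightarrow> 'u set \<Rightarrow> ('u, 'k, 's, 'x) msheaf_scheme
    \<Rightarrow> ('u, 'k, 't, 'y) msheaf_scheme \<Rightarrow> ('u set \<Rightarrow> 's \<Rightarrow> 't) \<Rightarrow> bool" where
  "sheaf_iso_on X W0 F H \<phi> \<longleftrightarrow> (\<forall>W\<in>opens X. W \<subseteq> W0 \<longrightarrow>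
     bij_betw (\<phi> W) (sections F W) (sections H W) \<and>
     (\<forall>s\<in>sections F W. \<forall>t\<in>sections F W. \<phi> W (sadd F s t) = sadd H (\<phi> W s) (\<phi> W t)) \<and>
     (\<forall>f\<in>regular X W. \<forall>s\<in>sections F W. \<phi> W (smul F f s) = smul H f (\<phi> W s)) \<and>
     (\<forall>W'\<in>opens X. W' \<subseteq> W \<longrightarrow>
        (\<forall>s\<in>sections F W. \<phi> W' (srestr F W' s) = srestr H W' (\<phi> W s))))"

definition free_sheaf :: "('u, 'k::field) fspace \<Rightarrow> nat \<Rightarrow> ('u, 'k, 'u \<Rightarrow> nat \<Rightarrow> 'k) msheaf" where
  "free_sheaf X d = \<lparr>
     sections = (\<lambda>W. {s. (\<forall>i. (\<lambda>u. s u i) \<in> regular X W) \<and> (\<forall>u i. u \<notin> W \<or> d \<le> i \<longrightarrow> s u i = 0)}),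
     srestr = (\<lambda>W s u i. if u \<in> W then s u i else 0),
     sadd = (\<lambda>s t u i. s u i + t u i),
     smul = (\<lambda>f s u i. f u * s u i)\<rparr>"

definition locally_free :: "('u, 'k::field) fspace \<Rightarrow> ('u, 'k, 's, 'x) msheaf_scheme \<Rightarrow> bool" where
  "locally_free X F \<longleftrightarrow> (\<forall>u\<in>pts X. \<exists>W\<in>opens X. u \<in> W \<and>
     (\<exists>d \<phi>. sheaf_iso_on X W (free_sheaf X d) F \<phi>))"

definition equivariant_vector_bundle :: "('u, 'k::field) fspace \<Rightarrow> 'g set \<Rightarrow> ('g \<Rightarrow> 'u \<Rightarrow> 'u)
    \<Rightarrow> ('u, 'k, 's, 'g) eqsheaf \<Rightarrow> bool" where
  "equivariant_vector_bundle X G \<tau> F \<longleftrightarrow> locally_free X F \<and>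
     (\<forall>g\<in>G. \<forall>W\<in>opens X. sact F g ` sections F W \<subseteq> sections F (\<tau> g ` W))"

definition equivariant_bundle_iso :: "('u, 'k::field) fspace \<Rightarrow> 'g set \<Rightarrow> ('g \<Rightarrow> 'u \<Rightarrow> 'u)
    \<Rightarrow> ('u, 'k, 's, 'g) eqsheaf \<Rightarrow> ('u, 'k, 't, 'g) eqsheaf \<Rightarrow> bool" where
  "equivariant_bundle_iso X G \<tau> F H \<longleftrightarrow>
     equivariant_vector_bundle X G \<tau> F \<and> equivariant_vector_bundle X G \<tau> H \<and>
     (\<exists>\<phi>. sheaf_iso_on X (pts X) F H \<phi> \<and>
        (\<forall>g\<in>G. \<forall>W\<in>opens X. \<forall>s\<in>sections F W. \<phi> (\<tau> g ` W) (sact F g s) = sact H g (\<phi> W s)))"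

section \<open>Equivariant modules\<close>

definition GLn :: "nat \<Rightarrow> 'k::field mat monoid" where
  "GLn n = units_of (ring_mat TYPE('k) n ())"

definition mat_coords :: "nat \<Rightarrow> nat \<Rightarrow> ('k mat \<Rightarrow> 'k) set" where
  "mat_coords a b = {\<lambda>A. A $$ (i, j) |i j. i < a \<and> j < b}"

definition k_algebra_automorphism ::
    "(('e::ab_group_add \<Rightarrow>\<^sub>0 'k::field) \<Rightarrow> ('e \<Rightarrow>\<^sub>0 'k)) \<Rightarrow> bool" where
  "k_algebra_automorphism h \<longleftrightarrow> bij h \<and> h 1 = 1 \<and> (\<forall>a b. h (a + b) = h a + h b) \<and>
     (\<forall>a b. h (a * b) = h a * h b) \<and> (\<forall>c a. h (kscale c a) = kscale c (h a))"

text \<open>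
  \<open>\<alpha> g\<close> is the algebra automorphism of \<open>kE\<close> induced by the standard action of \<open>g\<close> on \<open>V\<close>.
  It is determined by \<open>g\<close>, because \<open>V\<close> generates the algebra \<open>kE\<close>.
\<close>

definition induced_action :: "nat \<Rightarrow> (nat \<Rightarrow> ('e::ab_group_add \<Rightarrow>\<^sub>0 'k::field))
    \<Rightarrow> ('k mat \<Rightarrow> ('e \<Rightarrow>\<^sub>0 'k) \<Rightarrow> ('e \<Rightarrow>\<^sub>0 'k)) \<Rightarrow> bool" where
  "induced_action n x \<alpha> \<longleftrightarrow> (\<forall>g\<in>carrier (GLn n). k_algebra_automorphism (\<alpha> g) \<and>
     (\<forall>j<n. \<alpha> g (x j) = (\<Sum>i<n. kscale (g $$ (i, j)) (x i))))"

definition rational_action :: "nat \<Rightarrow> ('k::field \<Rightarrow> 'm::ab_group_add \<Rightarrow> 'm)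
    \<Rightarrow> ('k mat \<Rightarrow> 'm \<Rightarrow> 'm) \<Rightarrow> bool" where
  "rational_action n scale \<rho> \<longleftrightarrow> group_action (GLn n) UNIV \<rho> \<and>
     (\<forall>g\<in>carrier (GLn n). Vector_Spaces.linear scale scale (\<rho> g)) \<and>
     (\<forall>m \<xi>. Vector_Spaces.linear scale (*) \<xi> \<longrightarrow>
        (\<lambda>g. \<xi> (\<rho> g m)) \<in>
          regular (zariski_space (mat_coords n n) (carrier (GLn n))) (carrier (GLn n)))"

definition equivariant_module :: "nat
    \<Rightarrow> ('k mat \<Rightarrow> ('e::ab_group_add \<Rightarrow>\<^sub>0 'k::field) \<Rightarrow> ('e \<Rightarrow>\<^sub>0 'k))
    \<Rightarrow> (('e \<Rightarrow>\<^sub>0 'k) \<Rightarrow> 'm \<Rightarrow> 'm) \<Rightarrow> ('k mat \<Rightarrow> 'm \<Rightarrow> 'm::ab_group_add) \<Rightarrow> bool" where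
  "equivariant_module n \<alpha> act \<rho> \<longleftrightarrow>
     rational_action n (mscale act) \<rho> \<and>
     (\<forall>g\<in>carrier (GLn n). \<forall>a m. \<rho> g (act a m) = act (\<alpha> g a) (\<rho> g m))"

section \<open>The Grassmannian\<close>

definition full_rank_mats :: "nat \<Rightarrow> nat \<Rightarrow> 'k::field mat set" where
  "full_rank_mats n r = {A \<in> carrier_mat n r. vec_space.rank n A = r}"

definition col_span :: "nat \<Rightarrow> nat \<Rightarrow> (nat \<Rightarrow> ('e::ab_group_add \<Rightarrow>\<^sub>0 'k::field)) \<Rightarrow> 'k mat
    \<Rightarrow> ('e \<Rightarrow>\<^sub>0 'k) set" where
  "col_span n r x A =
     Modules.module.span kscale ((\<lambda>j. \<Sum>i<n. kscale (A $$ (i, j)) (x i)) ` {..<r})"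

definition Gr :: "nat \<Rightarrow> nat \<Rightarrow> (nat \<Rightarrow> ('e::ab_group_add \<Rightarrow>\<^sub>0 'k::field))
    \<Rightarrow> (('e \<Rightarrow>\<^sub>0 'k) set, 'k) fspace" where
  "Gr n r x = quotient_space (col_span n r x) (zariski_space (mat_coords n r) (full_rank_mats n r))"

definition gr_act :: "('k mat \<Rightarrow> ('e::ab_group_add \<Rightarrow>\<^sub>0 'k::field) \<Rightarrow> ('e \<Rightarrow>\<^sub>0 'k))
    \<Rightarrow> 'k mat \<Rightarrow> ('e \<Rightarrow>\<^sub>0 'k) set \<Rightarrow> ('e \<Rightarrow>\<^sub>0 'k) set" where
  "gr_act \<alpha> g U = \<alpha> g ` U"

definition index_sets :: "nat \<Rightarrow> nat \<Rightarrow> nat set set" where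
  "index_sets n r = {\<Sigma>. \<Sigma> \<subseteq> {..<n} \<and> card \<Sigma> = r}"

definition chart :: "nat \<Rightarrow> nat \<Rightarrow> (nat \<Rightarrow> ('e::ab_group_add \<Rightarrow>\<^sub>0 'k::field)) \<Rightarrow> nat set
    \<Rightarrow> ('e \<Rightarrow>\<^sub>0 'k) set set" where
  "chart n r x \<Sigma> = col_span n r x ` {A \<in> full_rank_mats n r. invertible_mat (submatrix A \<Sigma> UNIV)}"

definition Ymat :: "nat \<Rightarrow> nat \<Rightarrow> (nat \<Rightarrow> ('e::ab_group_add \<Rightarrow>\<^sub>0 'k::field)) \<Rightarrow> nat set
    \<Rightarrow> ('e \<Rightarrow>\<^sub>0 'k) set \<Rightarrow> 'k mat" where
  "Ymat n r x \<Sigma> U = (THE A. A \<in> full_rank_mats n r \<and> col_span n r x A = U \<and>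
     submatrix A \<Sigma> UNIV = 1\<^sub>m r)"

section \<open>The sheaves \<open>Ker\<close> and \<open>Im\<close>\<close>

text \<open>The sections of \<open>M \<otimes> O\<close> over \<open>W\<close>, as \<open>M\<close>-valued functions.\<close>

definition tensor_sections :: "('u, 'k) fspace \<Rightarrow> ('k \<Rightarrow> 'm \<Rightarrow> 'm) \<Rightarrow> 'u set
    \<Rightarrow> ('u \<Rightarrow> 'm::ab_group_add) set" where
  "tensor_sections X scale W = {s. (\<forall>u. u \<notin> W \<longrightarrow> s u = 0) \<and>
     (\<exists>B f. finite B \<and> (\<forall>b\<in>B. f b \<in> regular X W) \<and> (\<forall>u\<in>W. s u = (\<Sum>b\<in>B. scale (f b u) b)))}"

definition theta :: "nat \<Rightarrow> nat \<Rightarrow> (nat \<Rightarrow> ('e::ab_group_add \<Rightarrow>\<^sub>0 'k::field))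
    \<Rightarrow> (('e \<Rightarrow>\<^sub>0 'k) \<Rightarrow> 'm \<Rightarrow> 'm) \<Rightarrow> nat set \<Rightarrow> nat
    \<Rightarrow> (('e \<Rightarrow>\<^sub>0 'k) set \<Rightarrow> 'm::ab_group_add) \<Rightarrow> (('e \<Rightarrow>\<^sub>0 'k) set \<Rightarrow> 'm)" where
  "theta n r x act \<Sigma> j s = (\<lambda>U. if U \<in> chart n r x \<Sigma>
     then (\<Sum>i<n. mscale act (Ymat n r x \<Sigma> U $$ (i, j)) (act (x i) (s U))) else 0)"

definition multi_indices :: "nat \<Rightarrow> nat \<Rightarrow> nat list set" where
  "multi_indices r l = {js. length js = l \<and> set js \<subseteq> {..<r}}"

definition ker_chart :: "nat \<Rightarrow> nat \<Rightarrow> (nat \<Rightarrow> ('e::ab_group_add \<Rightarrow>\<^sub>0 'k::field))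
    \<Rightarrow> (('e \<Rightarrow>\<^sub>0 'k) \<Rightarrow> 'm \<Rightarrow> 'm) \<Rightarrow> nat \<Rightarrow> nat set
    \<Rightarrow> (('e \<Rightarrow>\<^sub>0 'k) set \<Rightarrow> 'm::ab_group_add) set" where
  "ker_chart n r x act l \<Sigma> =
     {s \<in> tensor_sections (Gr n r x) (mscale act) (chart n r x \<Sigma>).
        \<forall>js\<in>multi_indices r l. foldr (theta n r x act \<Sigma>) js s = (\<lambda>U. 0)}"

definition im_chart :: "nat \<Rightarrow> nat \<Rightarrow> (nat \<Rightarrow> ('e::ab_group_add \<Rightarrow>\<^sub>0 'k::field))
    \<Rightarrow> (('e \<Rightarrow>\<^sub>0 'k) \<Rightarrow> 'm \<Rightarrow> 'm) \<Rightarrow> nat \<Rightarrow> nat set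
    \<Rightarrow> (('e \<Rightarrow>\<^sub>0 'k) set \<Rightarrow> 'm::ab_group_add) set" where
  "im_chart n r x act l \<Sigma> =
     {s. \<exists>t. (\<forall>js\<in>multi_indices r l.
              t js \<in> tensor_sections (Gr n r x) (mscale act) (chart n r x \<Sigma>)) \<and>
            s = (\<lambda>U. \<Sum>js\<in>multi_indices r l. foldr (theta n r x act \<Sigma>) js (t js) U)}"

text \<open>
  Sections over \<open>W \<subseteq> Z\<close> of the quasi-coherent sheaf on the affine open set \<open>Z\<close> associated with a
  \<open>k[Z]\<close>-submodule \<open>N\<close> of \<open>M \<otimes> k[Z]\<close>: locally fractions \<open>t / h\<close> with \<open>t \<in> N\<close> and \<open>h \<in> k[Z]\<close>.
\<close>

definition assoc_sections :: "('u, 'k::field) fspace \<Rightarrow> ('k \<Rightarrow> 'm \<Rightarrow> 'm) \<Rightarrow> 'u set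
    \<Rightarrow> ('u \<Rightarrow> 'm::ab_group_add) set \<Rightarrow> 'u set \<Rightarrow> ('u \<Rightarrow> 'm) set" where
  "assoc_sections X scale Z N W = {s. (\<forall>u. u \<notin> W \<longrightarrow> s u = 0) \<and>
     (\<forall>u\<in>W. \<exists>W'\<in>opens X. u \<in> W' \<and> W' \<subseteq> W \<and>
        (\<exists>t\<in>N. \<exists>h\<in>regular X Z. \<forall>v\<in>W'. h v \<noteq> 0 \<and> s v = scale (inverse (h v)) (t v)))}"

text \<open>
  The subsheaf of \<open>M \<otimes> O\<close> whose restriction to each chart is associated with the given module of
  sections over that chart, with the diagonal action \<open>(g s)(U) = g (s (g\<^sup>-\<^sup>1 U))\<close>.
\<close>

definition glued_subsheaf :: "nat \<Rightarrow> nat \<Rightarrow> (nat \<Rightarrow> ('e::ab_group_add \<Rightarrow>\<^sub>0 'k::field))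
    \<Rightarrow> ('k mat \<Rightarrow> ('e \<Rightarrow>\<^sub>0 'k) \<Rightarrow> ('e \<Rightarrow>\<^sub>0 'k))
    \<Rightarrow> (('e \<Rightarrow>\<^sub>0 'k) \<Rightarrow> 'm \<Rightarrow> 'm) \<Rightarrow> ('k mat \<Rightarrow> 'm \<Rightarrow> 'm)
    \<Rightarrow> (nat set \<Rightarrow> (('e \<Rightarrow>\<^sub>0 'k) set \<Rightarrow> 'm::ab_group_add) set)
    \<Rightarrow> (('e \<Rightarrow>\<^sub>0 'k) set, 'k, ('e \<Rightarrow>\<^sub>0 'k) set \<Rightarrow> 'm, 'k mat) eqsheaf" where
  "glued_subsheaf n r x \<alpha> act \<rho> N = \<lparr>
     sections = (\<lambda>W. {s \<in> tensor_sections (Gr n r x) (mscale act) W. \<forall>\<Sigma>\<in>index_sets n r.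
        (\<lambda>U. if U \<in> W \<inter> chart n r x \<Sigma> then s U else 0) \<in>
          assoc_sections (Gr n r x) (mscale act) (chart n r x \<Sigma>) (N \<Sigma>) (W \<inter> chart n r x \<Sigma>)}),
     srestr = (\<lambda>W s U. if U \<in> W then s U else 0),
     sadd = (\<lambda>s t U. s U + t U),
     smul = (\<lambda>f s U. mscale act (f U) (s U)),
     sact = (\<lambda>g s U. \<rho> g (s (gr_act \<alpha> (inv\<^bsub>GLn n\<^esub> g) U)))\<rparr>"

definition Ker_sheaf :: "nat \<Rightarrow> nat \<Rightarrow> (nat \<Rightarrow> ('e::ab_group_add \<Rightarrow>\<^sub>0 'k::field))
    \<Rightarrow> ('k mat \<Rightarrow> ('e \<Rightarrow>\<^sub>0 'k) \<Rightarrow> ('e \<Rightarrow>\<^sub>0 'k))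
    \<Rightarrow> (('e \<Rightarrow>\<^sub>0 'k) \<Rightarrow> 'm \<Rightarrow> 'm) \<Rightarrow> ('k mat \<Rightarrow> 'm \<Rightarrow> 'm::ab_group_add) \<Rightarrow> nat
    \<Rightarrow> (('e \<Rightarrow>\<^sub>0 'k) set, 'k, ('e \<Rightarrow>\<^sub>0 'k) set \<Rightarrow> 'm, 'k mat) eqsheaf" where
  "Ker_sheaf n r x \<alpha> act \<rho> l = glued_subsheaf n r x \<alpha> act \<rho> (ker_chart n r x act l)"

definition Im_sheaf :: "nat \<Rightarrow> nat \<Rightarrow> (nat \<Rightarrow> ('e::ab_group_add \<Rightarrow>\<^sub>0 'k::field))
    \<Rightarrow> ('k mat \<Rightarrow> ('e \<Rightarrow>\<^sub>0 'k) \<Rightarrow> ('e \<Rightarrow>\<^sub>0 'k))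
    \<Rightarrow> (('e \<Rightarrow>\<^sub>0 'k) \<Rightarrow> 'm \<Rightarrow> 'm) \<Rightarrow> ('k mat \<Rightarrow> 'm \<Rightarrow> 'm::ab_group_add) \<Rightarrow> nat
    \<Rightarrow> (('e \<Rightarrow>\<^sub>0 'k) set, 'k, ('e \<Rightarrow>\<^sub>0 'k) set \<Rightarrow> 'm, 'k mat) eqsheaf" where
  "Im_sheaf n r x \<alpha> act \<rho> l = glued_subsheaf n r x \<alpha> act \<rho> (im_chart n r x act l)"

section \<open>The sheaf of sections of \<open>GL \<times>\<^sup>P N\<close>\<close>

definition base_subspace :: "nat \<Rightarrow> (nat \<Rightarrow> ('e::ab_group_add \<Rightarrow>\<^sub>0 'k::field)) \<Rightarrow> ('e \<Rightarrow>\<^sub>0 'k) set" where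
  "base_subspace r x = Modules.module.span kscale (x ` {..<r})"

definition parabolic :: "nat \<Rightarrow> nat \<Rightarrow> (nat \<Rightarrow> ('e::ab_group_add \<Rightarrow>\<^sub>0 'k::field))
    \<Rightarrow> ('k mat \<Rightarrow> ('e \<Rightarrow>\<^sub>0 'k) \<Rightarrow> ('e \<Rightarrow>\<^sub>0 'k)) \<Rightarrow> 'k mat set" where
  "parabolic n r x \<alpha> =
     {g \<in> carrier (GLn n). gr_act \<alpha> g (base_subspace r x) = base_subspace r x}"

definition bundle_class :: "nat \<Rightarrow> 'k::field mat set \<Rightarrow> ('k mat \<Rightarrow> 'm \<Rightarrow> 'm) \<Rightarrow> 'k mat \<times> 'm
    \<Rightarrow> ('k mat \<times> 'm) set" where
  "bundle_class n P \<rho> gm = {(fst gm \<otimes>\<^bsub>GLn n\<^esub> q, \<rho> (inv\<^bsub>GLn n\<^esub> q) (snd gm)) |q. q \<in> P}"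

text \<open>
  The coordinates of \<open>GL\<^sub>n \<times> N\<close> are the matrix entries and the restrictions to \<open>N\<close> of the linear
  functionals on \<open>M\<close>.
\<close>

definition total_space :: "nat \<Rightarrow> 'k::field mat set \<Rightarrow> ('k \<Rightarrow> 'm \<Rightarrow> 'm) \<Rightarrow> ('k mat \<Rightarrow> 'm \<Rightarrow> 'm)
    \<Rightarrow> 'm::ab_group_add set \<Rightarrow> (('k mat \<times> 'm) set, 'k) fspace" where
  "total_space n P scale \<rho> N = quotient_space (bundle_class n P \<rho>)
     (zariski_space
        ({\<lambda>gm. f (fst gm) |f. f \<in> mat_coords n n} \<union>
         {\<lambda>gm. \<xi> (snd gm) |\<xi>. Vector_Spaces.linear scale (*) \<xi>})
        (carrier (GLn n) \<times> N))"

text \<open>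
  A section over \<open>W\<close> is a morphism \<open>t\<close> from \<open>W\<close> to the total space with \<open>t U\<close> in the fibre over \<open>U\<close>,
  where \<open>[g, m]\<close> lies over \<open>g U\<^sub>0\<close>.  A class in the fibre over \<open>U\<close> contains exactly one pair
  \<open>(g, m)\<close> for each \<open>g\<close> with \<open>g U\<^sub>0 = U\<close>; therefore fibrewise operations can be
  computed at each such \<open>g\<close> separately.  The group acts by \<open>h [g, m] = [h g, m]\<close> and
  \<open>(h t)(U) = h (t (h\<^sup>-\<^sup>1 U))\<close>.
\<close>

definition L_sheaf :: "nat \<Rightarrow> nat \<Rightarrow> (nat \<Rightarrow> ('e::ab_group_add \<Rightarrow>\<^sub>0 'k::field))
    \<Rightarrow> ('k mat \<Rightarrow> ('e \<Rightarrow>\<^sub>0 'k) \<Rightarrow> ('e \<Rightarrow>\<^sub>0 'k))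
    \<Rightarrow> ('k \<Rightarrow> 'm \<Rightarrow> 'm) \<Rightarrow> ('k mat \<Rightarrow> 'm \<Rightarrow> 'm::ab_group_add) \<Rightarrow> 'm set
    \<Rightarrow> (('e \<Rightarrow>\<^sub>0 'k) set, 'k, ('e \<Rightarrow>\<^sub>0 'k) set \<Rightarrow> ('k mat \<times> 'm) set, 'k mat) eqsheaf" where
  "L_sheaf n r x \<alpha> scale \<rho> N = \<lparr>
     sections = (\<lambda>W. {t. (\<forall>U. U \<notin> W \<longrightarrow> t U = {}) \<and>
        morphism (open_subspace (Gr n r x) W) (total_space n (parabolic n r x \<alpha>) scale \<rho> N) t \<and>
        (\<forall>U\<in>W. \<forall>(g, m)\<in>t U. gr_act \<alpha> g (base_subspace r x) = U)}),
     srestr = (\<lambda>W t U. if U \<in> W then t U else {}),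
     sadd = (\<lambda>s t U. {(g, m + m') |g m m'. (g, m) \<in> s U \<and> (g, m') \<in> t U}),
     smul = (\<lambda>f t U. {(g, scale (f U) m) |g m. (g, m) \<in> t U}),
     sact = (\<lambda>h t U. {(h \<otimes>\<^bsub>GLn n\<^esub> g, m) |g m. (g, m) \<in> t (gr_act \<alpha> (inv\<^bsub>GLn n\<^esub> h) U)})\<rparr>"

end

theory Submission
  imports Defs
begin

text \<open>
  For a family of subspaces \<open>fib U\<close> of \<open>M\<close>, equivariant in the sense that \<open>g\<close> maps \<open>fib U\<close> to \<open>fib (g U)\<close>
  (here \<open>Soc_pow\<close> or \<open>Rad_pow\<close> with respect to \<open>U\<close>), consider the sheaf of sections \<open>s\<close> of \<open>M \<otimes> O\<close> with
  \<open>s U \<in> fib U\<close> for all \<open>U\<close>.  Over a chart there is a regular map \<open>U \<mapsto> frame U\<close> to \<open>GL\<^sub>n\<close> with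
  \<open>frame U\<close> carrying \<open>U\<^sub>0\<close> to \<open>U\<close>; translating by it turns this sheaf into the trivial bundle with fibre
  \<open>fib U\<^sub>0\<close>.  This shows that the sheaf is locally free and, after clearing denominators, that it agrees with
  \<open>Ker\<close> and \<open>Im\<close>, which are defined by modules of sections over the charts.  The isomorphism to the
  associated bundle sends \<open>s\<close> to the section \<open>U \<mapsto> {(g, m). g U\<^sub>0 = U \<and> g m = s U}\<close>; conversely
  \<open>(g, m) \<mapsto> g m\<close> is constant on classes and regular, so it recovers \<open>s\<close> from its image.
\<close>

section \<open>Spaces with functions\<close>

text \<open>The modules defining Ker and Im consist of sections over a whole chart, while a section
  over a smaller open set has frame coordinates that are regular only there. Near each point these
  coordinates must become fractions with one common denominator, all numerators and the denominator
  being regular on the whole chart. The frame completes the normal form of \<open>U\<close> by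
  standard basis vectors. Its first columns matter, not only their span: it carries
  \<open>x j\<close> to the element of \<open>kE\<close> by which \<open>theta j\<close> multiplies
  at \<open>U\<close>. Hence its action on M intertwines multiplication by \<open>x j\<close> with
  \<open>theta j\<close>, and a presentation of a vector of the radical power at \<open>U0\<close>
  becomes a presentation of a section as an element of Im over the chart. Rationality only says that
  \<open>g \<mapsto> \<xi> (\<rho> g m)\<close> is regular for fixed \<open>m\<close>; a vector that
  varies with the point is therefore first expanded in a basis. The inverse
  \<open>(g, m) \<mapsto> g m\<close> exists because the action of the parabolic subgroup on the
  fibre at \<open>U0\<close> is restricted from an action of GL_n on M: a class
  \<open>[g, m]\<close> is determined by \<open>g U0\<close> and \<open>g m\<close>.\<close>

locale space_with_functions =
  fixes X :: "('u, 'k::field) fspace"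
  assumes opens_subset: "W \<in> opens X \<Longrightarrow> W \<subseteq> pts X"
    and pts_open: "pts X \<in> opens X"
    and open_Int: "W \<in> opens X \<Longrightarrow> W' \<in> opens X \<Longrightarrow> W \<inter> W' \<in> opens X"
    and open_Union: "\<W> \<subseteq> opens X \<Longrightarrow> \<Union>\<W> \<in> opens X"
    and reg_restrict: "f \<in> regular X W \<Longrightarrow> W \<in> opens X \<Longrightarrow> W' \<in> opens X \<Longrightarrow> W' \<subseteq> W \<Longrightarrow> f \<in> regular X W'"
    and reg_cong: "f \<in> regular X W \<Longrightarrow> (\<And>a. a \<in> W \<Longrightarrow> f a = f' a) \<Longrightarrow> f' \<in> regular X W"
    and reg_local: "W \<in> opens X \<Longrightarrow>
      (\<And>a. a \<in> W \<Longrightarrow> \<exists>W'\<in>opens X. a \<in> W' \<and> W' \<subseteq> W \<and> f \<in> regular X W') \<Longrightarrow> f \<in> regular X W"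
    and reg_const: "W \<in> opens X \<Longrightarrow> (\<lambda>_. c) \<in> regular X W"
    and reg_add: "W \<in> opens X \<Longrightarrow> f \<in> regular X W \<Longrightarrow> f' \<in> regular X W \<Longrightarrow> (\<lambda>a. f a + f' a) \<in> regular X W"
    and reg_mult: "W \<in> opens X \<Longrightarrow> f \<in> regular X W \<Longrightarrow> f' \<in> regular X W \<Longrightarrow> (\<lambda>a. f a * f' a) \<in> regular X W"
    and reg_nonzero: "W \<in> opens X \<Longrightarrow> f \<in> regular X W \<Longrightarrow> {a \<in> W. f a \<noteq> 0} \<in> opens X"
    and reg_inverse: "W \<in> opens X \<Longrightarrow> f \<in> regular X W \<Longrightarrow> (\<And>a. a \<in> W \<Longrightarrow> f a \<noteq> 0) \<Longrightarrow>
      (\<lambda>a. inverse (f a)) \<in> regular X W"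
begin

lemma reg_sum:
  assumes "W \<in> opens X" "\<And>i. i \<in> I \<Longrightarrow> f i \<in> regular X W"
  shows "(\<lambda>a. \<Sum>i\<in>I. f i a) \<in> regular X W"
  using assms(2)
proof (induction I rule: infinite_finite_induct)
  case (insert i I)
  then show ?case using reg_add[OF assms(1), of "f i"] by (simp add: insert.hyps)
qed (auto simp: reg_const assms)

lemma reg_prod:
  assumes "W \<in> opens X" "\<And>i. i \<in> I \<Longrightarrow> f i \<in> regular X W"
  shows "(\<lambda>a. \<Prod>i\<in>I. f i a) \<in> regular X W"
  using assms(2)
proof (induction I rule: infinite_finite_induct)
  case (insert i I)
  then show ?case using reg_mult[OF assms(1), of "f i"] by (simp add: insert.hyps)
qed (auto simp: reg_const assms)

lemma reg_divide:
  assumes "W \<in> opens X" "f \<in> regular X W" "h \<in> regular X W" "\<And>a. a \<in> W \<Longrightarrow> h a \<noteq> 0"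
  shows "(\<lambda>a. f a / h a) \<in> regular X W"
  using reg_mult[OF assms(1,2) reg_inverse[OF assms(1,3,4)]] by (simp add: divide_inverse)

lemma reg_polyfun:
  assumes "W \<in> opens X" "\<And>c. c \<in> C \<Longrightarrow> (\<lambda>a. c (\<psi> a)) \<in> regular X W" "P \<in> polyfuns C"
  shows "(\<lambda>a. P (\<psi> a)) \<in> regular X W"
  using assms(3) by induction (auto intro: reg_const reg_add reg_mult assms)

text \<open>The Leibniz formula makes the determinant a polynomial in the entries. The formula is
  only available at points of \<open>W\<close>, where \<open>B a\<close> is known to be square, so
  it is brought in through \<open>reg_cong\<close>.\<close>

lemma reg_det:
  assumes "W \<in> opens X" "\<And>a. a \<in> W \<Longrightarrow> B a \<in> carrier_mat n n"
    "\<And>i j. i < n \<Longrightarrow> j < n \<Longrightarrow> (\<lambda>a. B a $$ (i, j)) \<in> regular X W"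
  shows "(\<lambda>a. det (B a)) \<in> regular X W"
proof (rule reg_cong)
  show "(\<lambda>a. \<Sum>q | q permutes {0..<n}. signof q * (\<Prod>i = 0..<n. B a $$ (i, q i))) \<in> regular X W"
    using assms by (intro reg_sum reg_mult reg_prod reg_const)
      (auto dest: permutes_in_image)
qed (simp add: det_def'[OF assms(2)])

lemma reg_adj_mat:
  assumes "W \<in> opens X" "\<And>a. a \<in> W \<Longrightarrow> B a \<in> carrier_mat n n"
    "\<And>i j. i < n \<Longrightarrow> j < n \<Longrightarrow> (\<lambda>a. B a $$ (i, j)) \<in> regular X W"
    and ij: "i < n" "j < n"
  shows "(\<lambda>a. adj_mat (B a) $$ (i, j)) \<in> regular X W"
proof (rule reg_cong)
  have "(\<lambda>a. det (mat_delete (B a) j i)) \<in> regular X W"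
  proof (rule reg_det[OF assms(1)])
    show "mat_delete (B a) j i \<in> carrier_mat (n - 1) (n - 1)" if "a \<in> W" for a
      using assms(2)[OF that] by (auto simp: mat_delete_def)
    fix i' j' assume *: "i' < n - 1" "j' < n - 1"
    \<comment> \<open>The adjugate entry at \<open>(i, j)\<close> is a cofactor with row
      \<open>j\<close> and column \<open>i\<close> deleted, so row indices from \<open>j\<close> on
      and column indices from \<open>i\<close> on move up by one.\<close>
    let ?i = "if i' < j then i' else Suc i'" and ?j = "if j' < i then j' else Suc j'"
    have "(\<lambda>a. B a $$ (?i, ?j)) \<in> regular X W"
      using * by (intro assms) auto
    then show "(\<lambda>a. mat_delete (B a) j i $$ (i', j')) \<in> regular X W"
      by (rule reg_cong) (use * in \<open>auto simp: mat_delete_def carrier_matD[OF assms(2)]\<close>)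
  qed
  then show "(\<lambda>a. (-1) ^ (j + i) * det (mat_delete (B a) j i)) \<in> regular X W"
    by (intro reg_mult reg_const assms)
qed (use ij in \<open>auto simp: adj_mat_def cofactor_def carrier_matD[OF assms(2)]\<close>)

end

section \<open>Zariski open sets and regular functions on a subset of affine space\<close>

context
  fixes C :: "('u \<Rightarrow> 'k::field) set" and X :: "'u set"
begin

lemma zariski_opensE:
  assumes "W \<in> zariski_opens C X"
  obtains F where "F \<subseteq> polyfuns C" "W = {a \<in> X. \<exists>q\<in>F. q a \<noteq> 0}"
proof -
  have "\<exists>F. F \<subseteq> polyfuns C \<and> W = {a \<in> X. \<exists>q\<in>F. q a \<noteq> 0}"
    using assms by (simp add: zariski_opens_def)
  then show ?thesis using that by (elim exE conjE)
qed

lemma zariski_basic: "q \<in> polyfuns C \<Longrightarrow> {a \<in> X. q a \<noteq> 0} \<in> zariski_opens C X"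
  unfolding zariski_opens_def by (auto intro!: exI[of _ "{q}"])

lemma zariski_Union:
  assumes "\<W> \<subseteq> zariski_opens C X" shows "\<Union>\<W> \<in> zariski_opens C X"
proof -
  \<comment> \<open>An open set may be given by infinitely many polynomials. Taking every polynomial
    whose non-vanishing locus lies in some member of the family avoids choosing a defining set for
    each member.\<close>
  define F where "F = {q \<in> polyfuns C. \<exists>W\<in>\<W>. {a \<in> X. q a \<noteq> 0} \<subseteq> W}"
  have "\<Union>\<W> = {a \<in> X. \<exists>q\<in>F. q a \<noteq> 0}"
  proof (intro equalityI subsetI)
    fix a assume "a \<in> \<Union>\<W>"
    then obtain W where W: "W \<in> \<W>" "a \<in> W" by blast
    have "W \<in> zariski_opens C X" using W(1) assms by (rule subsetD[rotated])
    then obtain F' where F': "F' \<subseteq> polyfuns C" "W = {a \<in> X. \<exists>q\<in>F'. q a \<noteq> 0}"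
      by (rule zariski_opensE)
    have "a \<in> X \<and> (\<exists>q\<in>F'. q a \<noteq> 0)" using W(2) unfolding F'(2) by simp
    then obtain q where q: "q \<in> F'" "q a \<noteq> 0" "a \<in> X" by (elim conjE bexE)
    have "{a \<in> X. q a \<noteq> 0} \<subseteq> W" unfolding F'(2) using q(1) by (intro Collect_mono conjI impI) auto
    then have "q \<in> F" unfolding F_def using F'(1) q(1) W(1) by (intro CollectI conjI bexI[of _ W]) auto
    then show "a \<in> {a \<in> X. \<exists>q\<in>F. q a \<noteq> 0}" using q by blast
  qed (auto simp: F_def)
  moreover have "F \<subseteq> polyfuns C" by (auto simp: F_def)
  ultimately show ?thesis unfolding zariski_opens_def by blast
qed

lemma zariski_Int:
  assumes "W \<in> zariski_opens C X" "W' \<in> zariski_opens C X" shows "W \<inter> W' \<in> zariski_opens C X"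
proof -
  obtain F where F: "F \<subseteq> polyfuns C" "W = {a \<in> X. \<exists>q\<in>F. q a \<noteq> 0}"
    using assms(1) by (rule zariski_opensE)
  obtain F' where F': "F' \<subseteq> polyfuns C" "W' = {a \<in> X. \<exists>q\<in>F'. q a \<noteq> 0}"
    using assms(2) by (rule zariski_opensE)
  \<comment> \<open>Over a field a product is non-zero exactly where both factors are.\<close>
  let ?F = "(\<lambda>(q, q') a. q a * q' a) ` (F \<times> F')"
  have "W \<inter> W' = {a \<in> X. \<exists>q\<in>?F. q a \<noteq> 0}"
    unfolding F(2) F'(2) by (auto simp: bex_simps)
  moreover have "?F \<subseteq> polyfuns C" using F(1) F'(1) by (auto intro: polyfuns.mult)
  ultimately show ?thesis unfolding zariski_opens_def by blast
qed

lemma zariski_regularI: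
  assumes "\<And>a. a \<in> W \<Longrightarrow> \<exists>W' g h. W' \<in> zariski_opens C X \<and> a \<in> W' \<and> W' \<subseteq> W \<and> g \<in> polyfuns C \<and>
     h \<in> polyfuns C \<and> (\<forall>b\<in>W'. h b \<noteq> 0 \<and> f b = g b / h b)"
  shows "f \<in> regular (zariski_space C X) W"
  using assms unfolding zariski_space_def by (simp, metis)

lemma zariski_regularE:
  assumes "f \<in> regular (zariski_space C X) W" "a \<in> W"
  obtains W' g h where "W' \<in> zariski_opens C X" "a \<in> W'" "W' \<subseteq> W" "g \<in> polyfuns C"
     "h \<in> polyfuns C" "\<And>b. b \<in> W' \<Longrightarrow> h b \<noteq> 0" "\<And>b. b \<in> W' \<Longrightarrow> f b = g b / h b"
  using assms unfolding zariski_space_def by fastforce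

lemma zariski_regular_polyfun:
  assumes "W \<in> zariski_opens C X" "q \<in> polyfuns C"
  shows "q \<in> regular (zariski_space C X) W"
  using assms by (intro zariski_regularI exI[of _ W] exI[of _ q] exI[of _ "\<lambda>_. 1"]) (auto intro: polyfuns.const)

lemma zariski_pts: "pts (zariski_space C X) = X"
  and zariski_space_opens: "opens (zariski_space C X) = zariski_opens C X"
  by (simp_all add: zariski_space_def)

text \<open>Every closure property reduces to fractions on small neighbourhoods: two functions are
  compared on the intersection of their neighbourhoods, and the non-vanishing locus is open because
  locally it is that of a numerator.\<close>

lemma zariski_space_with_functions: "space_with_functions (zariski_space C X)"
proof (unfold_locales, unfold zariski_pts zariski_space_opens)
  show "X \<in> zariski_opens C X"
    using zariski_basic[OF polyfuns.const[of 1]] by simp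
  show "W \<subseteq> X" if "W \<in> zariski_opens C X" for W
    using that unfolding zariski_opens_def by auto
  let ?reg = "regular (zariski_space C X)"
  show "f \<in> ?reg W'" if "f \<in> ?reg W" "W' \<in> zariski_opens C X" "W' \<subseteq> W" for f W W'
  proof (rule zariski_regularI)
    fix a assume a: "a \<in> W'"
    then obtain W1 g h where *: "W1 \<in> zariski_opens C X" "a \<in> W1" "W1 \<subseteq> W" "g \<in> polyfuns C"
     "h \<in> polyfuns C" "\<And>b. b \<in> W1 \<Longrightarrow> h b \<noteq> 0" "\<And>b. b \<in> W1 \<Longrightarrow> f b = g b / h b"
      using zariski_regularE[OF \<open>f \<in> ?reg W\<close>, of a] \<open>W' \<subseteq> W\<close> by blast
    note W' = that(2)
    show "\<exists>W1 g h. W1 \<in> zariski_opens C X \<and> a \<in> W1 \<and> W1 \<subseteq> W' \<and> g \<in> polyfuns C \<and>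
     h \<in> polyfuns C \<and> (\<forall>b\<in>W1. h b \<noteq> 0 \<and> f b = g b / h b)"
      using * a W' by (intro exI[of _ "W1 \<inter> W'"] exI[of _ g] exI[of _ h]) (auto intro: zariski_Int)
  qed
  show "f' \<in> ?reg W" if "f \<in> ?reg W" "\<And>a. a \<in> W \<Longrightarrow> f a = f' a" for f f' W
  proof (rule zariski_regularI)
    fix a assume a: "a \<in> W"
    obtain W1 g h where *: "W1 \<in> zariski_opens C X" "a \<in> W1" "W1 \<subseteq> W" "g \<in> polyfuns C"
     "h \<in> polyfuns C" "\<And>b. b \<in> W1 \<Longrightarrow> h b \<noteq> 0" "\<And>b. b \<in> W1 \<Longrightarrow> f b = g b / h b"
      using zariski_regularE[OF \<open>f \<in> ?reg W\<close> a] by blast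
    moreover have "f' b = g b / h b" if "b \<in> W1" for b
      using * that \<open>\<And>a. a \<in> W \<Longrightarrow> f a = f' a\<close>[of b] by auto
    ultimately show "\<exists>W1 g h. W1 \<in> zariski_opens C X \<and> a \<in> W1 \<and> W1 \<subseteq> W \<and> g \<in> polyfuns C \<and>
     h \<in> polyfuns C \<and> (\<forall>b\<in>W1. h b \<noteq> 0 \<and> f' b = g b / h b)"
      by blast
  qed
  show "f \<in> ?reg W" if "\<And>a. a \<in> W \<Longrightarrow> \<exists>W'\<in>zariski_opens C X. a \<in> W' \<and> W' \<subseteq> W \<and> f \<in> ?reg W'" for f W
  proof (rule zariski_regularI)
    fix a assume "a \<in> W"
    then have "\<exists>W'\<in>zariski_opens C X. a \<in> W' \<and> W' \<subseteq> W \<and> f \<in> ?reg W'" by (rule that)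
    then obtain W' where W': "a \<in> W'" "W' \<subseteq> W" "f \<in> ?reg W'" by (elim bexE conjE)
    obtain W1 g h where "W1 \<in> zariski_opens C X" "a \<in> W1" "W1 \<subseteq> W'" "g \<in> polyfuns C"
     "h \<in> polyfuns C" "\<And>b. b \<in> W1 \<Longrightarrow> h b \<noteq> 0" "\<And>b. b \<in> W1 \<Longrightarrow> f b = g b / h b"
      using zariski_regularE[OF W'(3,1)] by blast
    then show "\<exists>W1 g h. W1 \<in> zariski_opens C X \<and> a \<in> W1 \<and> W1 \<subseteq> W \<and> g \<in> polyfuns C \<and>
     h \<in> polyfuns C \<and> (\<forall>b\<in>W1. h b \<noteq> 0 \<and> f b = g b / h b)"
      using W'(2) by blast
  qed
  show "(\<lambda>_. c) \<in> ?reg W" if "W \<in> zariski_opens C X" for c W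
    by (intro zariski_regular_polyfun that polyfuns.const)
  show "(\<lambda>a. f a + f' a) \<in> ?reg W" and "(\<lambda>a. f a * f' a) \<in> ?reg W"
    if "f \<in> ?reg W" "f' \<in> ?reg W" for f f' W
  proof -
    have "\<exists>W1 g h g' h'. W1 \<in> zariski_opens C X \<and> a \<in> W1 \<and> W1 \<subseteq> W \<and> g \<in> polyfuns C \<and> g' \<in> polyfuns C \<and>
     h \<in> polyfuns C \<and> h' \<in> polyfuns C \<and> (\<forall>b\<in>W1. h b \<noteq> 0 \<and> f b = g b / h b \<and> h' b \<noteq> 0 \<and> f' b = g' b / h' b)"
      if a: "a \<in> W" for a
    proof -
      obtain W1 g h where *: "W1 \<in> zariski_opens C X" "a \<in> W1" "W1 \<subseteq> W" "g \<in> polyfuns C"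
       "h \<in> polyfuns C" "\<And>b. b \<in> W1 \<Longrightarrow> h b \<noteq> 0" "\<And>b. b \<in> W1 \<Longrightarrow> f b = g b / h b"
        using zariski_regularE[OF \<open>f \<in> ?reg W\<close> a] by blast
      obtain W1' g' h' where **: "W1' \<in> zariski_opens C X" "a \<in> W1'" "W1' \<subseteq> W" "g' \<in> polyfuns C"
       "h' \<in> polyfuns C" "\<And>b. b \<in> W1' \<Longrightarrow> h' b \<noteq> 0" "\<And>b. b \<in> W1' \<Longrightarrow> f' b = g' b / h' b"
        using zariski_regularE[OF \<open>f' \<in> ?reg W\<close> a] by blast
      show ?thesis
        using * ** by (intro exI[of _ "W1 \<inter> W1'"] exI[of _ g] exI[of _ g'] exI[of _ h] exI[of _ h'])
          (auto intro: zariski_Int)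
    qed note common = this
    show "(\<lambda>a. f a + f' a) \<in> ?reg W"
    proof (rule zariski_regularI)
      fix a assume a: "a \<in> W"
      obtain W1 g h g' h' where *: "W1 \<in> zariski_opens C X" "a \<in> W1" "W1 \<subseteq> W" "g \<in> polyfuns C" "g' \<in> polyfuns C"
        "h \<in> polyfuns C" "h' \<in> polyfuns C" "\<forall>b\<in>W1. h b \<noteq> 0 \<and> f b = g b / h b \<and> h' b \<noteq> 0 \<and> f' b = g' b / h' b"
        using common[OF a] by metis
      show "\<exists>W' g h. W' \<in> zariski_opens C X \<and> a \<in> W' \<and> W' \<subseteq> W \<and> g \<in> polyfuns C \<and>
         h \<in> polyfuns C \<and> (\<forall>b\<in>W'. h b \<noteq> 0 \<and> f b + f' b = g b / h b)"
        using * by (intro exI[of _ W1] exI[of _ "\<lambda>a. g a * h' a + g' a * h a"] exI[of _ "\<lambda>a. h a * h' a"])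
          (auto intro: polyfuns.intros simp: add_frac_eq)
    qed
    show "(\<lambda>a. f a * f' a) \<in> ?reg W"
    proof (rule zariski_regularI)
      fix a assume a: "a \<in> W"
      obtain W1 g h g' h' where *: "W1 \<in> zariski_opens C X" "a \<in> W1" "W1 \<subseteq> W" "g \<in> polyfuns C" "g' \<in> polyfuns C"
        "h \<in> polyfuns C" "h' \<in> polyfuns C" "\<forall>b\<in>W1. h b \<noteq> 0 \<and> f b = g b / h b \<and> h' b \<noteq> 0 \<and> f' b = g' b / h' b"
        using common[OF a] by metis
      show "\<exists>W' g h. W' \<in> zariski_opens C X \<and> a \<in> W' \<and> W' \<subseteq> W \<and> g \<in> polyfuns C \<and>
         h \<in> polyfuns C \<and> (\<forall>b\<in>W'. h b \<noteq> 0 \<and> f b * f' b = g b / h b)"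
        using * by (intro exI[of _ W1] exI[of _ "\<lambda>a. g a * g' a"] exI[of _ "\<lambda>a. h a * h' a"])
          (auto intro: polyfuns.intros)
    qed
  qed
  show "{a \<in> W. f a \<noteq> 0} \<in> zariski_opens C X" if "f \<in> ?reg W" for f W
  proof -
    have "\<exists>W'\<in>zariski_opens C X. a \<in> W' \<and> W' \<subseteq> {a \<in> W. f a \<noteq> 0}" if a: "a \<in> W" "f a \<noteq> 0" for a
    proof -
      obtain W1 g h where *: "W1 \<in> zariski_opens C X" "a \<in> W1" "W1 \<subseteq> W" "g \<in> polyfuns C"
       "h \<in> polyfuns C" "\<And>b. b \<in> W1 \<Longrightarrow> h b \<noteq> 0" "\<And>b. b \<in> W1 \<Longrightarrow> f b = g b / h b"
        using zariski_regularE[OF \<open>f \<in> ?reg W\<close> a(1)] by blast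
      have "W1 \<subseteq> X" using *(1) unfolding zariski_opens_def by auto
      then have "W1 \<inter> {a \<in> X. g a \<noteq> 0} \<subseteq> {a \<in> W. f a \<noteq> 0}" "a \<in> W1 \<inter> {a \<in> X. g a \<noteq> 0}"
        using * a by auto
      then show ?thesis
        using zariski_Int[OF *(1) zariski_basic[OF *(4)]] by (intro bexI[of _ "W1 \<inter> {a \<in> X. g a \<noteq> 0}"]) auto
    qed
    then have "{a \<in> W. f a \<noteq> 0} = \<Union>{W' \<in> zariski_opens C X. W' \<subseteq> {a \<in> W. f a \<noteq> 0}}" by blast
    then show ?thesis
      using zariski_Union[of "{W' \<in> zariski_opens C X. W' \<subseteq> {a \<in> W. f a \<noteq> 0}}"] by auto
  qed
  show "(\<lambda>a. inverse (f a)) \<in> ?reg W" if "f \<in> ?reg W" "\<And>a. a \<in> W \<Longrightarrow> f a \<noteq> 0" for f W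
  proof (rule zariski_regularI)
    fix a assume a: "a \<in> W"
    obtain W1 g h where *: "W1 \<in> zariski_opens C X" "a \<in> W1" "W1 \<subseteq> W" "g \<in> polyfuns C"
     "h \<in> polyfuns C" "\<And>b. b \<in> W1 \<Longrightarrow> h b \<noteq> 0" "\<And>b. b \<in> W1 \<Longrightarrow> f b = g b / h b"
      using zariski_regularE[OF \<open>f \<in> ?reg W\<close> a] by blast
    \<comment> \<open>A nowhere vanishing fraction has a nowhere vanishing numerator, so the
      fraction can be inverted.\<close>
    have "g b \<noteq> 0" if "b \<in> W1" for b
      using *(7)[OF that] \<open>\<And>a. a \<in> W \<Longrightarrow> f a \<noteq> 0\<close>[of b] subsetD[OF *(3) that] by auto
    with *(7) show "\<exists>W' g h. W' \<in> zariski_opens C X \<and> a \<in> W' \<and> W' \<subseteq> W \<and> g \<in> polyfuns C \<and>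
     h \<in> polyfuns C \<and> (\<forall>b\<in>W'. h b \<noteq> 0 \<and> inverse (f b) = g b / h b)"
      using *(1-5) by (intro exI[of _ W1] exI[of _ h] exI[of _ g]) simp
  qed
qed (fact zariski_Int zariski_Union)+

end

section \<open>Quotients and morphisms\<close>

lemma quotient_pts: "pts (quotient_space \<pi> X) = \<pi> ` pts X"
  and quotient_opens: "W \<in> opens (quotient_space \<pi> X) \<longleftrightarrow>
    W \<subseteq> \<pi> ` pts X \<and> {a \<in> pts X. \<pi> a \<in> W} \<in> opens X"
  and quotient_regular: "f \<in> regular (quotient_space \<pi> X) W \<longleftrightarrow>
    (\<lambda>a. f (\<pi> a)) \<in> regular X {a \<in> pts X. \<pi> a \<in> W}"
  by (simp_all add: quotient_space_def)

lemma morphism_pts: "morphism X Y \<phi> \<Longrightarrow> a \<in> pts X \<Longrightarrow> \<phi> a \<in> pts Y"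
  unfolding morphism_def by auto

lemma morphism_open: "morphism X Y \<phi> \<Longrightarrow> W \<in> opens Y \<Longrightarrow> {a \<in> pts X. \<phi> a \<in> W} \<in> opens X"
  unfolding morphism_def by simp

lemma morphism_regular:
  assumes "morphism X Y \<phi>" "W \<in> opens Y" "f \<in> regular Y W"
  shows "(\<lambda>a. f (\<phi> a)) \<in> regular X {a \<in> pts X. \<phi> a \<in> W}"
proof -
  have "\<forall>f\<in>regular Y W. (\<lambda>a. f (\<phi> a)) \<in> regular X {a \<in> pts X. \<phi> a \<in> W}"
    using assms(1,2) unfolding morphism_def by simp
  from bspec[OF this assms(3)] show ?thesis .
qed

context space_with_functions
begin

text \<open>Open sets and regular functions of the quotient are defined by pullback, so each
  property is that of \<open>X\<close>, applied to preimages.\<close>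

lemma quotient_space_with_functions: "space_with_functions (quotient_space \<pi> X)" (is "space_with_functions ?Q")
proof
  show "W \<subseteq> pts ?Q" if "W \<in> opens ?Q" for W
    using that unfolding quotient_opens quotient_pts by blast
  show "pts ?Q \<in> opens ?Q"
  proof -
    have "{a \<in> pts X. \<pi> a \<in> \<pi> ` pts X} = pts X" by auto
    then show ?thesis using pts_open unfolding quotient_opens quotient_pts by simp
  qed
  show "W \<inter> W' \<in> opens ?Q" if "W \<in> opens ?Q" "W' \<in> opens ?Q" for W W'
  proof -
    have "{a \<in> pts X. \<pi> a \<in> W \<inter> W'} = {a \<in> pts X. \<pi> a \<in> W} \<inter> {a \<in> pts X. \<pi> a \<in> W'}" by auto
    then show ?thesis using that open_Int unfolding quotient_opens by auto
  qed
  show "\<Union>\<W> \<in> opens ?Q" if "\<W> \<subseteq> opens ?Q" for \<W>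
  proof -
    have "{a \<in> pts X. \<pi> a \<in> \<Union>\<W>} = \<Union>((\<lambda>W. {a \<in> pts X. \<pi> a \<in> W}) ` \<W>)" by auto
    moreover have "(\<lambda>W. {a \<in> pts X. \<pi> a \<in> W}) ` \<W> \<subseteq> opens X"
      using that quotient_opens by blast
    ultimately have "{a \<in> pts X. \<pi> a \<in> \<Union>\<W>} \<in> opens X"
      using open_Union[of "(\<lambda>W. {a \<in> pts X. \<pi> a \<in> W}) ` \<W>"] by simp
    moreover have "\<Union>\<W> \<subseteq> \<pi> ` pts X" using that quotient_opens by blast
    ultimately show ?thesis unfolding quotient_opens by simp
  qed
  show "f \<in> regular ?Q W'" if "f \<in> regular ?Q W" "W \<in> opens ?Q" "W' \<in> opens ?Q" "W' \<subseteq> W" for f W W'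
    unfolding quotient_regular
    by (rule reg_restrict[OF that(1)[unfolded quotient_regular]])
      (use that(2-4) in \<open>auto simp: quotient_opens\<close>)
  show "f' \<in> regular ?Q W" if "f \<in> regular ?Q W" "\<And>a. a \<in> W \<Longrightarrow> f a = f' a" for f f' W
    unfolding quotient_regular
    by (rule reg_cong[OF that(1)[unfolded quotient_regular]]) (use that(2) in auto)
  show "f \<in> regular ?Q W"
    if W: "W \<in> opens ?Q"
      and *: "\<And>a. a \<in> W \<Longrightarrow> \<exists>W'\<in>opens ?Q. a \<in> W' \<and> W' \<subseteq> W \<and> f \<in> regular ?Q W'" for f W
    unfolding quotient_regular
  proof (rule reg_local)
    fix a assume "a \<in> {a \<in> pts X. \<pi> a \<in> W}"
    then have a: "a \<in> pts X" "\<pi> a \<in> W" by auto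
    obtain W' where "{a \<in> pts X. \<pi> a \<in> W'} \<in> opens X" "\<pi> a \<in> W'" "W' \<subseteq> W"
      "(\<lambda>a. f (\<pi> a)) \<in> regular X {a \<in> pts X. \<pi> a \<in> W'}"
      using *[OF a(2)] unfolding quotient_regular by (auto simp: quotient_opens)
    then show "\<exists>W'\<in>opens X. a \<in> W' \<and> W' \<subseteq> {a \<in> pts X. \<pi> a \<in> W} \<and> (\<lambda>a. f (\<pi> a)) \<in> regular X W'"
      using a by (intro bexI[of _ "{a \<in> pts X. \<pi> a \<in> W'}"]) auto
  qed (use W in \<open>simp add: quotient_opens\<close>)
  show "{a \<in> W. f a \<noteq> 0} \<in> opens ?Q" if "W \<in> opens ?Q" "f \<in> regular ?Q W" for f W
    using reg_nonzero[of "{a \<in> pts X. \<pi> a \<in> W}"] that unfolding quotient_opens quotient_regular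
    by (auto simp: conj_assoc)
  show "(\<lambda>a. inverse (f a)) \<in> regular ?Q W"
    if "W \<in> opens ?Q" "f \<in> regular ?Q W" "\<And>a. a \<in> W \<Longrightarrow> f a \<noteq> 0" for f W
    unfolding quotient_regular
    by (rule reg_inverse) (use that in \<open>auto simp: quotient_opens quotient_regular\<close>)
qed (auto simp: quotient_opens quotient_regular intro: reg_const reg_add reg_mult)

text \<open>A map into a subset of affine space is a morphism once its coordinates are regular: the
  preimage of an open set is a union of non-vanishing loci of pulled back polynomials, and a local
  fraction pulls back to a quotient of regular functions.\<close>

lemma morphism_zariski:
  assumes W: "W \<in> opens X" and \<psi>: "\<psi> ` W \<subseteq> Y"
    and C: "\<And>c. c \<in> C \<Longrightarrow> (\<lambda>a. c (\<psi> a)) \<in> regular X W"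
  shows "morphism (open_subspace X W) (zariski_space C Y) \<psi>"
  unfolding morphism_def zariski_pts zariski_space_opens
proof (intro conjI ballI)
  have poly: "(\<lambda>a. P (\<psi> a)) \<in> regular X W" if "P \<in> polyfuns C" for P
    by (rule reg_polyfun[OF W _ that]) (rule C)
  show "\<psi> ` pts (open_subspace X W) \<subseteq> Y" using \<psi> by (simp add: open_subspace_def)
  have op: "{a \<in> W. \<psi> a \<in> V} \<in> opens X" if "V \<in> zariski_opens C Y" for V
  proof -
    obtain F where F: "F \<subseteq> polyfuns C" "V = {a \<in> Y. \<exists>q\<in>F. q a \<noteq> 0}"
      using \<open>V \<in> zariski_opens C Y\<close> by (rule zariski_opensE)
    have "{a \<in> W. \<psi> a \<in> V} = \<Union>((\<lambda>q. {a \<in> W. q (\<psi> a) \<noteq> 0}) ` F)"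
      unfolding F(2) using \<psi> by (auto simp: image_subset_iff)
    moreover have "(\<lambda>q. {a \<in> W. q (\<psi> a) \<noteq> 0}) ` F \<subseteq> opens X"
    proof (rule image_subsetI)
      fix q assume "q \<in> F"
      then have "q \<in> polyfuns C" using F(1) by (rule subsetD[rotated])
      then have "(\<lambda>a. q (\<psi> a)) \<in> regular X W" by (rule poly)
      then show "{a \<in> W. q (\<psi> a) \<noteq> 0} \<in> opens X" by (rule reg_nonzero[OF W])
    qed
    ultimately show ?thesis using open_Union[of "(\<lambda>q. {a \<in> W. q (\<psi> a) \<noteq> 0}) ` F"] by simp
  qed
  fix V assume V: "V \<in> zariski_opens C Y"
  show "{a \<in> pts (open_subspace X W). \<psi> a \<in> V} \<in> opens (open_subspace X W)"
    using op[OF V] by (auto simp: open_subspace_def)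
  fix f assume f: "f \<in> regular (zariski_space C Y) V"
  have "(\<lambda>a. f (\<psi> a)) \<in> regular X {a \<in> W. \<psi> a \<in> V}"
  proof (rule reg_local[OF op[OF V]])
    fix a assume "a \<in> {a \<in> W. \<psi> a \<in> V}"
    then have a: "a \<in> W" "\<psi> a \<in> V" by auto
    obtain W' g h where *: "W' \<in> zariski_opens C Y" "\<psi> a \<in> W'" "W' \<subseteq> V" "g \<in> polyfuns C"
     "h \<in> polyfuns C" "\<And>b. b \<in> W' \<Longrightarrow> h b \<noteq> 0" "\<And>b. b \<in> W' \<Longrightarrow> f b = g b / h b"
      using zariski_regularE[OF f a(2)] by blast
    let ?W = "{a \<in> W. \<psi> a \<in> W'}"
    have "(\<lambda>a. g (\<psi> a) / h (\<psi> a)) \<in> regular X ?W"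
      using * op[OF *(1)] W by (intro reg_divide reg_restrict[OF poly[OF _] W]) auto
    then have "(\<lambda>a. f (\<psi> a)) \<in> regular X ?W"
      by (rule reg_cong) (use * in auto)
    then show "\<exists>W'\<in>opens X. a \<in> W' \<and> W' \<subseteq> {a \<in> W. \<psi> a \<in> V} \<and> (\<lambda>a. f (\<psi> a)) \<in> regular X W'"
      using op[OF *(1)] * a by (intro bexI[of _ ?W]) auto
  qed
  then show "(\<lambda>a. f (\<psi> a)) \<in> regular (open_subspace X W) {a \<in> pts (open_subspace X W). \<psi> a \<in> V}"
    by (simp add: open_subspace_def)
qed

lemma open_subspace_pts: "morphism (open_subspace X (pts X)) Y \<psi> \<longleftrightarrow> morphism X Y \<psi>"
  using opens_subset by (auto simp: open_subspace_def morphism_def)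

lemma morphism_local:
  assumes W: "W \<in> opens X" and "W = \<Union>\<W>" "\<W> \<subseteq> opens X"
    and m: "\<And>W'. W' \<in> \<W> \<Longrightarrow> morphism (open_subspace X W') Y \<psi>"
  shows "morphism (open_subspace X W) Y \<psi>"
  unfolding morphism_def
proof (intro conjI ballI)
  show "\<psi> ` pts (open_subspace X W) \<subseteq> pts Y"
    using m assms(2) unfolding morphism_def by (fastforce simp: open_subspace_def)
  fix V assume V: "V \<in> opens Y"
  have 1: "{a \<in> W'. \<psi> a \<in> V} \<in> opens X" if "W' \<in> \<W>" for W'
    using m[OF that] V unfolding morphism_def by (simp add: open_subspace_def)
  have "{a \<in> W. \<psi> a \<in> V} = \<Union>((\<lambda>W'. {a \<in> W'. \<psi> a \<in> V}) ` \<W>)" using assms(2) by auto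
  then have op: "{a \<in> W. \<psi> a \<in> V} \<in> opens X"
    using open_Union[of "(\<lambda>W'. {a \<in> W'. \<psi> a \<in> V}) ` \<W>"] 1 by auto
  then show "{a \<in> pts (open_subspace X W). \<psi> a \<in> V} \<in> opens (open_subspace X W)"
    by (auto simp: open_subspace_def)
  fix f assume f: "f \<in> regular Y V"
  have "(\<lambda>a. f (\<psi> a)) \<in> regular X {a \<in> W. \<psi> a \<in> V}"
  proof (rule reg_local[OF op])
    fix a assume "a \<in> {a \<in> W. \<psi> a \<in> V}"
    then obtain W' where W': "W' \<in> \<W>" "a \<in> W'" "\<psi> a \<in> V" using assms(2) by auto
    have "(\<lambda>a. f (\<psi> a)) \<in> regular X {a \<in> W'. \<psi> a \<in> V}"
      using m[OF W'(1)] V f unfolding morphism_def by (simp add: open_subspace_def)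
    then show "\<exists>W'\<in>opens X. a \<in> W' \<and> W' \<subseteq> {a \<in> W. \<psi> a \<in> V} \<and> (\<lambda>a. f (\<psi> a)) \<in> regular X W'"
      using 1[OF W'(1)] W' assms(2) by (intro bexI[of _ "{a \<in> W'. \<psi> a \<in> V}"]) auto
  qed
  then show "(\<lambda>a. f (\<psi> a)) \<in> regular (open_subspace X W) {a \<in> pts (open_subspace X W). \<psi> a \<in> V}"
    by (simp add: open_subspace_def)
qed

text \<open>The two preimages of a set along the commuting square with \<open>\<psi>\<close>
  upstairs and \<open>\<psi>'\<close> downstairs agree, and openness and regularity downstairs are
  tested upstairs.\<close>

lemma morphism_quotient:
  assumes "space_with_functions Y" "morphism X Y \<psi>" "\<And>a. a \<in> pts X \<Longrightarrow> \<psi>' (\<pi> a) = \<pi>' (\<psi> a)"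
  shows "morphism (quotient_space \<pi> X) (quotient_space \<pi>' Y) \<psi>'"
  unfolding morphism_def
proof (intro conjI ballI)
  have im: "\<psi> a \<in> pts Y" if "a \<in> pts X" for a using assms that unfolding morphism_def by auto
  then show im': "\<psi>' ` pts (quotient_space \<pi> X) \<subseteq> pts (quotient_space \<pi>' Y)"
    using assms(3) by (auto simp: quotient_pts)
  fix V assume V: "V \<in> opens (quotient_space \<pi>' Y)"
  let ?V = "{b \<in> pts Y. \<pi>' b \<in> V}"
  have eq: "{a \<in> pts X. \<pi> a \<in> {a \<in> pts (quotient_space \<pi> X). \<psi>' a \<in> V}} = {a \<in> pts X. \<psi> a \<in> ?V}"
    using im assms(3) by (auto 0 3 simp: quotient_pts) (metis assms(3))
  have "{a \<in> pts X. \<psi> a \<in> ?V} \<in> opens X"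
    by (rule morphism_open[OF assms(2)]) (use V in \<open>simp add: quotient_opens\<close>)
  then have "{a \<in> pts X. \<pi> a \<in> {a \<in> pts (quotient_space \<pi> X). \<psi>' a \<in> V}} \<in> opens X"
    unfolding eq .
  then show "{a \<in> pts (quotient_space \<pi> X). \<psi>' a \<in> V} \<in> opens (quotient_space \<pi> X)"
    unfolding quotient_opens by (simp add: quotient_pts)
  fix f assume "f \<in> regular (quotient_space \<pi>' Y) V"
  then have "(\<lambda>a. f (\<pi>' a)) \<in> regular Y ?V" by (simp add: quotient_regular)
  then have "(\<lambda>a. f (\<pi>' (\<psi> a))) \<in> regular X {a \<in> pts X. \<psi> a \<in> ?V}"
    using morphism_regular[OF assms(2)] V unfolding quotient_opens by blast
  then have "(\<lambda>a. f (\<psi>' (\<pi> a))) \<in> regular X {a \<in> pts X. \<psi> a \<in> ?V}"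
    by (rule reg_cong) (use assms(3) in auto)
  then show "(\<lambda>a. f (\<psi>' a)) \<in> regular (quotient_space \<pi> X) {a \<in> pts (quotient_space \<pi> X). \<psi>' a \<in> V}"
    unfolding quotient_regular eq by simp
qed

lemma morphism_to_quotient: "morphism X (quotient_space \<pi> X) \<pi>"
  unfolding morphism_def by (auto simp: quotient_pts quotient_opens quotient_regular)

end

lemma morphism_comp:
  assumes "morphism X Y \<phi>" "morphism Y Z \<psi>"
  shows "morphism X Z (\<lambda>a. \<psi> (\<phi> a))"
  unfolding morphism_def
proof (intro conjI ballI)
  show "(\<lambda>a. \<psi> (\<phi> a)) ` pts X \<subseteq> pts Z"
    using morphism_pts[OF assms(1)] morphism_pts[OF assms(2)] by blast
  fix W assume W: "W \<in> opens Z"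
  let ?V = "{b \<in> pts Y. \<psi> b \<in> W}"
  have eq: "{a \<in> pts X. \<psi> (\<phi> a) \<in> W} = {a \<in> pts X. \<phi> a \<in> ?V}"
    using morphism_pts[OF assms(1)] by auto
  show "{a \<in> pts X. \<psi> (\<phi> a) \<in> W} \<in> opens X"
    unfolding eq by (intro morphism_open[OF assms(1)] morphism_open[OF assms(2)] W)
  fix f assume "f \<in> regular Z W"
  then show "(\<lambda>a. f (\<psi> (\<phi> a))) \<in> regular X {a \<in> pts X. \<psi> (\<phi> a) \<in> W}"
    unfolding eq by (intro morphism_regular[OF assms(1) morphism_open[OF assms(2) W]]
        morphism_regular[OF assms(2) W])
qed

section \<open>Matrices of full column rank\<close>

lemma mult_mat_vec_index:
  assumes "A \<in> carrier_mat nr nc" "v \<in> carrier_vec nc" "i < nr"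
  shows "(A *\<^sub>v v) $ i = (\<Sum>j<nc. A $$ (i, j) * v $ j)"
  using assms by (auto simp: scalar_prod_def lessThan_atLeast0 intro!: sum.cong)

lemma mult_mat_index:
  assumes "A \<in> carrier_mat nr n" "B \<in> carrier_mat n nc" "i < nr" "j < nc"
  shows "(A * B) $$ (i, j) = (\<Sum>k<n. A $$ (i, k) * B $$ (k, j))"
  using assms by (auto simp: scalar_prod_def lessThan_atLeast0 intro!: sum.cong)

text \<open>The column space is handled through the set of columns, so repeated columns need
  separate care. If columns \<open>i\<close> and \<open>j\<close> coincide, both sides fail: fewer
  than \<open>nc\<close> columns remain in the set, and the difference of the two unit vectors lies
  in the kernel.\<close>

lemma (in vec_space) rank_eq_nc_iff:
  assumes A: "A \<in> carrier_mat n nc"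
  shows "rank A = nc \<longleftrightarrow> (\<forall>v\<in>carrier_vec nc. A *\<^sub>v v = 0\<^sub>v n \<longrightarrow> v = 0\<^sub>v nc)" (is "_ \<longleftrightarrow> ?K")
proof (cases "distinct (cols A)")
  case True
  then show ?thesis
    using lin_indpt_full_rank[OF A True] full_rank_lin_indpt[OF A _ True]
      lin_depI[OF A _ _ _ True] lin_depE[OF A _ True] by metis
next
  case False
  have "rank A \<noteq> nc"
  proof
    assume "rank A = nc"
    obtain S where S: "maximal S (\<lambda>T. T \<subseteq> set (cols A) \<and> lin_indpt T)"
      using maximal_exists[of "(\<lambda>T. T \<subseteq> set (cols A) \<and> lin_indpt T)" "card (set (cols A))" "{}"]
      by (meson List.finite_set card_mono empty_iff empty_subsetI finite_lin_indpt2 rev_finite_subset)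
    then have "card S \<le> card (set (cols A))" by (simp add: card_mono maximal_def)
    also have "\<dots> < nc"
      using A False card_distinct[of "cols A"] card_length[of "cols A"] by (auto simp: le_less)
    finally show False using rank_card_indpt[OF A S] \<open>rank A = nc\<close> by simp
  qed
  moreover have "\<not> ?K"
  proof
    assume K: ?K
    obtain i j where ij: "i < nc" "j < nc" "i \<noteq> j" "col A i = col A j"
      using False A by (auto simp: distinct_conv_nth)
    let ?v = "unit_vec nc i - unit_vec nc j :: 'a vec"
    have unit: "A *\<^sub>v unit_vec nc k = col A k" if "k < nc" for k
      using A that by (intro eq_vecI) (auto simp: scalar_prod_right_unit)
    have "A *\<^sub>v ?v = A *\<^sub>v unit_vec nc i - A *\<^sub>v unit_vec nc j"
      using A by (intro mult_minus_distrib_mat_vec) auto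
    also have "\<dots> = 0\<^sub>v n"
      using A ij(1,2,4) by (simp add: unit)
    finally have "?v = 0\<^sub>v nc" using K by auto
    then have "?v $ i = 0" using ij by simp
    then show False using ij by simp
  qed
  ultimately show ?thesis by simp
qed

lemma full_rank_mats_iff:
  "A \<in> full_rank_mats n r \<longleftrightarrow> A \<in> carrier_mat n r \<and>
     (\<forall>v\<in>carrier_vec r. A *\<^sub>v v = 0\<^sub>v n \<longrightarrow> v = 0\<^sub>v r)"
  unfolding full_rank_mats_def using vec_space.rank_eq_nc_iff by auto

lemma det_nonzero_iff_kernel:
  fixes A :: "'k::field mat"
  assumes "A \<in> carrier_mat n n"
  shows "det A \<noteq> 0 \<longleftrightarrow> (\<forall>v\<in>carrier_vec n. A *\<^sub>v v = 0\<^sub>v n \<longrightarrow> v = 0\<^sub>v n)"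
  using det_0_iff_vec_prod_zero_field[OF assms] by auto

lemma wide_mat_kernel:
  fixes A :: "'k::field mat"
  assumes A: "A \<in> carrier_mat m c" and "m < c"
  shows "\<exists>v\<in>carrier_vec c. v \<noteq> 0\<^sub>v c \<and> A *\<^sub>v v = 0\<^sub>v m"
proof -
  \<comment> \<open>Padding with zero rows makes the matrix square and singular without changing its
    kernel.\<close>
  define B where "B = mat c c (\<lambda>(i, j). if i < m then A $$ (i, j) else 0)"
  have B: "B \<in> carrier_mat c c" by (simp add: B_def)
  have "row B m = 0\<^sub>v c" using \<open>m < c\<close> by (auto simp: B_def)
  then have "det B = 0"
    using laplace_expansion_row[OF B \<open>m < c\<close>] \<open>m < c\<close> by (simp add: B_def)
  then obtain v where v: "v \<in> carrier_vec c" "v \<noteq> 0\<^sub>v c" "B *\<^sub>v v = 0\<^sub>v c"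
    using det_0_iff_vec_prod_zero_field[OF B] by auto
  have "A *\<^sub>v v = 0\<^sub>v m"
  proof (rule eq_vecI)
    fix i assume i: "i < dim_vec (0\<^sub>v m :: 'k vec)"
    then have "(A *\<^sub>v v) $ i = (B *\<^sub>v v) $ i"
      using \<open>m < c\<close> by (simp add: mult_mat_vec_index[OF A v(1)] mult_mat_vec_index[OF B v(1)]) (simp add: B_def)
    then show "(A *\<^sub>v v) $ i = 0\<^sub>v m $ i" using i v \<open>m < c\<close> by simp
  qed (use A in auto)
  then show ?thesis using v by blast
qed

lemma pick_bij_betw:
  assumes "finite S" shows "bij_betw (pick S) {..<card S} S"
proof -
  have "inj_on (pick S) {..<card S}"
    by (intro inj_onI) (metis card_pick lessThan_iff)
  moreover have "pick S ` {..<card S} \<subseteq> S" using pick_in_set by auto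
  ultimately show ?thesis
    using assms by (metis bij_betw_def card_image card_lessThan card_subset_eq)
qed

section \<open>Row selections and non-vanishing minors\<close>

context
  fixes n :: nat and \<Sigma> :: "nat set"
  assumes \<Sigma>: "\<Sigma> \<subseteq> {..<n}"
begin

lemma row_select_carrier:
  assumes "A \<in> carrier_mat n r"
  shows "submatrix A \<Sigma> UNIV \<in> carrier_mat (card \<Sigma>) r"
proof -
  have "{i. i < dim_row A \<and> i \<in> \<Sigma>} = \<Sigma>" "{j. j < dim_col A} = {..<r}" using assms \<Sigma> by auto
  then show ?thesis by (intro carrier_matI) (simp_all add: dim_submatrix)
qed

lemma row_select_index:
  assumes "A \<in> carrier_mat n r" "i < card \<Sigma>" "j < r"
  shows "submatrix A \<Sigma> UNIV $$ (i, j) = A $$ (pick \<Sigma> i, j)"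
proof -
  have "{i. i < dim_row A \<and> i \<in> \<Sigma>} = \<Sigma>" "{j. j < dim_col A} = {..<r}" using assms \<Sigma> by auto
  then show ?thesis using assms by (subst submatrix_index) (simp_all add: pick_UNIV)
qed

lemma pick_less: "i < card \<Sigma> \<Longrightarrow> pick \<Sigma> i < n"
  using pick_in_set \<Sigma> by blast

lemma row_select_mult:
  assumes A: "(A :: 'k::field mat) \<in> carrier_mat n r" and C: "C \<in> carrier_mat r c"
  shows "submatrix (A * C) \<Sigma> UNIV = submatrix A \<Sigma> UNIV * C"
proof (rule eq_matI)
  note S = row_select_carrier[OF A] and AC = mult_carrier_mat[OF A C]
  note SC = mult_carrier_mat[OF S C]
  fix i j assume "i < dim_row (submatrix A \<Sigma> UNIV * C)" "j < dim_col (submatrix A \<Sigma> UNIV * C)"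
  then have ij: "i < card \<Sigma>" "j < c" using SC by auto
  show "submatrix (A * C) \<Sigma> UNIV $$ (i, j) = (submatrix A \<Sigma> UNIV * C) $$ (i, j)"
    using row_select_index[OF A ij(1)]
    by (simp add: row_select_index[OF AC ij] mult_mat_index[OF S C ij]
        mult_mat_index[OF A C pick_less[OF ij(1)] ij(2)])
qed (use row_select_carrier[OF mult_carrier_mat[OF A C]] mult_carrier_mat[OF row_select_carrier[OF A] C] in auto)

lemma row_select_mult_vec:
  assumes A: "(A :: 'k::field mat) \<in> carrier_mat n r" and v: "v \<in> carrier_vec r" and "i < card \<Sigma>"
  shows "(submatrix A \<Sigma> UNIV *\<^sub>v v) $ i = (A *\<^sub>v v) $ pick \<Sigma> i"
  using row_select_index[OF A \<open>i < card \<Sigma>\<close>]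
  by (simp add: mult_mat_vec_index[OF row_select_carrier[OF A] v \<open>i < card \<Sigma>\<close>]
      mult_mat_vec_index[OF A v pick_less[OF \<open>i < card \<Sigma>\<close>]])

end

lemma full_rank_matsI_row_select:
  assumes A: "(A :: 'k::field mat) \<in> carrier_mat n r" and \<Sigma>: "\<Sigma> \<in> index_sets n r"
    and det: "det (submatrix A \<Sigma> UNIV) \<noteq> 0"
  shows "A \<in> full_rank_mats n r"
  unfolding full_rank_mats_iff
proof (intro conjI ballI impI A)
  fix v assume v: "v \<in> carrier_vec r" "A *\<^sub>v v = 0\<^sub>v n"
  have \<Sigma>': "\<Sigma> \<subseteq> {..<n}" "card \<Sigma> = r" using \<Sigma> by (auto simp: index_sets_def)
  have S: "submatrix A \<Sigma> UNIV \<in> carrier_mat r r" using row_select_carrier[OF \<Sigma>'(1) A] \<Sigma>' by simp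
  have "submatrix A \<Sigma> UNIV *\<^sub>v v = 0\<^sub>v r"
  proof (rule eq_vecI)
    fix i assume "i < dim_vec (0\<^sub>v r :: 'k vec)"
    then show "(submatrix A \<Sigma> UNIV *\<^sub>v v) $ i = 0\<^sub>v r $ i"
      using row_select_mult_vec[OF \<Sigma>'(1) A v(1), of i] pick_less[OF \<Sigma>'(1), of i] \<Sigma>'(2) v(2) by simp
  qed (use S in auto)
  then show "v = 0\<^sub>v r" using det det_nonzero_iff_kernel[OF S] v(1) by blast
qed

text \<open>The rows are chosen as a smallest set on which \<open>A\<close> is still injective.
  Fewer than \<open>r\<close> rows would leave a kernel; more than \<open>r\<close> rows contradict
  minimality, because each row would carry a vector detected by that row alone, which gives too many
  independent vectors in dimension \<open>r\<close>.\<close>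

lemma full_rank_mats_row_select:
  assumes "(A :: 'k::field mat) \<in> full_rank_mats n r"
  shows "\<exists>\<Sigma>\<in>index_sets n r. det (submatrix A \<Sigma> UNIV) \<noteq> 0"
proof -
  have A: "A \<in> carrier_mat n r" using assms full_rank_mats_iff by blast
  \<comment> \<open>\<open>K \<Sigma>\<close> says that the rows in \<open>\<Sigma>\<close> alone
    already make \<open>A\<close> injective.\<close>
  define K where "K \<Sigma> \<longleftrightarrow> (\<forall>v\<in>carrier_vec r. (\<forall>i\<in>\<Sigma>. (A *\<^sub>v v) $ i = 0) \<longrightarrow> v = 0\<^sub>v r)" for \<Sigma>
  have "K {..<n}"
    unfolding K_def
  proof (intro ballI impI)
    fix v assume v: "v \<in> carrier_vec r" "\<forall>i\<in>{..<n}. (A *\<^sub>v v) $ i = 0"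
    then have "A *\<^sub>v v = 0\<^sub>v n" using A by (intro eq_vecI) auto
    then show "v = 0\<^sub>v r" using assms v(1) unfolding full_rank_mats_iff by blast
  qed
  then obtain \<Sigma> where \<Sigma>: "\<Sigma> \<subseteq> {..<n}" "K \<Sigma>" and min: "\<And>\<Sigma>'. \<Sigma>' \<subset> \<Sigma> \<Longrightarrow> \<not> K \<Sigma>'"
  proof -
    have "\<exists>\<Sigma>. (\<Sigma> \<subseteq> {..<n} \<and> K \<Sigma>) \<and> (\<forall>\<Sigma>'. \<Sigma>' \<subseteq> {..<n} \<and> K \<Sigma>' \<longrightarrow> card \<Sigma> \<le> card \<Sigma>')"
      by (rule ex_has_least_nat[of _ "{..<n}"]) (simp add: \<open>K {..<n}\<close>)
    then obtain \<Sigma> where *: "\<Sigma> \<subseteq> {..<n}" "K \<Sigma>" "\<And>\<Sigma>'. \<Sigma>' \<subseteq> {..<n} \<Longrightarrow> K \<Sigma>' \<Longrightarrow> card \<Sigma> \<le> card \<Sigma>'"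
      by blast
    have "\<not> K \<Sigma>'" if "\<Sigma>' \<subset> \<Sigma>" for \<Sigma>'
      using *(3)[of \<Sigma>'] *(1) psubset_card_mono[OF finite_subset[OF *(1)] that] that by auto
    then show ?thesis using *(1,2) that by blast
  qed
  note S = row_select_carrier[OF \<Sigma>(1) A]
  have ker: "v = 0\<^sub>v r" if "v \<in> carrier_vec r" "submatrix A \<Sigma> UNIV *\<^sub>v v = 0\<^sub>v (card \<Sigma>)" for v
  proof -
    have "(A *\<^sub>v v) $ i = 0" if i: "i \<in> \<Sigma>" for i
    proof -
      obtain k where "k < card \<Sigma>" "i = pick \<Sigma> k"
        using pick_bij_betw[of \<Sigma>] \<Sigma>(1) i finite_subset[OF \<Sigma>(1)] unfolding bij_betw_def by auto
      then show ?thesis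
        using row_select_mult_vec[OF \<Sigma>(1) A \<open>v \<in> carrier_vec r\<close>, of k] that \<open>submatrix A \<Sigma> UNIV *\<^sub>v v = _\<close> by simp
    qed
    then show ?thesis using \<Sigma>(2) \<open>v \<in> carrier_vec r\<close> unfolding K_def by blast
  qed
  have "\<not> card \<Sigma> < r" using wide_mat_kernel[OF S] ker by blast
  moreover have "\<not> r < card \<Sigma>"
  proof
    assume less: "r < card \<Sigma>"
    have "\<exists>v\<in>carrier_vec r. (\<forall>i'\<in>\<Sigma> - {i}. (A *\<^sub>v v) $ i' = 0) \<and> (A *\<^sub>v v) $ i \<noteq> 0" if i: "i \<in> \<Sigma>" for i
    proof -
      have "\<not> K (\<Sigma> - {i})" using min i by blast
      then obtain v where "v \<in> carrier_vec r" "\<forall>i'\<in>\<Sigma> - {i}. (A *\<^sub>v v) $ i' = 0" "v \<noteq> 0\<^sub>v r"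
        unfolding K_def by blast
      then show ?thesis using \<Sigma>(2) unfolding K_def by (intro bexI[of _ v]) auto
    qed
    then obtain w where w: "\<And>i. i \<in> \<Sigma> \<Longrightarrow> w i \<in> carrier_vec r"
      "\<And>i i'. i \<in> \<Sigma> \<Longrightarrow> i' \<in> \<Sigma> - {i} \<Longrightarrow> (A *\<^sub>v w i) $ i' = 0"
      "\<And>i. i \<in> \<Sigma> \<Longrightarrow> (A *\<^sub>v w i) $ i \<noteq> 0" by metis
    \<comment> \<open>The columns of \<open>C\<close> are the vectors \<open>w i\<close>. Restricted
      to the rows in \<open>\<Sigma>\<close>, the product \<open>A * C\<close> is diagonal with
      non-zero diagonal entries, while \<open>C\<close> has more columns than rows and hence a
      kernel vector.\<close>
    define C where "C = mat r (card \<Sigma>) (\<lambda>(k, j). w (pick \<Sigma> j) $ k)"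
    have C: "C \<in> carrier_mat r (card \<Sigma>)" by (simp add: C_def)
    obtain v where v: "v \<in> carrier_vec (card \<Sigma>)" "v \<noteq> 0\<^sub>v (card \<Sigma>)" "C *\<^sub>v v = 0\<^sub>v r"
      using wide_mat_kernel[OF C less] by blast
    have "v $ i = 0" if i: "i < card \<Sigma>" for i
    proof -
      let ?p = "pick \<Sigma>"
      have p: "?p j \<in> \<Sigma>" "?p j < n" if "j < card \<Sigma>" for j
        using that pick_in_set pick_less[OF \<Sigma>(1)] by auto
      have AC: "(A * C) $$ (?p i, j) = (A *\<^sub>v w (?p j)) $ ?p i" if j: "j < card \<Sigma>" for j
        using mult_mat_index[OF A C p(2)[OF i] j] mult_mat_vec_index[OF A w(1)[OF p(1)[OF j]] p(2)[OF i]]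
        by (simp add: C_def j)
      have "0 = (A *\<^sub>v (C *\<^sub>v v)) $ ?p i" using v(3) A p(2)[OF i] by simp
      also have "\<dots> = ((A * C) *\<^sub>v v) $ ?p i" using A C v(1) by (simp add: assoc_mult_mat_vec)
      also have "\<dots> = (\<Sum>j<card \<Sigma>. (A * C) $$ (?p i, j) * v $ j)"
        by (rule mult_mat_vec_index[OF mult_carrier_mat[OF A C] v(1) p(2)[OF i]])
      also have "\<dots> = (\<Sum>j<card \<Sigma>. if j = i then (A *\<^sub>v w (?p i)) $ ?p i * v $ i else 0)"
      proof (intro sum.cong refl)
        fix j assume "j \<in> {..<card \<Sigma>}"
        then have j: "j < card \<Sigma>" by simp
        have "?p j = ?p i \<longleftrightarrow> j = i"
          using pick_bij_betw[of \<Sigma>] finite_subset[OF \<Sigma>(1)] i j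
            inj_on_eq_iff[of "?p" "{..<card \<Sigma>}" j i] by (simp add: bij_betw_def)
        then show "(A * C) $$ (?p i, j) * v $ j = (if j = i then (A *\<^sub>v w (?p i)) $ ?p i * v $ i else 0)"
          using AC[OF j] w(2)[OF p(1)[OF j], of "?p i"] p(1)[OF i] by auto
      qed
      also have "\<dots> = (A *\<^sub>v w (?p i)) $ ?p i * v $ i" using i by simp
      finally show ?thesis using w(3)[OF p(1)[OF i]] by simp
    qed
    then have "v = 0\<^sub>v (card \<Sigma>)" using v(1) by (intro eq_vecI) auto
    then show False using v(2) by blast
  qed
  ultimately have card: "card \<Sigma> = r" by (rule antisym[OF leI leI, rotated])
  then have "submatrix A \<Sigma> UNIV \<in> carrier_mat r r" using S by simp
  then have "det (submatrix A \<Sigma> UNIV) \<noteq> 0"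
    using ker unfolding card by (subst det_nonzero_iff_kernel) blast+
  then show ?thesis using \<Sigma>(1) card by (auto simp: index_sets_def)
qed

lemma invertible_mat_iff_det:
  assumes A: "(A :: 'k::field mat) \<in> carrier_mat n n"
  shows "invertible_mat A \<longleftrightarrow> det A \<noteq> 0"
proof
  assume "invertible_mat A"
  then obtain B where "A * B = 1\<^sub>m n" "B * A = 1\<^sub>m (dim_row B)"
    using A unfolding invertible_mat_def inverts_mat_def by auto
  \<comment> \<open>The definition of invertibility does not fix the size of \<open>B\<close>; both
    dimensions are read off from the two products.\<close>
  then have "dim_col B = n" "dim_row B = n"
    using A by (metis index_mult_mat(3) index_one_mat(3), metis carrier_matD(2) index_mult_mat(3) index_one_mat(3))
  then have "B \<in> carrier_mat n n" by auto
  then have "det A * det B = 1" using det_mult[OF A, of B] \<open>A * B = 1\<^sub>m n\<close> by simp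
  then show "det A \<noteq> 0" by auto
next
  assume "det A \<noteq> 0"
  then have "A \<in> Units (ring_mat TYPE('k) n ())" by (rule det_non_zero_imp_unit[OF A])
  then obtain B where "B \<in> carrier_mat n n" "B * A = 1\<^sub>m n" "A * B = 1\<^sub>m n"
    by (auto simp: Units_def ring_mat_simps)
  then show "invertible_mat A"
    using A unfolding invertible_mat_def inverts_mat_def by auto
qed

text \<open>The inverse is written as adjugate over determinant so that its entries are visibly
  regular functions of the entries of \<open>A\<close>.\<close>

definition inv_mat :: "'k::field mat \<Rightarrow> 'k mat" where
  "inv_mat A = inverse (det A) \<cdot>\<^sub>m adj_mat A"

lemma inv_mat:
  assumes A: "A \<in> carrier_mat n n" and "det A \<noteq> 0"
  shows "inv_mat A \<in> carrier_mat n n" "A * inv_mat A = 1\<^sub>m n" "inv_mat A * A = 1\<^sub>m n"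
proof -
  note adj = adj_mat[OF A]
  show "inv_mat A \<in> carrier_mat n n" using adj(1) by (simp add: inv_mat_def)
  show "A * inv_mat A = 1\<^sub>m n"
    unfolding inv_mat_def mult_smult_distrib[OF A adj(1)] adj(2) using \<open>det A \<noteq> 0\<close> by (auto intro!: eq_matI)
  show "inv_mat A * A = 1\<^sub>m n"
    unfolding inv_mat_def mult_smult_assoc_mat[OF adj(1) A] adj(3) using \<open>det A \<noteq> 0\<close> by (auto intro!: eq_matI)
qed

lemma det_inv_mat: "A \<in> carrier_mat n n \<Longrightarrow> det A \<noteq> 0 \<Longrightarrow> det (inv_mat A) \<noteq> 0"
  using det_mult[of A n "inv_mat A"] inv_mat[of A n] by auto

text \<open>The first \<open>r\<close> columns are those of \<open>Y\<close>; the others are the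
  standard basis vectors for the indices outside \<open>\<Sigma>\<close>, in increasing order. If
  the rows of \<open>Y\<close> in \<open>\<Sigma>\<close> form the identity, this is block
  triangular with identity blocks up to a permutation of rows.\<close>

definition frame_mat :: "nat \<Rightarrow> nat \<Rightarrow> nat set \<Rightarrow> 'k::field mat \<Rightarrow> 'k mat" where
  "frame_mat n r \<Sigma> Y = mat n n (\<lambda>(i, j). if j < r then Y $$ (i, j)
     else if i = pick ({..<n} - \<Sigma>) (j - r) then 1 else 0)"

lemma frame_mat_carrier: "frame_mat n r \<Sigma> Y \<in> carrier_mat n n"
  by (simp add: frame_mat_def)

lemma det_frame_mat:
  assumes Y: "Y \<in> carrier_mat n r" and \<Sigma>: "\<Sigma> \<in> index_sets n r" and one: "submatrix Y \<Sigma> UNIV = 1\<^sub>m r"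
  shows "det (frame_mat n r \<Sigma> Y) \<noteq> 0"
  unfolding det_nonzero_iff_kernel[OF frame_mat_carrier]
proof (intro ballI impI)
  fix v assume v: "v \<in> carrier_vec n" "frame_mat n r \<Sigma> Y *\<^sub>v v = 0\<^sub>v n"
  have \<Sigma>': "\<Sigma> \<subseteq> {..<n}" "card \<Sigma> = r" "finite \<Sigma>" using \<Sigma> finite_subset[of \<Sigma>] by (auto simp: index_sets_def)
  then have "r \<le> n" using card_mono[OF _ \<Sigma>'(1)] by simp
  let ?c = "{..<n} - \<Sigma>"
  have c: "card ?c = n - r" using \<Sigma>' by (simp add: card_Diff_subset)
  have pc: "pick ?c k \<in> ?c" if "k < n - r" for k using that pick_in_set[of k ?c] c by simp
  have eq: "(\<Sum>j<n. frame_mat n r \<Sigma> Y $$ (i, j) * v $ j) = 0" if "i < n" for i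
    unfolding mult_mat_vec_index[OF frame_mat_carrier v(1) that, symmetric] v(2) using that by simp
  \<comment> \<open>In a row with index in \<open>\<Sigma>\<close> only the identity block of
    \<open>Y\<close> contributes, so this row of the equation reads off one of the first
    \<open>r\<close> coordinates of \<open>v\<close>.\<close>
  have low: "v $ j = 0" if j: "j < r" for j
  proof -
    have p: "pick \<Sigma> j \<in> \<Sigma>" "pick \<Sigma> j < n"
      using j pick_in_set[of j \<Sigma>] pick_less[OF \<Sigma>'(1), of j] \<Sigma>'(2) by auto
    have "frame_mat n r \<Sigma> Y $$ (pick \<Sigma> j, j') = (if j' = j then 1 else 0)" if "j' < n" for j'
    proof (cases "j' < r")
      case True
      have "Y $$ (pick \<Sigma> j, j') = (1\<^sub>m r :: 'a mat) $$ (j, j')"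
        using row_select_index[OF \<Sigma>'(1) Y, of j j'] one True j \<Sigma>'(2) by simp
      then show ?thesis using p True that j by (simp add: frame_mat_def)
    next
      case False
      then have "pick \<Sigma> j \<noteq> pick ?c (j' - r)" using p pc[of "j' - r"] that by auto
      then show ?thesis using p False that j by (simp add: frame_mat_def)
    qed
    then have "(\<Sum>j'<n. frame_mat n r \<Sigma> Y $$ (pick \<Sigma> j, j') * v $ j') = (\<Sum>j'<n. if j' = j then v $ j else 0)"
      by (intro sum.cong) auto
    then show ?thesis using eq[OF p(2)] j \<open>r \<le> n\<close> by simp
  qed
  \<comment> \<open>Once the first \<open>r\<close> coordinates vanish, \<open>Y\<close> no longer
    contributes, and a row with index outside \<open>\<Sigma>\<close> reads off one of the remaining
    coordinates.\<close>
  have high: "v $ j = 0" if j: "r \<le> j" "j < n" for j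
  proof -
    have p: "pick ?c (j - r) < n" using pc[of "j - r"] j by auto
    have "frame_mat n r \<Sigma> Y $$ (pick ?c (j - r), j') * v $ j' = (if j' = j then v $ j else 0)" if "j' < n" for j'
    proof (cases "j' < r")
      case True then show ?thesis using low j by simp
    next
      case False
      have "pick ?c (j - r) = pick ?c (j' - r) \<longleftrightarrow> j - r = j' - r"
      proof -
        have "inj_on (pick ?c) {..<n - r}" using pick_bij_betw[of ?c] c by (simp add: bij_betw_def)
        moreover have "j - r \<in> {..<n - r}" "j' - r \<in> {..<n - r}" using False j that by auto
        ultimately show ?thesis by (rule inj_on_eq_iff)
      qed
      then show ?thesis using p False that j by (auto simp: frame_mat_def)
    qed
    then have "(\<Sum>j'<n. frame_mat n r \<Sigma> Y $$ (pick ?c (j - r), j') * v $ j') = (\<Sum>j'<n. if j' = j then v $ j else 0)"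
      by (intro sum.cong) auto
    then show ?thesis using eq[OF p] j by simp
  qed
  show "v = 0\<^sub>v n" using low high v(1) by (intro eq_vecI) (auto, metis not_less)
qed

section \<open>Radical and socle powers\<close>

lemma vector_space_kscale: "vector_space (kscale :: 'k::field \<Rightarrow> ('e::ab_group_add \<Rightarrow>\<^sub>0 'k) \<Rightarrow> _)"
proof
  fix a b :: 'k and v w :: "'e \<Rightarrow>\<^sub>0 'k"
  show "kscale (a + b) v = kscale a v + kscale b v"
    by (simp add: kscale_def single_add distrib_right)
  show "kscale a (kscale b v) = kscale (a * b) v"
    by (simp add: kscale_def mult.assoc[symmetric] mult_single)
qed (simp_all add: kscale_def distrib_left)

interpretation kE: vector_space "kscale :: 'k::field \<Rightarrow> ('e::ab_group_add \<Rightarrow>\<^sub>0 'k) \<Rightarrow> _"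
  by (rule vector_space_kscale)

locale kE_module =
  fixes act :: "('e::ab_group_add \<Rightarrow>\<^sub>0 'k::field) \<Rightarrow> 'm \<Rightarrow> 'm::ab_group_add"
  assumes module_act: "Modules.module act"
begin

abbreviation scale :: "'k \<Rightarrow> 'm \<Rightarrow> 'm" where "scale \<equiv> mscale act"

sublocale act: Modules.module act by (rule module_act)

sublocale M: vector_space "mscale act"
proof
  fix a b :: 'k and v w :: 'm
  show "scale (a + b) v = scale a v + scale b v"
    by (simp add: mscale_def single_add act.scale_left_distrib)
  show "scale a (scale b v) = scale (a * b) v"
    by (simp add: mscale_def mult_single)
qed (simp_all add: mscale_def act.scale_right_distrib)

lemma act_kscale: "act (kscale c a) m = scale c (act a m)"
  by (simp add: kscale_def mscale_def)

lemma act_scale: "act a (scale c m) = scale c (act a m)"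
  by (simp add: mscale_def mult.commute)

lemma subspace_act_vimage: "M.subspace N \<Longrightarrow> M.subspace {m. act a m \<in> N}"
  by (auto simp: M.subspace_def act.scale_right_distrib act_scale)

lemma subspace_act_elements: "M.subspace N \<Longrightarrow> kE.subspace {a. act a m \<in> N}"
  by (auto simp: M.subspace_def kE.subspace_def act.scale_left_distrib act_kscale)

text \<open>Peeling off one factor turns the multilinear condition into a condition that is linear
  in a single \<open>u\<close>, which is what the passage to spans needs; commutativity of
  \<open>kE\<close> makes the order of the factors irrelevant.\<close>

lemma Soc_pow_Suc: "m \<in> Soc_pow act U (Suc l) \<longleftrightarrow> (\<forall>u\<in>U. act u m \<in> Soc_pow act U l)"
proof (intro iffI ballI)
  fix u assume "m \<in> Soc_pow act U (Suc l)" "u \<in> U"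
  then have "act (prod_list (u # us)) m = 0" if "length us = l" "set us \<subseteq> U" for us
    using that unfolding Soc_pow_def mem_Collect_eq by (metis insert_subset length_Cons list.simps(15))
  then show "act u m \<in> Soc_pow act U l" unfolding Soc_pow_def by (simp add: mult.commute)
next
  assume *: "\<forall>u\<in>U. act u m \<in> Soc_pow act U l"
  show "m \<in> Soc_pow act U (Suc l)"
    unfolding Soc_pow_def mem_Collect_eq
  proof (intro allI impI)
    fix us assume us: "length us = Suc l \<and> set us \<subseteq> U"
    then obtain u us' where "us = u # us'" by (cases us) auto
    then show "act (prod_list us) m = 0" using * us by (auto simp: Soc_pow_def mult.commute)
  qed
qed

lemma subspace_Soc_pow: "M.subspace (Soc_pow act U l)"
  by (auto simp: M.subspace_def Soc_pow_def act.scale_right_distrib act_scale)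

text \<open>For fixed \<open>m\<close> the elements of \<open>kE\<close> that send \<open>m\<close>
  into a given subspace form a subspace, so each factor may be tested on spanning elements.\<close>

lemma Soc_pow_span: "Soc_pow act (kE.span S) l = Soc_pow act S l"
proof (induction l)
  case (Suc l)
  have "(\<forall>u\<in>kE.span S. act u m \<in> Soc_pow act S l) \<longleftrightarrow> (\<forall>u\<in>S. act u m \<in> Soc_pow act S l)" for m
    using kE.span_minimal[OF _ subspace_act_elements[OF subspace_Soc_pow], of S m S l] kE.span_superset[of S] by blast
  then show ?case using Suc by (auto simp: Soc_pow_Suc)
qed (simp add: Soc_pow_def)

lemma subspace_Rad_pow: "M.subspace (Rad_pow act U l)"
  by (simp add: Rad_pow_def)

lemma Rad_powI: "length us = l \<Longrightarrow> set us \<subseteq> U \<Longrightarrow> act (prod_list us) m \<in> Rad_pow act U l"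
  unfolding Rad_pow_def by (rule M.span_base) blast

text \<open>The claim is linear in \<open>m\<close> and in \<open>u\<close>, so it may be checked on
  generators of both spans.\<close>

lemma act_Rad_pow:
  assumes u: "u \<in> kE.span S" and m: "m \<in> Rad_pow act S l"
  shows "act u m \<in> Rad_pow act S (Suc l)"
proof -
  have "act u m \<in> Rad_pow act S (Suc l)" if "u \<in> S" for u
  proof -
    have "{act (prod_list us) m |us m. length us = l \<and> set us \<subseteq> S} \<subseteq> {m. act u m \<in> Rad_pow act S (Suc l)}"
    proof clarify
      fix us m assume "set us \<subseteq> S" "l = length us"
      then show "act u (act (prod_list us) m) \<in> Rad_pow act S (Suc (length us))"
        using Rad_powI[of "u # us" "Suc l" S m] that by simp
    qed
    then show ?thesis
      using M.span_minimal[OF _ subspace_act_vimage[OF subspace_Rad_pow]] m unfolding Rad_pow_def by blast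
  qed
  then have "S \<subseteq> {u. act u m \<in> Rad_pow act S (Suc l)}" by blast
  then show ?thesis
    using kE.span_minimal[OF _ subspace_act_elements[OF subspace_Rad_pow]] u by blast
qed

lemma Rad_pow_span: "Rad_pow act (kE.span S) l = Rad_pow act S l"
proof
  have "act (prod_list us) m \<in> Rad_pow act S (length us)" if "set us \<subseteq> kE.span S" for us m
    using that
  proof (induction us)
    case Nil
    show ?case using Rad_powI[of "[]" 0 S m] by simp
  next
    case (Cons u us)
    then show ?case using act_Rad_pow[of u S "act (prod_list us) m" "length us"] by simp
  qed
  then show "Rad_pow act (kE.span S) l \<subseteq> Rad_pow act S l"
    unfolding Rad_pow_def[of act "kE.span S"]
    by (intro M.span_minimal subspace_Rad_pow) auto
  show "Rad_pow act S l \<subseteq> Rad_pow act (kE.span S) l"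
    unfolding Rad_pow_def using kE.span_superset[of S] by (intro M.span_mono) blast
qed

lemma multi_indices_image:
  assumes "length us = l \<and> set us \<subseteq> y ` {..<r}"
  obtains js where "js \<in> multi_indices r l" "us = map y js"
proof -
  have "us \<in> map y ` lists {..<r}" using assms unfolding lists_image[symmetric] by (simp add: lists_eq_set)
  then obtain js where "js \<in> lists {..<r}" "us = map y js" by (rule imageE)
  then show thesis using assms by (intro that) (auto simp: multi_indices_def lists_eq_set)
qed

text \<open>Contributions of the same word can be merged because the action is linear in
  \<open>m\<close>. The result is a sum with one vector per multi-index, which is the shape of the
  elements of \<open>im_chart\<close>.\<close>

lemma Rad_pow_image:
  "Rad_pow act (y ` {..<r}) l =
     range (\<lambda>m. \<Sum>js\<in>multi_indices r l. act (prod_list (map y js)) (m js))" (is "_ = ?R")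
proof
  have fin: "finite (multi_indices r l)"
    using finite_lists_length_eq[of "{..<r}" l] by (simp add: multi_indices_def conj_commute)
  have sub: "M.subspace ?R"
    unfolding M.subspace_def
  proof (intro conjI ballI allI)
    show "0 \<in> ?R" by (intro range_eqI[of _ _ "\<lambda>_. 0"]) simp
    fix a assume "a \<in> ?R"
    then obtain m where m: "a = (\<Sum>js\<in>multi_indices r l. act (prod_list (map y js)) (m js))" by blast
    show "scale c a \<in> ?R" for c
      unfolding m M.scale_sum_right act_scale[symmetric] by (rule range_eqI) (rule refl)
    fix b assume "b \<in> ?R"
    then obtain m' where m': "b = (\<Sum>js\<in>multi_indices r l. act (prod_list (map y js)) (m' js))" by blast
    show "a + b \<in> ?R"
      unfolding m m' sum.distrib[symmetric] act.scale_right_distrib[symmetric] by (rule range_eqI) (rule refl)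
  qed
  have "act (prod_list us) m \<in> ?R" if us: "length us = l \<and> set us \<subseteq> y ` {..<r}" for us m
  proof -
    obtain js where "js \<in> multi_indices r l" and js: "us = map y js" using us by (rule multi_indices_image)
    have "act (prod_list us) m = (\<Sum>js'\<in>multi_indices r l. act (prod_list (map y js')) (if js' = js then m else 0))"
      using fin \<open>js \<in> multi_indices r l\<close> js by (simp add: if_distrib cong: if_cong)
    then show ?thesis by (rule range_eqI[of _ _ "\<lambda>js'. if js' = js then m else 0"])
  qed
  then have "{act (prod_list us) m |us m. length us = l \<and> set us \<subseteq> y ` {..<r}} \<subseteq> ?R" by blast
  then show "Rad_pow act (y ` {..<r}) l \<subseteq> ?R"
    unfolding Rad_pow_def by (rule M.span_minimal[OF _ sub])
  show "?R \<subseteq> Rad_pow act (y ` {..<r}) l"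
  proof clarify
    fix m show "(\<Sum>js\<in>multi_indices r l. act (prod_list (map y js)) (m js)) \<in> Rad_pow act (y ` {..<r}) l"
      by (intro M.subspace_sum[OF subspace_Rad_pow] Rad_powI) (auto simp: multi_indices_def)
  qed
qed

lemma Soc_pow_image:
  "m \<in> Soc_pow act (y ` {..<r}) l \<longleftrightarrow> (\<forall>js\<in>multi_indices r l. act (prod_list (map y js)) m = 0)"
proof (intro iffI ballI)
  fix js assume m: "m \<in> Soc_pow act (y ` {..<r}) l" and js: "js \<in> multi_indices r l"
  have "length (map y js) = l \<and> set (map y js) \<subseteq> y ` {..<r}" using js by (auto simp: multi_indices_def)
  then show "act (prod_list (map y js)) m = 0" using m unfolding Soc_pow_def by blast
next
  assume *: "\<forall>js\<in>multi_indices r l. act (prod_list (map y js)) m = 0"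
  show "m \<in> Soc_pow act (y ` {..<r}) l"
    unfolding Soc_pow_def mem_Collect_eq
  proof (intro allI impI)
    fix us assume us: "length us = l \<and> set us \<subseteq> y ` {..<r}"
    then obtain js where "js \<in> multi_indices r l" "us = map y js" by (rule multi_indices_image)
    then show "act (prod_list us) m = 0" using bspec[OF *] by simp
  qed
qed

text \<open>The coordinate functionals of \<open>N\<close> are defined on all of M, by extending a
  basis of \<open>N\<close> to a basis of M. This is required because regularity of sections and the
  coordinates of the total space are formulated with functionals on M.\<close>

lemma subspace_coordinates:
  assumes fin: "finite B" "M.span B = UNIV" and N: "M.subspace N"
  obtains d :: nat and e \<xi> where "\<And>i. i < d \<Longrightarrow> e i \<in> N"
    "\<And>i. Vector_Spaces.linear scale (*) (\<xi> i)"
    "\<And>v. v \<in> N \<Longrightarrow> v = (\<Sum>i<d. scale (\<xi> i v) (e i))"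
    "\<And>i j. i < d \<Longrightarrow> j < d \<Longrightarrow> \<xi> i (e j) = (if i = j then 1 else 0)"
proof -
  obtain B' where B': "B' \<subseteq> B" "M.independent B'" "B \<subseteq> M.span B'"
    using M.maximal_independent_subset[of B] by auto
  then have "M.span B' = UNIV" using fin(2) M.span_minimal[OF _ M.subspace_span, of B B'] by auto
  interpret F: finite_dimensional_vector_space scale B'
    by unfold_locales (use B' fin(1) finite_subset \<open>M.span B' = UNIV\<close> in auto)
  obtain E where E: "E \<subseteq> N" "M.independent E" "N \<subseteq> M.span E" using M.maximal_independent_subset[of N] by auto
  have "finite E" using E(2) by (rule F.finiteI_independent)
  then obtain e where e: "bij_betw e {..<card E} E" using ex_bij_betw_nat_finite[of E] lessThan_atLeast0 by metis
  define \<xi> where "\<xi> i v = M.representation (M.extend_basis E) v (e i)" for i v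
  have span: "v \<in> M.span (M.extend_basis E)" for v
    using M.span_extend_basis[OF E(2)] by simp
  note ind = M.independent_extend_basis[OF E(2)]
  show thesis
  proof (rule that[where d = "card E" and e = e and \<xi> = \<xi>])
    show "e i \<in> N" if "i < card E" for i using e E(1) that by (auto simp: bij_betw_def)
    show "Vector_Spaces.linear scale (*) (\<xi> i)" for i
      unfolding \<xi>_def by (intro M.linear_representation ind M.span_extend_basis E)
    show "v = (\<Sum>i<card E. scale (\<xi> i v) (e i))" if "v \<in> N" for v
    proof -
      have v: "v \<in> M.span E" using that E by auto
      have "v = (\<Sum>b\<in>E. scale (M.representation E v b) b)"
        using M.sum_representation_eq[OF E(2) v \<open>finite E\<close>] by simp
      also have "\<dots> = (\<Sum>i<card E. scale (\<xi> i v) (e i))"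
        unfolding \<xi>_def M.representation_extend[OF ind v M.extend_basis_superset[OF E(2)]]
        by (rule sum.reindex_bij_betw[OF e, symmetric])
      finally show ?thesis .
    qed
    show "\<xi> i (e j) = (if i = j then 1 else 0)" if "i < card E" "j < card E" for i j
    proof -
      have "e j \<in> E" using e that by (auto simp: bij_betw_def)
      then have "e j \<in> M.extend_basis E" using M.extend_basis_superset[OF E(2)] by blast
      moreover have "e j = e i \<longleftrightarrow> i = j"
        using inj_on_eq_iff[of e "{..<card E}" j i] e that by (auto simp: bij_betw_def)
      ultimately show ?thesis unfolding \<xi>_def M.representation_basis[OF ind \<open>e j \<in> M.extend_basis E\<close>] by auto
    qed
  qed
qed

end

section \<open>Charts of the Grassmannian\<close>

lemma GLn_carrier: "g \<in> carrier (GLn n) \<longleftrightarrow> g \<in> carrier_mat n n \<and> det (g :: 'k::field mat) \<noteq> 0"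
  using unit_imp_det_non_zero[of g n "()"] det_non_zero_imp_unit[of g n "()"]
  by (auto simp: GLn_def units_of_def Units_def ring_mat_simps)

lemma GLn_mult: "g \<otimes>\<^bsub>GLn n\<^esub> h = g * h" and GLn_one: "\<one>\<^bsub>GLn n\<^esub> = 1\<^sub>m n"
  by (simp_all add: GLn_def units_of_def ring_mat_simps)

lemma GLn_group: "group (GLn n :: 'k::field mat monoid)"
proof -
  interpret ring "ring_mat TYPE('k) n ()" by (rule ring_mat)
  show ?thesis unfolding GLn_def by (rule units_group)
qed

lemma GLn_inv: "g \<in> carrier (GLn n) \<Longrightarrow> inv\<^bsub>GLn n\<^esub> g = inv_mat (g :: 'k::field mat)"
  using inv_mat[of g n] det_inv_mat[of g n]
  by (intro group.inv_equality[OF GLn_group]) (auto simp: GLn_carrier GLn_mult GLn_one)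

lemma GLn_inv_mat:
  assumes "(g :: 'k::field mat) \<in> carrier (GLn n)"
  shows "inv_mat g \<in> carrier (GLn n)" "g * inv_mat g = 1\<^sub>m n" "inv_mat g * g = 1\<^sub>m n"
  using assms inv_mat[of g n] det_inv_mat[of g n] by (auto simp: GLn_carrier)

lemma GLn_mult_closed: "g \<in> carrier (GLn n) \<Longrightarrow> h \<in> carrier (GLn n) \<Longrightarrow> (g :: 'k::field mat) * h \<in> carrier (GLn n)"
  by (auto simp: GLn_carrier det_mult)

locale equivariant_kE_module = kE_module act
  for act :: "('e::ab_group_add \<Rightarrow>\<^sub>0 'k::field) \<Rightarrow> 'm \<Rightarrow> 'm::ab_group_add" +
  fixes n r :: nat and x :: "nat \<Rightarrow> ('e \<Rightarrow>\<^sub>0 'k)"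
    and \<alpha> :: "'k mat \<Rightarrow> ('e \<Rightarrow>\<^sub>0 'k) \<Rightarrow> ('e \<Rightarrow>\<^sub>0 'k)" and \<rho> :: "'k mat \<Rightarrow> 'm \<Rightarrow> 'm"
  assumes x_inj: "inj_on x {..<n}" and x_indep: "kE.independent (x ` {..<n})"
    and \<alpha>: "induced_action n x \<alpha>"
    and finite_dim: "\<exists>B. finite B \<and> M.span B = UNIV"
    and equivariant: "equivariant_module n \<alpha> act \<rho>"
    and r_le: "r \<le> n"
begin

abbreviation "G \<equiv> carrier (GLn n :: 'k mat monoid)"

lemma G_mat: "g \<in> G \<Longrightarrow> g \<in> carrier_mat n n" by (simp add: GLn_carrier)

lemma one_in_G: "1\<^sub>m n \<in> G" by (simp add: GLn_carrier)

lemma rho_linear: "g \<in> G \<Longrightarrow> Vector_Spaces.linear scale scale (\<rho> g)"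
  using equivariant by (simp add: equivariant_module_def rational_action_def)

lemma rho_add: "g \<in> G \<Longrightarrow> \<rho> g (m + m') = \<rho> g m + \<rho> g m'"
  and rho_scale: "g \<in> G \<Longrightarrow> \<rho> g (scale c m) = scale c (\<rho> g m)"
  using rho_linear[of g] unfolding Vector_Spaces.linear_iff by blast+

lemma rho_zero: "g \<in> G \<Longrightarrow> \<rho> g 0 = 0"
  using rho_add[of g 0 0] by simp

lemma rho_sum: "g \<in> G \<Longrightarrow> \<rho> g (\<Sum>i\<in>I. f i) = (\<Sum>i\<in>I. \<rho> g (f i))"
  by (induction I rule: infinite_finite_induct) (simp_all add: rho_zero rho_add)

lemma rho_action: "group_action (GLn n) UNIV \<rho>"
  using equivariant by (simp add: equivariant_module_def rational_action_def)

lemma rho_mult: "g \<in> G \<Longrightarrow> h \<in> G \<Longrightarrow> \<rho> (g * h) m = \<rho> g (\<rho> h m)"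
  using group_action.composition_rule[OF rho_action, of m g h] by (simp add: GLn_mult)

lemma rho_one: "\<rho> (1\<^sub>m n) m = m"
  using group_action.id_eq_one[OF rho_action] by (simp add: GLn_one restrict_def fun_eq_iff)

lemma rho_inv: "g \<in> G \<Longrightarrow> \<rho> g (\<rho> (inv_mat g) m) = m" "g \<in> G \<Longrightarrow> \<rho> (inv_mat g) (\<rho> g m) = m"
  using rho_mult[of g "inv_mat g" m] rho_mult[of "inv_mat g" g m] GLn_inv_mat[of g n] by (simp_all add: rho_one)

lemma rho_regular: "Vector_Spaces.linear scale (*) \<xi> \<Longrightarrow>
    (\<lambda>g. \<xi> (\<rho> g m)) \<in> regular (zariski_space (mat_coords n n) G) G"
  using equivariant by (simp add: equivariant_module_def rational_action_def)

lemma rho_act: "g \<in> G \<Longrightarrow> \<rho> g (act a m) = act (\<alpha> g a) (\<rho> g m)"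
  using equivariant by (simp add: equivariant_module_def)

lemma
  assumes "g \<in> G"
  shows alpha_bij: "bij (\<alpha> g)" and alpha_one: "\<alpha> g 1 = 1" and alpha_add: "\<alpha> g (a + b) = \<alpha> g a + \<alpha> g b"
    and alpha_mult: "\<alpha> g (a * b) = \<alpha> g a * \<alpha> g b" and alpha_kscale: "\<alpha> g (kscale c a) = kscale c (\<alpha> g a)"
    and alpha_x: "j < n \<Longrightarrow> \<alpha> g (x j) = (\<Sum>i<n. kscale (g $$ (i, j)) (x i))"
  using \<alpha> assms unfolding induced_action_def k_algebra_automorphism_def by blast+

lemma alpha_zero: "g \<in> G \<Longrightarrow> \<alpha> g 0 = 0"
  using alpha_add[of g 0 0] by simp

lemma alpha_sum: "g \<in> G \<Longrightarrow> \<alpha> g (\<Sum>i\<in>I. f i) = (\<Sum>i\<in>I. \<alpha> g (f i))"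
  by (induction I rule: infinite_finite_induct) (simp_all add: alpha_zero alpha_add)

lemma alpha_prod_list: "g \<in> G \<Longrightarrow> \<alpha> g (prod_list us) = prod_list (map (\<alpha> g) us)"
  by (induction us) (simp_all add: alpha_one alpha_mult)

text \<open>The coordinate map from column vectors to the span of the \<open>x i\<close>; it
  translates column spans and the action of \<open>\<alpha> g\<close> into matrix algebra.\<close>

definition lin_comb :: "'k vec \<Rightarrow> ('e \<Rightarrow>\<^sub>0 'k)" where
  "lin_comb v = (\<Sum>i<n. kscale (v $ i) (x i))"

lemma lin_comb_inj:
  assumes "v \<in> carrier_vec n" "w \<in> carrier_vec n" "lin_comb v = lin_comb w"
  shows "v = w"
proof -
  define u where "u b = v $ the_inv_into {..<n} x b - w $ the_inv_into {..<n} x b" for b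
  have u: "u (x i) = v $ i - w $ i" if "i < n" for i
    using the_inv_into_f_f[OF x_inj, of i] that by (simp add: u_def)
  have "(\<Sum>b\<in>x ` {..<n}. kscale (u b) b) = (\<Sum>i<n. kscale (v $ i - w $ i) (x i))"
    by (subst sum.reindex[OF x_inj]) (simp add: u)
  also have "\<dots> = 0"
    using assms(3) by (simp add: lin_comb_def kE.scale_left_diff_distrib sum_subtractf)
  finally have "u (x i) = 0" if "i < n" for i
    using kE.independentD[OF x_indep, of "x ` {..<n}" u "x i"] that by simp
  then show ?thesis using u assms(1,2) by (intro eq_vecI) auto
qed

lemma lin_comb_mult_mat:
  assumes A: "A \<in> carrier_mat n c" and v: "v \<in> carrier_vec c"
  shows "lin_comb (A *\<^sub>v v) = (\<Sum>j<c. kscale (v $ j) (\<Sum>i<n. kscale (A $$ (i, j)) (x i)))"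
proof -
  have "lin_comb (A *\<^sub>v v) = (\<Sum>i<n. \<Sum>j<c. kscale (v $ j) (kscale (A $$ (i, j)) (x i)))"
    unfolding lin_comb_def
    by (intro sum.cong refl) (simp add: mult_mat_vec_index[OF A v] kE.scale_sum_left mult.commute)
  also have "\<dots> = (\<Sum>j<c. kscale (v $ j) (\<Sum>i<n. kscale (A $$ (i, j)) (x i)))"
    by (subst sum.swap) (simp add: kE.scale_sum_right)
  finally show ?thesis .
qed

text \<open>Coefficients are indexed by numbers and not by vectors, so that \<open>f\<close> may
  take a value twice; columns of an arbitrary matrix can coincide.\<close>

lemma span_image_lessThan: "kE.span (f ` {..<c::nat}) = range (\<lambda>w. \<Sum>j<c. kscale (w j) (f j))" (is "_ = ?R")
proof
  have "kE.subspace ?R"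
    unfolding kE.subspace_def
  proof (intro conjI ballI allI)
    show "0 \<in> ?R" by (intro range_eqI[of _ _ "\<lambda>_. 0"]) simp
    fix a assume "a \<in> ?R"
    then obtain w where w: "a = (\<Sum>j<c. kscale (w j) (f j))" by blast
    show "kscale d a \<in> ?R" for d
      unfolding w kE.scale_sum_right kE.scale_scale by (rule range_eqI) (rule refl)
    fix b assume "b \<in> ?R"
    then obtain w' where w': "b = (\<Sum>j<c. kscale (w' j) (f j))" by blast
    show "a + b \<in> ?R"
      unfolding w w' sum.distrib[symmetric] kE.scale_left_distrib[symmetric] by (rule range_eqI) (rule refl)
  qed
  moreover have "f j \<in> ?R" if "j < c" for j
  proof (rule range_eqI)
    have "(\<Sum>i<c. kscale (if i = j then 1 else 0) (f i)) = (\<Sum>i<c. if i = j then f j else 0)"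
      by (intro sum.cong) auto
    then show "f j = (\<Sum>i<c. kscale (if i = j then 1 else 0) (f i))" using that by simp
  qed
  ultimately show "kE.span (f ` {..<c}) \<subseteq> ?R" by (intro kE.span_minimal) auto
  show "?R \<subseteq> kE.span (f ` {..<c})"
    by (intro image_subsetI kE.span_sum kE.span_scale kE.span_base imageI)
qed

lemma col_span_eq:
  assumes A: "A \<in> carrier_mat n r"
  shows "col_span n r x A = (\<lambda>w. lin_comb (A *\<^sub>v w)) ` carrier_vec r"
proof -
  have "range (\<lambda>w. \<Sum>j<r. kscale (w j) (\<Sum>i<n. kscale (A $$ (i, j)) (x i))) =
      (\<lambda>w. \<Sum>j<r. kscale (w $ j) (\<Sum>i<n. kscale (A $$ (i, j)) (x i))) ` carrier_vec r" (is "range ?f = ?g ` _")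
  proof (intro equalityI image_subsetI)
    fix w :: "nat \<Rightarrow> 'k"
    show "?f w \<in> ?g ` carrier_vec r" by (intro image_eqI[of _ _ "vec r w"]) auto
  next
    fix w :: "'k vec"
    show "?g w \<in> range ?f" by (rule range_eqI[of _ _ "\<lambda>j. w $ j"]) simp
  qed
  then show ?thesis unfolding col_span_def span_image_lessThan using lin_comb_mult_mat[OF A] by simp
qed

lemma alpha_lin_comb:
  assumes "g \<in> G" "v \<in> carrier_vec n"
  shows "\<alpha> g (lin_comb v) = lin_comb (g *\<^sub>v v)"
  unfolding lin_comb_mult_mat[OF G_mat[OF assms(1)] assms(2)]
  by (simp add: lin_comb_def alpha_sum[OF assms(1)] alpha_kscale[OF assms(1)] alpha_x[OF assms(1)])

lemma gr_act_col_span: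
  assumes g: "g \<in> G" and A: "A \<in> carrier_mat n r"
  shows "gr_act \<alpha> g (col_span n r x A) = col_span n r x (g * A)"
proof -
  have "\<alpha> g (lin_comb (A *\<^sub>v w)) = lin_comb (g * A *\<^sub>v w)" if "w \<in> carrier_vec r" for w
    using alpha_lin_comb[OF g, of "A *\<^sub>v w"] A that G_mat[OF g] by (simp add: assoc_mult_mat_vec)
  then show ?thesis
    unfolding gr_act_def col_span_eq[OF A] col_span_eq[OF mult_carrier_mat[OF G_mat[OF g] A]] image_image
    by (intro image_cong) auto
qed

text \<open>Injectivity of \<open>lin_comb\<close> lifts the containment of subspaces to column
  vectors: every column of \<open>A\<close> is \<open>B\<close> applied to some vector, and these
  vectors are the columns of \<open>C\<close>.\<close>

lemma col_span_subset_imp_factor: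
  assumes A: "A \<in> carrier_mat n r" and B: "B \<in> carrier_mat n r" and "col_span n r x A \<subseteq> col_span n r x B"
  obtains C where "C \<in> carrier_mat r r" "A = B * C"
proof -
  have "\<exists>w\<in>carrier_vec r. col A j = B *\<^sub>v w" if j: "j < r" for j
  proof -
    have "A *\<^sub>v unit_vec r j = col A j" using A j by (intro eq_vecI) (auto simp: scalar_prod_right_unit)
    then have "lin_comb (col A j) \<in> col_span n r x A"
      unfolding col_span_eq[OF A] by (intro image_eqI[of _ _ "unit_vec r j"]) auto
    then obtain w where "w \<in> carrier_vec r" "lin_comb (col A j) = lin_comb (B *\<^sub>v w)"
      using assms(3) unfolding col_span_eq[OF B] by blast
    moreover have "col A j \<in> carrier_vec n" using A col_dim[of A j] by simp
    ultimately show ?thesis using lin_comb_inj[of "col A j" "B *\<^sub>v w"] B by (intro bexI[of _ w]) auto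
  qed
  then obtain w where w: "\<And>j. j < r \<Longrightarrow> w j \<in> carrier_vec r" "\<And>j. j < r \<Longrightarrow> col A j = B *\<^sub>v w j" by metis
  define C where "C = mat r r (\<lambda>(i, j). w j $ i)"
  have C: "C \<in> carrier_mat r r" by (simp add: C_def)
  have "A = B * C"
  proof (rule eq_matI)
    fix i j assume "i < dim_row (B * C)" "j < dim_col (B * C)"
    then have ij: "i < n" "j < r" using B C by auto
    have "A $$ (i, j) = (B *\<^sub>v w j) $ i" using w(2)[OF ij(2), symmetric] A ij by simp
    also have "\<dots> = (B * C) $$ (i, j)"
      unfolding mult_mat_vec_index[OF B w(1)[OF ij(2)] ij(1)] mult_mat_index[OF B C ij] using ij by (simp add: C_def)
    finally show "A $$ (i, j) = (B * C) $$ (i, j)" .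
  qed (use A B C in auto)
  then show thesis using C that by blast
qed

text \<open>The factor \<open>C\<close> is invertible because a kernel vector of \<open>C\<close>
  would be a kernel vector of \<open>A\<close>. So the points of the Grassmannian are the orbits of
  GL_r on full rank matrices.\<close>

lemma col_span_eq_imp_factor:
  assumes A: "A \<in> full_rank_mats n r" and B: "B \<in> full_rank_mats n r" and eq: "col_span n r x A = col_span n r x B"
  obtains C where "C \<in> carrier_mat r r" "A = B * C" "det C \<noteq> 0"
proof -
  have A': "A \<in> carrier_mat n r" and B': "B \<in> carrier_mat n r" using A B by (auto simp: full_rank_mats_iff)
  obtain C where C: "C \<in> carrier_mat r r" "A = B * C"
    using col_span_subset_imp_factor[OF A' B'] eq by blast
  have "v = 0\<^sub>v r" if "v \<in> carrier_vec r" "C *\<^sub>v v = 0\<^sub>v r" for v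
  proof -
    have "A *\<^sub>v v = B *\<^sub>v (C *\<^sub>v v)" using B' C that by (simp add: assoc_mult_mat_vec)
    also have "\<dots> = 0\<^sub>v n" using B' that by (auto intro: eq_vecI)
    finally show ?thesis using A that by (auto simp: full_rank_mats_iff)
  qed
  then have "det C \<noteq> 0" using det_nonzero_iff_kernel[OF C(1)] by blast
  then show thesis using C that by blast
qed

lemma col_span_mult:
  assumes B: "B \<in> carrier_mat n r" and C: "C \<in> carrier_mat r r" "det C \<noteq> 0"
  shows "col_span n r x (B * C) = col_span n r x B"
proof -
  have "lin_comb (B * C *\<^sub>v w) = lin_comb (B *\<^sub>v (C *\<^sub>v w))" if "w \<in> carrier_vec r" for w
    using assms that by (simp add: assoc_mult_mat_vec)
  moreover have "(\<lambda>w. C *\<^sub>v w) ` carrier_vec r = carrier_vec r"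
  proof (intro equalityI subsetI)
    fix w :: "'k vec" assume "w \<in> carrier_vec r"
    then have "w = C *\<^sub>v (inv_mat C *\<^sub>v w)"
      using inv_mat[OF C] C(1) by (simp add: assoc_mult_mat_vec[symmetric])
    then show "w \<in> (\<lambda>w. C *\<^sub>v w) ` carrier_vec r"
      using inv_mat(1)[OF C] \<open>w \<in> carrier_vec r\<close> by (intro image_eqI[of _ _ "inv_mat C *\<^sub>v w"]) auto
  qed (use C in auto)
  ultimately have "(\<lambda>w. lin_comb (B * C *\<^sub>v w)) ` carrier_vec r =
      (\<lambda>w. lin_comb (B *\<^sub>v w)) ` (\<lambda>w. C *\<^sub>v w) ` carrier_vec r"
    unfolding image_image by (intro image_cong) auto
  then show ?thesis
    unfolding col_span_eq[OF B] col_span_eq[OF mult_carrier_mat[OF B C(1)]]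
    using \<open>(\<lambda>w. C *\<^sub>v w) ` carrier_vec r = carrier_vec r\<close> by simp
qed

lemma full_rank_mult_left:
  assumes g: "g \<in> G" and A: "A \<in> full_rank_mats n r"
  shows "g * A \<in> full_rank_mats n r"
  unfolding full_rank_mats_iff
proof (intro conjI ballI impI)
  have A': "A \<in> carrier_mat n r" using A by (simp add: full_rank_mats_iff)
  then show "g * A \<in> carrier_mat n r" using G_mat[OF g] by simp
  fix v assume v: "v \<in> carrier_vec r" "g * A *\<^sub>v v = 0\<^sub>v n"
  then have "g *\<^sub>v (A *\<^sub>v v) = 0\<^sub>v n" using G_mat[OF g] A' by (simp add: assoc_mult_mat_vec)
  then have "A *\<^sub>v v = 0\<^sub>v n"
    using g det_nonzero_iff_kernel[OF G_mat[OF g]] A' v(1) by (auto simp: GLn_carrier)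
  then show "v = 0\<^sub>v r" using A v(1) by (simp add: full_rank_mats_iff)
qed


section \<open>Charts, normal forms and frames\<close>

lemma index_sets_D:
  assumes "\<Sigma> \<in> index_sets n r"
  shows "\<Sigma> \<subseteq> {..<n}" "card \<Sigma> = r"
  using assms by (auto simp: index_sets_def)

lemma row_select_square:
  assumes "\<Sigma> \<in> index_sets n r" "A \<in> carrier_mat n r"
  shows "submatrix A \<Sigma> UNIV \<in> carrier_mat r r"
  using row_select_carrier[OF index_sets_D(1) assms(2)] index_sets_D(2) assms(1) by blast

lemma full_rank_carrier: "A \<in> full_rank_mats n r \<Longrightarrow> A \<in> carrier_mat n r"
  by (simp add: full_rank_mats_iff)

text \<open>The condition does not depend on the representing matrix: two representatives differ by
  an invertible \<open>C\<close> on the right, which multiplies the minor by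
  \<open>det C\<close>.\<close>

lemma col_span_in_chart_iff:
  assumes \<Sigma>: "\<Sigma> \<in> index_sets n r" and A: "A \<in> full_rank_mats n r"
  shows "col_span n r x A \<in> chart n r x \<Sigma> \<longleftrightarrow> det (submatrix A \<Sigma> UNIV) \<noteq> 0"
proof
  assume "col_span n r x A \<in> chart n r x \<Sigma>"
  then obtain B where B: "B \<in> full_rank_mats n r" "invertible_mat (submatrix B \<Sigma> UNIV)"
    "col_span n r x A = col_span n r x B" unfolding chart_def by auto
  obtain C where C: "C \<in> carrier_mat r r" "A = B * C" "det C \<noteq> 0"
    using col_span_eq_imp_factor[OF A B(1,3)] .
  note BS = row_select_square[OF \<Sigma> full_rank_carrier[OF B(1)]]
  have "submatrix A \<Sigma> UNIV = submatrix B \<Sigma> UNIV * C"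
    unfolding C(2) by (rule row_select_mult[OF index_sets_D(1)[OF \<Sigma>] full_rank_carrier[OF B(1)] C(1)])
  then show "det (submatrix A \<Sigma> UNIV) \<noteq> 0"
    using B(2) C(3) by (simp add: det_mult[OF BS C(1)] invertible_mat_iff_det[OF BS])
next
  assume "det (submatrix A \<Sigma> UNIV) \<noteq> 0"
  then show "col_span n r x A \<in> chart n r x \<Sigma>"
    unfolding chart_def
    using A invertible_mat_iff_det[OF row_select_square[OF \<Sigma> full_rank_carrier[OF A]]] by blast
qed

text \<open>Any other normalised representative is this one times some \<open>C\<close>; comparing
  the rows in \<open>\<Sigma>\<close> forces \<open>C\<close> to be the identity. This justifies the
  definite description in \<open>Ymat\<close>.\<close>

lemma Ymat_col_span:
  assumes \<Sigma>: "\<Sigma> \<in> index_sets n r" and A: "A \<in> full_rank_mats n r" and det: "det (submatrix A \<Sigma> UNIV) \<noteq> 0"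
  shows "Ymat n r x \<Sigma> (col_span n r x A) = A * inv_mat (submatrix A \<Sigma> UNIV)" (is "_ = ?Y")
    and "A * inv_mat (submatrix A \<Sigma> UNIV) \<in> full_rank_mats n r"
    and "col_span n r x (A * inv_mat (submatrix A \<Sigma> UNIV)) = col_span n r x A"
    and "submatrix (A * inv_mat (submatrix A \<Sigma> UNIV)) \<Sigma> UNIV = 1\<^sub>m r"
proof -
  note A' = full_rank_carrier[OF A]
  note S = row_select_square[OF \<Sigma> A']
  note I = inv_mat[OF S det]
  show one: "submatrix ?Y \<Sigma> UNIV = 1\<^sub>m r"
    using row_select_mult[OF index_sets_D(1)[OF \<Sigma>] A' I(1)] I(2) by simp
  show full: "?Y \<in> full_rank_mats n r"
    by (rule full_rank_matsI_row_select[OF mult_carrier_mat[OF A' I(1)] \<Sigma>]) (simp add: one)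
  show span: "col_span n r x ?Y = col_span n r x A"
    by (rule col_span_mult[OF A' I(1) det_inv_mat[OF S det]])
  show "Ymat n r x \<Sigma> (col_span n r x A) = ?Y"
    unfolding Ymat_def
  proof (rule the_equality)
    fix B assume B: "B \<in> full_rank_mats n r \<and> col_span n r x B = col_span n r x A \<and> submatrix B \<Sigma> UNIV = 1\<^sub>m r"
    then obtain C where C: "C \<in> carrier_mat r r" "B = ?Y * C"
      using col_span_eq_imp_factor[of B ?Y] full span by metis
    have "1\<^sub>m r = submatrix (?Y * C) \<Sigma> UNIV" using B C(2) by simp
    also have "\<dots> = 1\<^sub>m r * C"
      using row_select_mult[OF index_sets_D(1)[OF \<Sigma>] full_rank_carrier[OF full] C(1)] one by simp
    finally have "C = 1\<^sub>m r" using C(1) by simp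
    then show "B = ?Y" using C(2) right_mult_one_mat[OF full_rank_carrier[OF full]] by simp
  qed (use one full span in simp)
qed

lemma Ymat_chart:
  assumes \<Sigma>: "\<Sigma> \<in> index_sets n r" and U: "U \<in> chart n r x \<Sigma>"
  shows "Ymat n r x \<Sigma> U \<in> full_rank_mats n r" "col_span n r x (Ymat n r x \<Sigma> U) = U"
    "submatrix (Ymat n r x \<Sigma> U) \<Sigma> UNIV = 1\<^sub>m r"
proof -
  obtain A where A: "A \<in> full_rank_mats n r" "U = col_span n r x A" using U unfolding chart_def by auto
  then have "det (submatrix A \<Sigma> UNIV) \<noteq> 0" using U col_span_in_chart_iff[OF \<Sigma>] by simp
  from Ymat_col_span[OF \<Sigma> A(1) this]
  show "Ymat n r x \<Sigma> U \<in> full_rank_mats n r" "col_span n r x (Ymat n r x \<Sigma> U) = U"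
    "submatrix (Ymat n r x \<Sigma> U) \<Sigma> UNIV = 1\<^sub>m r" using A(2) by simp_all
qed

abbreviation "U0 \<equiv> base_subspace r x"

text \<open>\<open>U0\<close> is the column span of the first \<open>r\<close> columns of the
  identity matrix, and multiplying these by \<open>g\<close> gives the first \<open>r\<close>
  columns of \<open>g\<close>.\<close>

lemma alpha_base_subspace:
  assumes g: "g \<in> G"
  shows "gr_act \<alpha> g U0 = col_span n r x (mat n r (\<lambda>(i, j). g $$ (i, j)))" (is "_ = col_span n r x ?A")
proof -
  let ?J = "mat n r (\<lambda>(i, j). if i = j then 1 else 0) :: 'k mat"
  have J: "?J \<in> carrier_mat n r" by simp
  have "(\<Sum>i<n. kscale (?J $$ (i, j)) (x i)) = x j" if "j < r" for j
  proof -
    have "(\<Sum>i<n. kscale (?J $$ (i, j)) (x i)) = (\<Sum>i<n. if i = j then x j else 0)"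
      using that by (intro sum.cong) auto
    then show ?thesis using that r_le by simp
  qed
  then have "col_span n r x ?J = U0"
    unfolding col_span_def base_subspace_def by (intro arg_cong[where f = kE.span] image_cong) auto
  moreover have "g * ?J = ?A"
  proof (rule eq_matI)
    fix i j assume "i < dim_row ?A" "j < dim_col ?A"
    then have ij: "i < n" "j < r" by auto
    have "(g * ?J) $$ (i, j) = (\<Sum>k<n. if k = j then g $$ (i, j) else 0)"
      unfolding mult_mat_index[OF G_mat[OF g] J ij] using ij by (intro sum.cong) auto
    then show "(g * ?J) $$ (i, j) = ?A $$ (i, j)" using ij r_le by simp
  qed (use G_mat[OF g] in auto)
  ultimately show ?thesis using gr_act_col_span[OF g J] by simp
qed

definition frame :: "nat set \<Rightarrow> ('e \<Rightarrow>\<^sub>0 'k) set \<Rightarrow> 'k mat" where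
  "frame \<Sigma> U = frame_mat n r \<Sigma> (Ymat n r x \<Sigma> U)"

text \<open>The third claim is finer than the second: the frame sends the chosen basis of
  \<open>U0\<close> to the normalised basis of \<open>U\<close>, which are the elements occurring in
  \<open>theta\<close>.\<close>

lemma frame:
  assumes \<Sigma>: "\<Sigma> \<in> index_sets n r" and U: "U \<in> chart n r x \<Sigma>"
  shows "frame \<Sigma> U \<in> G" "gr_act \<alpha> (frame \<Sigma> U) U0 = U"
    "j < r \<Longrightarrow> \<alpha> (frame \<Sigma> U) (x j) = (\<Sum>i<n. kscale (Ymat n r x \<Sigma> U $$ (i, j)) (x i))"
proof -
  note Y = Ymat_chart[OF \<Sigma> U]
  show G: "frame \<Sigma> U \<in> G"
    unfolding GLn_carrier frame_def
    using frame_mat_carrier det_frame_mat[OF full_rank_carrier[OF Y(1)] \<Sigma> Y(3)] by blast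
  have entry: "frame \<Sigma> U $$ (i, j) = Ymat n r x \<Sigma> U $$ (i, j)" if "i < n" "j < r" for i j
    using that r_le by (simp add: frame_def frame_mat_def)
  have "mat n r (\<lambda>(i, j). frame \<Sigma> U $$ (i, j)) = Ymat n r x \<Sigma> U"
    using full_rank_carrier[OF Y(1)] entry by (intro eq_matI) auto
  then show "gr_act \<alpha> (frame \<Sigma> U) U0 = U"
    unfolding alpha_base_subspace[OF G] using Y(2) by simp
  show "\<alpha> (frame \<Sigma> U) (x j) = (\<Sum>i<n. kscale (Ymat n r x \<Sigma> U $$ (i, j)) (x i))" if "j < r"
    using alpha_x[OF G, of j] that r_le entry by simp
qed

text \<open>\<open>induced_action\<close> does not state that \<open>\<alpha>\<close> is
  multiplicative in \<open>g\<close>. For subspaces represented by matrices the needed identities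
  are read off from matrix products.\<close>

lemma alpha_inv_on_col_span:
  assumes g: "g \<in> G" and A: "A \<in> carrier_mat n r"
  shows "gr_act \<alpha> (inv_mat g) (gr_act \<alpha> g (col_span n r x A)) = col_span n r x A"
    and "gr_act \<alpha> g (gr_act \<alpha> (inv_mat g) (col_span n r x A)) = col_span n r x A"
proof -
  note gm = G_mat[OF g] and h = GLn_inv_mat[OF g]
  note hm = G_mat[OF h(1)]
  have "inv_mat g * (g * A) = A" "g * (inv_mat g * A) = A"
    using assoc_mult_mat[OF hm gm A] assoc_mult_mat[OF gm hm A] h(2,3) A by simp_all
  then show "gr_act \<alpha> (inv_mat g) (gr_act \<alpha> g (col_span n r x A)) = col_span n r x A"
    "gr_act \<alpha> g (gr_act \<alpha> (inv_mat g) (col_span n r x A)) = col_span n r x A"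
    using gr_act_col_span[OF h(1)] gr_act_col_span[OF g] A gm hm by simp_all
qed

lemma gr_act_inj: "g \<in> G \<Longrightarrow> gr_act \<alpha> g U = gr_act \<alpha> g U' \<Longrightarrow> U = U'"
  using alpha_bij[of g] unfolding gr_act_def by (simp add: bij_is_inj inj_image_eq_iff)

section \<open>The action of GL_n on the points of the Grassmannian\<close>

abbreviation "X \<equiv> Gr n r x"

lemma pts_Gr: "pts X = col_span n r x ` full_rank_mats n r"
  by (simp add: Gr_def quotient_pts zariski_pts)

lemma chart_subset_pts: "chart n r x \<Sigma> \<subseteq> pts X"
  by (auto simp: chart_def pts_Gr)

lemma gr_act_pts: "g \<in> G \<Longrightarrow> U \<in> pts X \<Longrightarrow> gr_act \<alpha> g U \<in> pts X"
  by (auto simp: pts_Gr gr_act_col_span full_rank_carrier intro: full_rank_mult_left)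

lemma gr_act_inv:
  assumes g: "g \<in> G" and "U \<in> pts X"
  shows "gr_act \<alpha> (inv_mat g) (gr_act \<alpha> g U) = U" "gr_act \<alpha> g (gr_act \<alpha> (inv_mat g) U) = U"
  using assms alpha_inv_on_col_span[OF g] by (auto simp: pts_Gr full_rank_carrier)

lemma gr_act_mult:
  assumes g: "g \<in> G" and h: "h \<in> G" and "U \<in> pts X"
  shows "gr_act \<alpha> (g * h) U = gr_act \<alpha> g (gr_act \<alpha> h U)"
proof -
  obtain A where A: "A \<in> carrier_mat n r" "U = col_span n r x A"
    using assms(3) full_rank_carrier by (auto simp: pts_Gr)
  have "gr_act \<alpha> (g * h) U = col_span n r x (g * (h * A))"
    unfolding A(2) gr_act_col_span[OF GLn_mult_closed[OF g h] A(1)] assoc_mult_mat[OF G_mat[OF g] G_mat[OF h] A(1)] ..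
  then show ?thesis
    unfolding A(2) gr_act_col_span[OF h A(1)] gr_act_col_span[OF g mult_carrier_mat[OF G_mat[OF h] A(1)]] .
qed

text \<open>The sections of the two sheaves vanish outside \<open>W\<close> on arbitrary sets \<open>U\<close>, not only on points of
  the Grassmannian; injectivity of \<open>\<alpha> g\<close> takes care of the others.\<close>

lemma gr_act_inv_mem_iff:
  assumes g: "g \<in> G" and W: "W \<subseteq> pts X"
  shows "gr_act \<alpha> (inv_mat g) U \<in> W \<longleftrightarrow> U \<in> gr_act \<alpha> g ` W"
proof
  assume *: "gr_act \<alpha> (inv_mat g) U \<in> W"
  let ?U = "gr_act \<alpha> (inv_mat g) U"
  have "gr_act \<alpha> (inv_mat g) (gr_act \<alpha> g ?U) = ?U" using gr_act_inv(1)[OF g] * W by blast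
  then have "gr_act \<alpha> g ?U = U" using gr_act_inj[OF GLn_inv_mat(1)[OF g]] by blast
  then show "U \<in> gr_act \<alpha> g ` W" using * by (metis imageI)
next
  assume "U \<in> gr_act \<alpha> g ` W"
  then show "gr_act \<alpha> (inv_mat g) U \<in> W" using gr_act_inv(1)[OF g] W by auto
qed

text \<open>A full rank matrix has a non-zero minor of size \<open>r\<close>.\<close>

lemma charts_cover: "U \<in> pts X \<Longrightarrow> \<exists>\<Sigma>\<in>index_sets n r. U \<in> chart n r x \<Sigma>"
  using full_rank_mats_row_select col_span_in_chart_iff by (auto simp: pts_Gr)

lemma U0_in_pts: "U0 \<in> pts X"
proof -
  have I: "{..<r} \<in> index_sets n r" using r_le by (auto simp: index_sets_def)
  let ?J = "mat n r (\<lambda>(i, j). (1\<^sub>m n :: 'k mat) $$ (i, j))"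
  have J: "?J \<in> carrier_mat n r" by simp
  have p: "pick {..<r} i = i" if "i < r" for i
    using pick_card_in_set[of i "{..<r}"] that by (simp add: lessThan_def[symmetric] Collect_conj_eq Int_absorb1)
  have "submatrix ?J {..<r} UNIV = 1\<^sub>m r"
    using row_select_square[OF I J] row_select_index[OF index_sets_D(1)[OF I] J] p r_le by (intro eq_matI) auto
  then have "?J \<in> full_rank_mats n r" by (intro full_rank_matsI_row_select[OF J I]) simp
  moreover have "U0 = col_span n r x ?J"
  proof -
    have "\<alpha> (1\<^sub>m n) (x j) = x j" if "j < n" for j
    proof -
      have "\<alpha> (1\<^sub>m n) (x j) = (\<Sum>i<n. if i = j then x j else 0)"
        unfolding alpha_x[OF one_in_G that] using that by (intro sum.cong) auto
      then show ?thesis using that by simp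
    qed
    \<comment> \<open>Triviality of \<open>\<alpha> (1\<^sub>m n)\<close> has been checked on the
      vectors \<open>x j\<close> only; linearity extends it to their span.\<close>
    then have "gr_act \<alpha> (1\<^sub>m n) U0 = U0"
      using r_le unfolding gr_act_def base_subspace_def span_image_lessThan image_image
      by (intro image_cong refl) (simp add: alpha_sum[OF one_in_G] alpha_kscale[OF one_in_G])
    then show ?thesis using alpha_base_subspace[OF one_in_G] by simp
  qed
  ultimately show ?thesis by (auto simp: pts_Gr)
qed

sublocale Gr: space_with_functions "Gr n r x"
  unfolding Gr_def
  by (intro space_with_functions.quotient_space_with_functions zariski_space_with_functions)

section \<open>Regular functions on charts and translates of open sets\<close>

abbreviation "Z \<equiv> zariski_space (mat_coords n r) (full_rank_mats n r :: 'k mat set)"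

sublocale Z: space_with_functions "zariski_space (mat_coords n r) (full_rank_mats n r :: 'k mat set)"
  by (rule zariski_space_with_functions)

lemma Gr_opens: "W \<in> opens X \<longleftrightarrow> W \<subseteq> pts X \<and> {A \<in> full_rank_mats n r. col_span n r x A \<in> W} \<in> opens Z"
  by (simp add: Gr_def quotient_opens quotient_pts zariski_pts)

lemma Gr_regular: "f \<in> regular X W \<longleftrightarrow>
    (\<lambda>A. f (col_span n r x A)) \<in> regular Z {A \<in> full_rank_mats n r. col_span n r x A \<in> W}"
  by (simp add: Gr_def quotient_regular zariski_pts)

lemma entry_regular:
  "W \<in> opens Z \<Longrightarrow> i < n \<Longrightarrow> j < r \<Longrightarrow> (\<lambda>A. A $$ (i, j)) \<in> regular Z W"
  unfolding zariski_space_opens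
  by (rule zariski_regular_polyfun) (auto intro!: polyfuns.coord simp: mat_coords_def)

lemma row_select_entry_regular:
  assumes W: "W \<in> opens Z" and \<Sigma>: "\<Sigma> \<in> index_sets n r" and ij: "i < r" "j < r"
  shows "(\<lambda>A. submatrix A \<Sigma> UNIV $$ (i, j)) \<in> regular Z W"
proof (rule Z.reg_cong)
  note \<Sigma>' = index_sets_D[OF \<Sigma>]
  show "(\<lambda>A. A $$ (pick \<Sigma> i, j)) \<in> regular Z W"
    using pick_less[OF \<Sigma>'(1), of i] \<Sigma>'(2) ij by (intro entry_regular[OF W]) auto
  fix A assume "A \<in> W"
  then have A: "A \<in> carrier_mat n r" using Z.opens_subset[OF W] full_rank_carrier by (auto simp: zariski_pts)
  show "A $$ (pick \<Sigma> i, j) = submatrix A \<Sigma> UNIV $$ (i, j)"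
    using row_select_index[OF \<Sigma>'(1) A, of i j] \<Sigma>'(2) ij by simp
qed

lemma opens_Z_carrier:
  assumes "W \<in> opens Z" "A \<in> W" shows "A \<in> full_rank_mats n r"
  using Z.opens_subset[OF assms(1)] assms(2) by (auto simp: zariski_pts)

lemma full_open: "full_rank_mats n r \<in> opens Z"
  using Z.pts_open by (simp add: zariski_pts)

lemma det_row_select_regular:
  assumes W: "W \<in> opens Z" and \<Sigma>: "\<Sigma> \<in> index_sets n r"
  shows "(\<lambda>A. det (submatrix A \<Sigma> UNIV)) \<in> regular Z W"
  by (rule Z.reg_det[OF W row_select_square[OF \<Sigma> full_rank_carrier[OF opens_Z_carrier[OF W]]]
        row_select_entry_regular[OF W \<Sigma>]])

text \<open>The preimage of the chart among full rank matrices is the non-vanishing locus of one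
  minor.\<close>

lemma chart_open:
  assumes \<Sigma>: "\<Sigma> \<in> index_sets n r" shows "chart n r x \<Sigma> \<in> opens X"
proof -
  have "{A \<in> full_rank_mats n r. col_span n r x A \<in> chart n r x \<Sigma>} =
      {A \<in> full_rank_mats n r. det (submatrix A \<Sigma> UNIV) \<noteq> 0}"
    using col_span_in_chart_iff[OF \<Sigma>] by blast
  then show ?thesis
    using Z.reg_nonzero[OF full_open det_row_select_regular[OF full_open \<Sigma>]] chart_subset_pts
    by (simp add: Gr_opens)
qed

text \<open>Regularity on the quotient is tested on matrices, where the normal form is
  \<open>A\<close> times the inverse of its selected rows; its entries are polynomials divided by
  the minor that is non-zero on the chart.\<close>

lemma Ymat_regular:
  assumes \<Sigma>: "\<Sigma> \<in> index_sets n r" and ij: "i < n" "j < r"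
  shows "(\<lambda>U. Ymat n r x \<Sigma> U $$ (i, j)) \<in> regular X (chart n r x \<Sigma>)"
  unfolding Gr_regular
proof (rule Z.reg_cong)
  let ?W = "{A \<in> full_rank_mats n r. col_span n r x A \<in> chart n r x \<Sigma>}"
  have W: "?W \<in> opens Z" using chart_open[OF \<Sigma>] by (simp add: Gr_opens)
  note sq = row_select_square[OF \<Sigma> full_rank_carrier[OF opens_Z_carrier[OF W]]]
  have det: "det (submatrix A \<Sigma> UNIV) \<noteq> 0" if "A \<in> ?W" for A
    using that col_span_in_chart_iff[OF \<Sigma>] by blast
  show "(\<lambda>A. \<Sum>k<r. A $$ (i, k) * (inverse (det (submatrix A \<Sigma> UNIV)) * adj_mat (submatrix A \<Sigma> UNIV) $$ (k, j)))
      \<in> regular Z ?W"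
    using ij by (intro Z.reg_sum[OF W] Z.reg_mult[OF W] entry_regular[OF W] Z.reg_inverse[OF W]
        det_row_select_regular[OF W \<Sigma>] det Z.reg_adj_mat[OF W sq row_select_entry_regular[OF W \<Sigma>]]) auto
  fix A assume A: "A \<in> ?W"
  then have full: "A \<in> full_rank_mats n r" by simp
  note I = inv_mat(1)[OF sq[OF A] det[OF A]]
  show "(\<Sum>k<r. A $$ (i, k) * (inverse (det (submatrix A \<Sigma> UNIV)) * adj_mat (submatrix A \<Sigma> UNIV) $$ (k, j))) =
      Ymat n r x \<Sigma> (col_span n r x A) $$ (i, j)"
    unfolding Ymat_col_span(1)[OF \<Sigma> full det[OF A]] mult_mat_index[OF full_rank_carrier[OF full] I ij]
    using adj_mat(1)[OF sq[OF A]] ij by (intro sum.cong refl) (simp add: inv_mat_def)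
qed

lemma frame_regular:
  assumes \<Sigma>: "\<Sigma> \<in> index_sets n r" and ij: "i < n" "j < n"
  shows "(\<lambda>U. frame \<Sigma> U $$ (i, j)) \<in> regular X (chart n r x \<Sigma>)"
proof (cases "j < r")
  case True
  show ?thesis
    by (rule Gr.reg_cong[OF Ymat_regular[OF \<Sigma> ij(1) True]]) (use True ij in \<open>simp add: frame_def frame_mat_def\<close>)
next
  case False
  show ?thesis
    by (rule Gr.reg_cong[OF Gr.reg_const[OF chart_open[OF \<Sigma>],
            of "if i = pick ({..<n} - \<Sigma>) (j - r) then 1 else 0"]])
      (use False ij in \<open>simp add: frame_def frame_mat_def\<close>)
qed

lemma inv_frame_regular:
  assumes \<Sigma>: "\<Sigma> \<in> index_sets n r" and ij: "i < n" "j < n"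
  shows "(\<lambda>U. inv_mat (frame \<Sigma> U) $$ (i, j)) \<in> regular X (chart n r x \<Sigma>)"
proof (rule Gr.reg_cong)
  note op = chart_open[OF \<Sigma>] and fr = frame(1)[OF \<Sigma>]
  note car = G_mat[OF fr]
  have det: "det (frame \<Sigma> U) \<noteq> 0" if "U \<in> chart n r x \<Sigma>" for U using fr[OF that] by (simp add: GLn_carrier)
  show "(\<lambda>U. inverse (det (frame \<Sigma> U)) * adj_mat (frame \<Sigma> U) $$ (i, j)) \<in> regular X (chart n r x \<Sigma>)"
    by (intro Gr.reg_mult[OF op] Gr.reg_inverse[OF op] det Gr.reg_det[OF op car]
        Gr.reg_adj_mat[OF op car] frame_regular[OF \<Sigma>] ij)
  fix U assume U: "U \<in> chart n r x \<Sigma>"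
  show "inverse (det (frame \<Sigma> U)) * adj_mat (frame \<Sigma> U) $$ (i, j) = inv_mat (frame \<Sigma> U) $$ (i, j)"
    using adj_mat(1)[OF car[OF U]] ij by (simp add: inv_mat_def)
qed

lemma morphism_to_GLn:
  assumes W: "W \<in> opens X" and \<psi>: "\<And>U. U \<in> W \<Longrightarrow> \<psi> U \<in> G"
    and reg: "\<And>i j. i < n \<Longrightarrow> j < n \<Longrightarrow> (\<lambda>U. \<psi> U $$ (i, j)) \<in> regular X W"
  shows "morphism (open_subspace X W) (zariski_space (mat_coords n n) G) \<psi>"
  by (rule Gr.morphism_zariski[OF W]) (use \<psi> reg in \<open>auto simp: mat_coords_def\<close>)

text \<open>A matrix coefficient of the rational action is regular on GL_n and is pulled back along
  the morphism \<open>\<psi>\<close>.\<close>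

lemma rho_comp_regular:
  assumes W: "W \<in> opens X" and \<psi>: "\<And>U. U \<in> W \<Longrightarrow> \<psi> U \<in> G"
    and reg: "\<And>i j. i < n \<Longrightarrow> j < n \<Longrightarrow> (\<lambda>U. \<psi> U $$ (i, j)) \<in> regular X W"
    and \<xi>: "Vector_Spaces.linear scale (*) \<xi>"
  shows "(\<lambda>U. \<xi> (\<rho> (\<psi> U) m)) \<in> regular X W"
proof -
  interpret GS: space_with_functions "zariski_space (mat_coords n n) G"
    by (rule zariski_space_with_functions)
  have "G \<in> opens (zariski_space (mat_coords n n) G)" using GS.pts_open by (simp add: zariski_pts)
  from morphism_regular[OF morphism_to_GLn[OF W \<psi> reg] this rho_regular[OF \<xi>]]
  have "(\<lambda>U. \<xi> (\<rho> (\<psi> U) m)) \<in> regular X {U \<in> W. \<psi> U \<in> G}" by (simp add: open_subspace_def)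
  moreover have "{U \<in> W. \<psi> U \<in> G} = W" using \<psi> by blast
  ultimately show ?thesis by simp
qed

text \<open>The map is covered by left multiplication with \<open>g\<close> on matrices, which is
  linear in the entries.\<close>

lemma gr_act_morphism:
  assumes g: "g \<in> G" shows "morphism X X (gr_act \<alpha> g)"
  unfolding Gr_def
proof (rule Z.morphism_quotient)
  have "morphism (open_subspace Z (pts Z)) Z ((*) g)"
  proof (rule Z.morphism_zariski[OF Z.pts_open])
    show "(*) g ` pts Z \<subseteq> full_rank_mats n r" using full_rank_mult_left[OF g] by (auto simp: zariski_pts)
    fix c :: "'k mat \<Rightarrow> 'k" assume "c \<in> mat_coords n r"
    then obtain i j where c: "c = (\<lambda>A. A $$ (i, j))" and ij: "i < n" "j < r" by (auto simp: mat_coords_def)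
    have "(\<lambda>A. \<Sum>k<n. g $$ (i, k) * A $$ (k, j)) \<in> regular Z (pts Z)"
      using ij by (intro Z.reg_sum Z.reg_mult Z.reg_const entry_regular Z.pts_open) auto
    then show "(\<lambda>A. c (g * A)) \<in> regular Z (pts Z)"
      by (rule Z.reg_cong) (simp add: c zariski_pts mult_mat_index[OF G_mat[OF g] full_rank_carrier ij])
  qed
  then show "morphism Z Z ((*) g)" by (simp add: Z.open_subspace_pts)
  show "gr_act \<alpha> g (col_span n r x A) = col_span n r x (g * A)" if "A \<in> pts Z" for A
    using that by (intro gr_act_col_span[OF g] full_rank_carrier) (simp add: zariski_pts)
qed (rule zariski_space_with_functions)

text \<open>The translate of \<open>W\<close> by \<open>g\<close> is the preimage of
  \<open>W\<close> under the morphism given by the inverse of \<open>g\<close>.\<close>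

lemma translate_open:
  assumes g: "g \<in> G" and W: "W \<in> opens X"
  shows "gr_act \<alpha> g ` W \<in> opens X"
    and "f \<in> regular X W \<Longrightarrow> (\<lambda>U. f (gr_act \<alpha> (inv_mat g) U)) \<in> regular X (gr_act \<alpha> g ` W)"
proof -
  have "gr_act \<alpha> g ` W \<subseteq> pts X" using Gr.opens_subset[OF W] gr_act_pts[OF g] by blast
  then have eq: "{U \<in> pts X. gr_act \<alpha> (inv_mat g) U \<in> W} = gr_act \<alpha> g ` W"
    using gr_act_inv_mem_iff[OF g Gr.opens_subset[OF W]] by blast
  note m = gr_act_morphism[OF GLn_inv_mat(1)[OF g]]
  show "gr_act \<alpha> g ` W \<in> opens X" using morphism_open[OF m W] unfolding eq .
  show "f \<in> regular X W \<Longrightarrow> (\<lambda>U. f (gr_act \<alpha> (inv_mat g) U)) \<in> regular X (gr_act \<alpha> g ` W)"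
    using morphism_regular[OF m W] unfolding eq .
qed

text \<open>Pulling back along the normal form \<open>Ymat\<close> turns a local fraction of polynomials in the matrix
  entries into a fraction of functions regular on the whole chart.\<close>

lemma regular_chart_fraction:
  assumes \<Sigma>: "\<Sigma> \<in> index_sets n r" and W: "W \<in> opens X" "W \<subseteq> chart n r x \<Sigma>"
    and f: "f \<in> regular X W" and U: "U \<in> W"
  shows "\<exists>W'\<in>opens X. U \<in> W' \<and> W' \<subseteq> W \<and>
    (\<exists>g\<in>regular X (chart n r x \<Sigma>). \<exists>h\<in>regular X (chart n r x \<Sigma>). \<forall>V\<in>W'. h V \<noteq> 0 \<and> f V = g V / h V)"
proof -
  let ?Y = "Ymat n r x \<Sigma>"
  note op = chart_open[OF \<Sigma>]
  have Y: "?Y V \<in> full_rank_mats n r" "col_span n r x (?Y V) = V" if "V \<in> chart n r x \<Sigma>" for V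
    using Ymat_chart[OF \<Sigma> that] by blast+
  have m: "morphism (open_subspace X (chart n r x \<Sigma>)) Z ?Y"
    by (rule Gr.morphism_zariski[OF op]) (use Y(1) Ymat_regular[OF \<Sigma>] in \<open>auto simp: mat_coords_def\<close>)
  have UY: "?Y U \<in> {A \<in> full_rank_mats n r. col_span n r x A \<in> W}" using Y U W(2) by auto
  obtain W1 g h where *: "W1 \<in> zariski_opens (mat_coords n r) (full_rank_mats n r)" "?Y U \<in> W1"
    "W1 \<subseteq> {A \<in> full_rank_mats n r. col_span n r x A \<in> W}" "g \<in> polyfuns (mat_coords n r)"
    "h \<in> polyfuns (mat_coords n r)" "\<And>A. A \<in> W1 \<Longrightarrow> h A \<noteq> 0" "\<And>A. A \<in> W1 \<Longrightarrow> f (col_span n r x A) = g A / h A"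
    by (rule zariski_regularE[OF f[unfolded Gr_regular] UY]) (rule that)
  have W1: "W1 \<in> opens Z" using *(1) by (simp add: zariski_space_opens)
  let ?W' = "{V \<in> chart n r x \<Sigma>. ?Y V \<in> W1}"
  have poly: "(\<lambda>V. q (?Y V)) \<in> regular X (chart n r x \<Sigma>)" if "q \<in> polyfuns (mat_coords n r)" for q
    by (rule Gr.reg_polyfun[OF op _ that]) (auto simp: mat_coords_def intro: Ymat_regular[OF \<Sigma>])
  have "?W' \<in> opens X" using morphism_open[OF m W1] by (simp add: open_subspace_def)
  moreover have "U \<in> ?W'" using U W(2) *(2) by blast
  moreover have "?W' \<subseteq> W"
  proof
    fix V assume V: "V \<in> ?W'"
    then have "col_span n r x (?Y V) \<in> W" using *(3) by blast
    then show "V \<in> W" using Y(2) V by simp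
  qed
  moreover have "h (?Y V) \<noteq> 0 \<and> f V = g (?Y V) / h (?Y V)" if "V \<in> ?W'" for V
    using *(6,7)[of "?Y V"] Y(2)[of V] that by simp
  ultimately show ?thesis
    using poly[OF *(4)] poly[OF *(5)]
    apply (intro bexI[of _ ?W'] conjI)
       apply assumption+
     apply (rule bexI[of _ "\<lambda>V. g (?Y V)"])
      apply (rule bexI[of _ "\<lambda>V. h (?Y V)"])
       apply blast
      apply assumption+
    done
qed

end

section \<open>The subsheaf with prescribed fibres and the associated bundle\<close>

lemma (in space_with_functions) morphism_cong:
  assumes m: "morphism (open_subspace X W) Y \<phi>" and eq: "\<And>a. a \<in> W \<Longrightarrow> \<phi> a = \<phi>' a"
  shows "morphism (open_subspace X W) Y \<phi>'"
proof -
  have set: "{a \<in> W. \<phi>' a \<in> V} = {a \<in> W. \<phi> a \<in> V}" for V using eq by auto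
  show ?thesis
    unfolding morphism_def
  proof (intro conjI ballI)
    show "\<phi>' ` pts (open_subspace X W) \<subseteq> pts Y"
      using morphism_pts[OF m] eq by (auto simp: open_subspace_def)
    fix V assume V: "V \<in> opens Y"
    show "{a \<in> pts (open_subspace X W). \<phi>' a \<in> V} \<in> opens (open_subspace X W)"
      using morphism_open[OF m V] set by (simp add: open_subspace_def)
    fix f assume "f \<in> regular Y V"
    then have "(\<lambda>a. f (\<phi> a)) \<in> regular X {a \<in> W. \<phi> a \<in> V}"
      using morphism_regular[OF m V] by (simp add: open_subspace_def)
    then have "(\<lambda>a. f (\<phi>' a)) \<in> regular X {a \<in> W. \<phi> a \<in> V}"
      by (rule reg_cong) (use eq in auto)
    then show "(\<lambda>a. f (\<phi>' a)) \<in> regular (open_subspace X W) {a \<in> pts (open_subspace X W). \<phi>' a \<in> V}"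
      using set by (simp add: open_subspace_def)
  qed
qed

lemma sheaf_iso_onD:
  assumes "sheaf_iso_on X W0 F H \<phi>" "W \<in> opens X" "W \<subseteq> W0"
  shows "bij_betw (\<phi> W) (sections F W) (sections H W)"
    "s \<in> sections F W \<Longrightarrow> t \<in> sections F W \<Longrightarrow> \<phi> W (sadd F s t) = sadd H (\<phi> W s) (\<phi> W t)"
    "f \<in> regular X W \<Longrightarrow> s \<in> sections F W \<Longrightarrow> \<phi> W (smul F f s) = smul H f (\<phi> W s)"
    "W' \<in> opens X \<Longrightarrow> W' \<subseteq> W \<Longrightarrow> s \<in> sections F W \<Longrightarrow> \<phi> W' (srestr F W' s) = srestr H W' (\<phi> W s)"
    "s \<in> sections F W \<Longrightarrow> \<phi> W s \<in> sections H W"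
proof -
  have *: "bij_betw (\<phi> W) (sections F W) (sections H W) \<and>
     (\<forall>s\<in>sections F W. \<forall>t\<in>sections F W. \<phi> W (sadd F s t) = sadd H (\<phi> W s) (\<phi> W t)) \<and>
     (\<forall>f\<in>regular X W. \<forall>s\<in>sections F W. \<phi> W (smul F f s) = smul H f (\<phi> W s)) \<and>
     (\<forall>W'\<in>opens X. W' \<subseteq> W \<longrightarrow>
        (\<forall>s\<in>sections F W. \<phi> W' (srestr F W' s) = srestr H W' (\<phi> W s)))"
    using assms unfolding sheaf_iso_on_def by simp
  show "bij_betw (\<phi> W) (sections F W) (sections H W)" using * by (rule conjunct1)
  then show "s \<in> sections F W \<Longrightarrow> \<phi> W s \<in> sections H W" by (rule bij_betwE[THEN bspec])
  show "s \<in> sections F W \<Longrightarrow> t \<in> sections F W \<Longrightarrow> \<phi> W (sadd F s t) = sadd H (\<phi> W s) (\<phi> W t)"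
    using * by simp
  show "f \<in> regular X W \<Longrightarrow> s \<in> sections F W \<Longrightarrow> \<phi> W (smul F f s) = smul H f (\<phi> W s)"
    using * by simp
  show "W' \<in> opens X \<Longrightarrow> W' \<subseteq> W \<Longrightarrow> s \<in> sections F W \<Longrightarrow> \<phi> W' (srestr F W' s) = srestr H W' (\<phi> W s)"
    using * by simp
qed

lemma sheaf_iso_on_trans:
  assumes \<phi>: "sheaf_iso_on X W0 F H \<phi>" and \<psi>: "sheaf_iso_on X W1 H K \<psi>" and "W0 \<subseteq> W1"
  shows "sheaf_iso_on X W0 F K (\<lambda>W s. \<psi> W (\<phi> W s))"
  unfolding sheaf_iso_on_def
proof (intro ballI impI conjI)
  fix W assume W: "W \<in> opens X" "W \<subseteq> W0"
  note A = sheaf_iso_onD[OF \<phi> W] and B = sheaf_iso_onD[OF \<psi> W(1) subset_trans[OF W(2) assms(3)]]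
  show "bij_betw (\<lambda>s. \<psi> W (\<phi> W s)) (sections F W) (sections K W)"
    using bij_betw_trans[OF A(1) B(1)] by (simp add: comp_def)
  fix s assume s: "s \<in> sections F W"
  show "\<psi> W (\<phi> W (sadd F s t)) = sadd K (\<psi> W (\<phi> W s)) (\<psi> W (\<phi> W t))" if "t \<in> sections F W" for t
    using A(2)[OF s that] B(2)[OF A(5)[OF s] A(5)[OF that]] by simp
  show "\<psi> W (\<phi> W (smul F f s)) = smul K f (\<psi> W (\<phi> W s))" if "f \<in> regular X W" for f
    using A(3)[OF that s] B(3)[OF that A(5)[OF s]] by simp
  show "\<psi> W' (\<phi> W' (srestr F W' s)) = srestr K W' (\<psi> W (\<phi> W s))" if "W' \<in> opens X" "W' \<subseteq> W" for W'
    using A(4)[OF that s] B(4)[OF that A(5)[OF s]] by simp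
qed

section \<open>Regular functions with values in M\<close>

context equivariant_kE_module
begin

abbreviation "functional \<equiv> Vector_Spaces.linear scale (*)"

lemma functional_sum:
  assumes "functional \<xi>"
  shows "\<xi> (\<Sum>i\<in>I. scale (c i) (e i)) = (\<Sum>i\<in>I. c i * \<xi> (e i))"
proof -
  have add: "\<xi> (a + b) = \<xi> a + \<xi> b" and mult: "\<xi> (scale k a) = k * \<xi> a" for a b k
    using assms unfolding Vector_Spaces.linear_iff by blast+
  have "\<xi> 0 = 0" using mult[of 0 0] by simp
  then show ?thesis by (induction I rule: infinite_finite_induct) (simp_all add: add mult)
qed

lemma functional_rho:
  assumes "g \<in> G" "functional \<xi>" shows "functional (\<lambda>m. \<xi> (\<rho> g m))"
  using Vector_Spaces.linear_compose[OF rho_linear[OF assms(1)] assms(2)] by (simp add: comp_def)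

lemma coordinates:
  assumes "M.subspace N"
  obtains d :: nat and e \<xi> where "\<And>i. i < d \<Longrightarrow> e i \<in> N" "\<And>i. functional (\<xi> i)"
    "\<And>v. v \<in> N \<Longrightarrow> v = (\<Sum>i<d. scale (\<xi> i v) (e i))"
    "\<And>i j. i < d \<Longrightarrow> j < d \<Longrightarrow> \<xi> i (e j) = (if i = j then 1 else 0)"
proof -
  obtain B where "finite B" "M.span B = UNIV" using finite_dim by blast
  then show thesis by (rule subspace_coordinates[OF _ _ assms]) (rule that)
qed

text \<open>Finite sums of vectors with regular coefficients are replaced by a criterion that
  mentions no choice of vectors. The converse direction expands in a basis of the finite dimensional
  space M.\<close>

lemma tensor_sections_iff:
  assumes W: "W \<in> opens X"
  shows "s \<in> tensor_sections X scale W \<longleftrightarrow>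
    (\<forall>U. U \<notin> W \<longrightarrow> s U = 0) \<and> (\<forall>\<xi>. functional \<xi> \<longrightarrow> (\<lambda>U. \<xi> (s U)) \<in> regular X W)"
proof (intro iffI conjI allI impI)
  assume s: "s \<in> tensor_sections X scale W"
  then show "s U = 0" if "U \<notin> W" for U using that by (simp add: tensor_sections_def)
  obtain B f where "\<forall>b\<in>B. f b \<in> regular X W" "\<forall>U\<in>W. s U = (\<Sum>b\<in>B. scale (f b U) b)"
    using s unfolding tensor_sections_def by (elim CollectE conjE exE)
  then have f: "\<And>b. b \<in> B \<Longrightarrow> f b \<in> regular X W" "\<And>U. U \<in> W \<Longrightarrow> s U = (\<Sum>b\<in>B. scale (f b U) b)"
    by simp_all
  fix \<xi> assume \<xi>: "functional \<xi>"
  have "(\<lambda>U. \<Sum>b\<in>B. f b U * \<xi> b) \<in> regular X W"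
    by (intro Gr.reg_sum[OF W] Gr.reg_mult[OF W] Gr.reg_const[OF W] f(1))
  then show "(\<lambda>U. \<xi> (s U)) \<in> regular X W"
    by (rule Gr.reg_cong) (simp add: f(2) functional_sum[OF \<xi>])
next
  assume *: "(\<forall>U. U \<notin> W \<longrightarrow> s U = 0) \<and> (\<forall>\<xi>. functional \<xi> \<longrightarrow> (\<lambda>U. \<xi> (s U)) \<in> regular X W)"
  obtain d :: nat and e \<xi> where e: "\<And>i. i < d \<Longrightarrow> e i \<in> UNIV" "\<And>i. functional (\<xi> i)"
    "\<And>v. v \<in> UNIV \<Longrightarrow> v = (\<Sum>i<d. scale (\<xi> i v) (e i))"
    "\<And>i j. i < d \<Longrightarrow> j < d \<Longrightarrow> \<xi> i (e j) = (if i = j then 1 else 0)"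
    by (rule coordinates[OF M.subspace_UNIV]) (rule that)
  have inj: "inj_on e {..<d}"
    using e(4) by (intro inj_onI) (metis lessThan_iff zero_neq_one)
  \<comment> \<open>The definition indexes coefficients by vectors and not by numbers, so the
    coordinate belonging to \<open>b\<close> is found by inverting \<open>e\<close>.\<close>
  let ?f = "\<lambda>b U. \<xi> (the_inv_into {..<d} e b) (s U)"
  have "(\<Sum>b\<in>e ` {..<d}. scale (?f b U) b) = s U" for U
    unfolding sum.reindex[OF inj] comp_def
    by (subst e(3)[of "s U"]) (simp_all add: the_inv_into_f_f[OF inj])
  moreover have "?f b \<in> regular X W" for b using * e(2) by blast
  ultimately show "s \<in> tensor_sections X scale W"
    unfolding tensor_sections_def using *
    by (intro CollectI conjI exI[of _ "e ` {..<d}"] exI[of _ ?f]) auto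
qed

text \<open>Here both the group element and the vector vary. Expanding \<open>s U\<close> in a basis
  of M separates them: regular coordinates times matrix coefficients at constant vectors.\<close>

lemma tensor_section_rho_regular:
  assumes W: "W \<in> opens X" and s: "\<And>\<xi>. functional \<xi> \<Longrightarrow> (\<lambda>U. \<xi> (s U)) \<in> regular X W"
    and \<psi>: "\<And>U. U \<in> W \<Longrightarrow> \<psi> U \<in> G"
    and reg: "\<And>i j. i < n \<Longrightarrow> j < n \<Longrightarrow> (\<lambda>U. \<psi> U $$ (i, j)) \<in> regular X W"
    and \<xi>: "functional \<xi>"
  shows "(\<lambda>U. \<xi> (\<rho> (\<psi> U) (s U))) \<in> regular X W"
proof -
  obtain d :: nat and b \<eta> where b: "\<And>i. i < d \<Longrightarrow> b i \<in> UNIV" "\<And>i. functional (\<eta> i)"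
    "\<And>v. v \<in> UNIV \<Longrightarrow> v = (\<Sum>i<d. scale (\<eta> i v) (b i))"
    "\<And>i j. i < d \<Longrightarrow> j < d \<Longrightarrow> \<eta> i (b j) = (if i = j then 1 else 0)"
    by (rule coordinates[OF M.subspace_UNIV]) (rule that)
  have "(\<lambda>U. \<Sum>i<d. \<eta> i (s U) * \<xi> (\<rho> (\<psi> U) (b i))) \<in> regular X W"
    by (intro Gr.reg_sum[OF W] Gr.reg_mult[OF W] s b(2) rho_comp_regular[OF W \<psi> reg \<xi>])
  moreover have "(\<Sum>i<d. \<eta> i (s U) * \<xi> (\<rho> (\<psi> U) (b i))) = \<xi> (\<rho> (\<psi> U) (s U))" if "U \<in> W" for U
  proof -
    have "\<rho> (\<psi> U) (s U) = (\<Sum>i<d. scale (\<eta> i (s U)) (\<rho> (\<psi> U) (b i)))"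
      by (subst b(3)[of "s U"]) (simp_all add: rho_sum[OF \<psi>[OF that]] rho_scale[OF \<psi>[OF that]])
    then show ?thesis by (simp add: functional_sum[OF \<xi>])
  qed
  ultimately show ?thesis by (rule Gr.reg_cong)
qed

lemma chart_subopen:
  assumes \<Sigma>: "\<Sigma> \<in> index_sets n r" and W: "W \<in> opens X" "W \<subseteq> chart n r x \<Sigma>"
  shows "U \<in> W \<Longrightarrow> frame \<Sigma> U \<in> G" "U \<in> W \<Longrightarrow> inv_mat (frame \<Sigma> U) \<in> G"
    "i < n \<Longrightarrow> j < n \<Longrightarrow> (\<lambda>U. frame \<Sigma> U $$ (i, j)) \<in> regular X W"
    "i < n \<Longrightarrow> j < n \<Longrightarrow> (\<lambda>U. inv_mat (frame \<Sigma> U) $$ (i, j)) \<in> regular X W"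
proof -
  show "frame \<Sigma> U \<in> G" if "U \<in> W" using that W(2) frame(1)[OF \<Sigma>] by blast
  then show "inv_mat (frame \<Sigma> U) \<in> G" if "U \<in> W" using that GLn_inv_mat(1) by blast
  show "i < n \<Longrightarrow> j < n \<Longrightarrow> (\<lambda>U. frame \<Sigma> U $$ (i, j)) \<in> regular X W"
    by (rule Gr.reg_restrict[OF frame_regular[OF \<Sigma>] chart_open[OF \<Sigma>] W])
  show "i < n \<Longrightarrow> j < n \<Longrightarrow> (\<lambda>U. inv_mat (frame \<Sigma> U) $$ (i, j)) \<in> regular X W"
    by (rule Gr.reg_restrict[OF inv_frame_regular[OF \<Sigma>] chart_open[OF \<Sigma>] W])
qed

lemma frame_combination_tensor_section:
  assumes \<Sigma>: "\<Sigma> \<in> index_sets n r" and W: "W \<in> opens X" "W \<subseteq> chart n r x \<Sigma>"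
    and c: "\<And>i. i \<in> I \<Longrightarrow> c i \<in> regular X W"
  shows "(\<lambda>U. if U \<in> W then \<Sum>i\<in>I. scale (c i U) (\<rho> (frame \<Sigma> U) (e i)) else 0) \<in> tensor_sections X scale W"
  unfolding tensor_sections_iff[OF W(1)]
proof (intro conjI allI impI)
  note S = chart_subopen[OF \<Sigma> W]
  fix \<xi> assume \<xi>: "functional \<xi>"
  have "(\<lambda>U. \<Sum>i\<in>I. c i U * \<xi> (\<rho> (frame \<Sigma> U) (e i))) \<in> regular X W"
    by (intro Gr.reg_sum[OF W(1)] Gr.reg_mult[OF W(1)] c rho_comp_regular[OF W(1) S(1) S(3) \<xi>])
  then show "(\<lambda>U. \<xi> (if U \<in> W then \<Sum>i\<in>I. scale (c i U) (\<rho> (frame \<Sigma> U) (e i)) else 0)) \<in> regular X W"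
    by (rule Gr.reg_cong) (simp add: functional_sum[OF \<xi>])
qed simp

text \<open>Finitely many local fractions are treated one after the other, shrinking the
  neighbourhood each time. A single denominator is needed because a local section of the associated
  sheaf is one element of the module divided by one function.\<close>

lemma regular_chart_common_denominator:
  assumes \<Sigma>: "\<Sigma> \<in> index_sets n r" and W: "W \<in> opens X" "W \<subseteq> chart n r x \<Sigma>"
    and f: "\<And>i::nat. i < d \<Longrightarrow> f i \<in> regular X W" and U: "U \<in> W"
  shows "\<exists>W' g h. W' \<in> opens X \<and> U \<in> W' \<and> W' \<subseteq> W \<and> (\<forall>i<d. g i \<in> regular X (chart n r x \<Sigma>)) \<and>
     h \<in> regular X (chart n r x \<Sigma>) \<and> (\<forall>V\<in>W'. h V \<noteq> 0 \<and> (\<forall>i<d. f i V = g i V / h V))"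
  using f
proof (induction d)
  case 0
  show ?case
    using W U Gr.reg_const[OF chart_open[OF \<Sigma>], of 1]
    by (intro exI[of _ W] exI[of _ "\<lambda>_ _. 1"] exI[of _ "\<lambda>_. 1"]) auto
next
  case (Suc d)
  note op = chart_open[OF \<Sigma>]
  obtain W1 g h where 1: "W1 \<in> opens X" "U \<in> W1" "W1 \<subseteq> W" "\<And>i. i < d \<Longrightarrow> g i \<in> regular X (chart n r x \<Sigma>)"
     "h \<in> regular X (chart n r x \<Sigma>)" "\<And>V. V \<in> W1 \<Longrightarrow> h V \<noteq> 0"
     "\<And>V i. V \<in> W1 \<Longrightarrow> i < d \<Longrightarrow> f i V = g i V / h V"
    using Suc by (metis less_Suc_eq)
  obtain W2 g' h' where 2: "W2 \<in> opens X" "U \<in> W2" "W2 \<subseteq> W" "g' \<in> regular X (chart n r x \<Sigma>)"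
     "h' \<in> regular X (chart n r x \<Sigma>)" "\<And>V. V \<in> W2 \<Longrightarrow> h' V \<noteq> 0" "\<And>V. V \<in> W2 \<Longrightarrow> f d V = g' V / h' V"
    using regular_chart_fraction[OF \<Sigma> W Suc.prems[OF lessI] U] by blast
  \<comment> \<open>Cross multiplication to the denominator \<open>h * h'\<close>: old numerators
    gain the factor \<open>h'\<close>, the new one gains \<open>h\<close>.\<close>
  let ?g = "\<lambda>i V. if i < d then g i V * h' V else g' V * h V"
  have "?g i \<in> regular X (chart n r x \<Sigma>)" for i
    using 1(4)[of i] 1(5) 2(4,5) by (cases "i < d") (simp_all add: Gr.reg_mult[OF op])
  moreover have "(\<lambda>V. h V * h' V) \<in> regular X (chart n r x \<Sigma>)" using 1(5) 2(5) by (rule Gr.reg_mult[OF op])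
  moreover have "h V * h' V \<noteq> 0 \<and> (\<forall>i<Suc d. f i V = ?g i V / (h V * h' V))" if "V \<in> W1 \<inter> W2" for V
    using 1(6,7)[of V] 2(6,7)[of V] that by (auto simp: less_Suc_eq)
  moreover have "W1 \<inter> W2 \<in> opens X" using 1(1) 2(1) by (rule Gr.open_Int)
  ultimately show ?case
    using 1(2,3) 2(2) by (intro exI[of _ "W1 \<inter> W2"] exI[of _ ?g] exI[of _ "\<lambda>V. h V * h' V"] conjI) blast+
qed

end

text \<open>The common part of the arguments for Ker and Im. The modules \<open>N \<Sigma>\<close>
  enter through an upper bound, \<open>chart_fib\<close>, and a lower bound,
  \<open>chart_gen\<close>: their elements take values in the fibres, and they contain all
  combinations of frame translates of vectors in \<open>fib U0\<close> with coefficients regular on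
  the chart. Together these bounds determine the glued sheaf.\<close>

locale equivariant_fibres = equivariant_kE_module act n r x \<alpha> \<rho>
  for act :: "('e::ab_group_add \<Rightarrow>\<^sub>0 'k::field) \<Rightarrow> 'm \<Rightarrow> 'm::ab_group_add" and n r x \<alpha> \<rho> +
  fixes fib :: "('e \<Rightarrow>\<^sub>0 'k) set \<Rightarrow> 'm set"
    and N :: "nat set \<Rightarrow> (('e \<Rightarrow>\<^sub>0 'k) set \<Rightarrow> 'm) set"
  assumes fib_subspace: "M.subspace (fib U)"
    and fib_equiv: "g \<in> G \<Longrightarrow> m \<in> fib U \<Longrightarrow> \<rho> g m \<in> fib (gr_act \<alpha> g U)"
    and chart_fib: "\<Sigma> \<in> index_sets n r \<Longrightarrow> t \<in> N \<Sigma> \<Longrightarrow> U \<in> chart n r x \<Sigma> \<Longrightarrow> t U \<in> fib U"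
    and chart_gen: "\<Sigma> \<in> index_sets n r \<Longrightarrow> (\<And>i. i < d \<Longrightarrow> e i \<in> fib U0) \<Longrightarrow>
      (\<And>i. i < d \<Longrightarrow> c i \<in> regular X (chart n r x \<Sigma>)) \<Longrightarrow>
      (\<lambda>U. if U \<in> chart n r x \<Sigma> then \<Sum>i<(d::nat). scale (c i U) (\<rho> (frame \<Sigma> U) (e i)) else 0) \<in> N \<Sigma>"
begin

abbreviation "F \<equiv> glued_subsheaf n r x \<alpha> act \<rho> N"
abbreviation "P \<equiv> parabolic n r x \<alpha>"
abbreviation "L \<equiv> L_sheaf n r x \<alpha> (mscale act) \<rho> (fib U0)"
abbreviation "T \<equiv> total_space n P (mscale act) \<rho> (fib U0)"

lemma fib_frame:
  assumes "g \<in> G"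
  shows "m \<in> fib U0 \<Longrightarrow> \<rho> g m \<in> fib (gr_act \<alpha> g U0)"
    and "m \<in> fib (gr_act \<alpha> g U0) \<Longrightarrow> \<rho> (inv_mat g) m \<in> fib U0"
  using fib_equiv[OF assms, of m U0] fib_equiv[OF GLn_inv_mat(1)[OF assms], of m "gr_act \<alpha> g U0"]
    gr_act_inv(1)[OF assms U0_in_pts] by simp_all

lemma frame_coordinates_regular:
  assumes \<Sigma>: "\<Sigma> \<in> index_sets n r" and W: "W \<in> opens X" "W \<subseteq> chart n r x \<Sigma>"
    and s: "s \<in> tensor_sections X scale W" and \<xi>: "functional \<xi>"
  shows "(\<lambda>U. \<xi> (\<rho> (inv_mat (frame \<Sigma> U)) (s U))) \<in> regular X W"
  using s chart_subopen[OF \<Sigma> W] unfolding tensor_sections_iff[OF W(1)]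
  by (intro tensor_section_rho_regular[OF W(1) _ _ _ \<xi>]) auto

lemma tensor_sections_restrict:
  assumes "s \<in> tensor_sections X scale W" "W \<in> opens X" "W' \<in> opens X" "W' \<subseteq> W"
  shows "(\<lambda>U. if U \<in> W' then s U else 0) \<in> tensor_sections X scale W'"
  unfolding tensor_sections_iff[OF assms(3)]
proof (intro conjI allI impI)
  fix \<xi> assume "functional \<xi>"
  then have "(\<lambda>U. \<xi> (s U)) \<in> regular X W" using assms(1) tensor_sections_iff[OF assms(2)] by blast
  then have "(\<lambda>U. \<xi> (s U)) \<in> regular X W'" by (rule Gr.reg_restrict[OF _ assms(2-4)])
  then show "(\<lambda>U. \<xi> (if U \<in> W' then s U else 0)) \<in> regular X W'" by (rule Gr.reg_cong) simp
qed simp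

lemma sections_glued:
  assumes W: "W \<in> opens X"
  shows "sections F W = {s \<in> tensor_sections X scale W. \<forall>U\<in>W. s U \<in> fib U}" (is "_ = ?S")
proof (intro equalityI subsetI)
  fix s assume s: "s \<in> sections F W"
  have "s U \<in> fib U" if U: "U \<in> W" for U
  proof -
    obtain \<Sigma> where \<Sigma>: "\<Sigma> \<in> index_sets n r" "U \<in> chart n r x \<Sigma>"
      using charts_cover Gr.opens_subset[OF W] U by blast
    let ?s = "\<lambda>U. if U \<in> W \<inter> chart n r x \<Sigma> then s U else 0"
    have "?s \<in> assoc_sections X scale (chart n r x \<Sigma>) (N \<Sigma>) (W \<inter> chart n r x \<Sigma>)"
      using s \<Sigma>(1) by (simp add: glued_subsheaf_def)
    then obtain t h where "t \<in> N \<Sigma>" "?s U = scale (inverse (h U)) (t U)"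
      using U \<Sigma>(2) unfolding assoc_sections_def by blast
    then show ?thesis
      using chart_fib[OF \<Sigma>(1) _ \<Sigma>(2)] M.subspace_scale[OF fib_subspace] U \<Sigma>(2) by simp
  qed
  then show "s \<in> ?S" using s by (simp add: glued_subsheaf_def)
next
  fix s assume s: "s \<in> ?S"
  have "(\<lambda>U. if U \<in> W \<inter> chart n r x \<Sigma> then s U else 0) \<in>
      assoc_sections X scale (chart n r x \<Sigma>) (N \<Sigma>) (W \<inter> chart n r x \<Sigma>)" (is "?s \<in> _")
    if \<Sigma>: "\<Sigma> \<in> index_sets n r" for \<Sigma>
  proof -
    let ?W = "W \<inter> chart n r x \<Sigma>"
    have W': "?W \<in> opens X" "?W \<subseteq> chart n r x \<Sigma>" using Gr.open_Int[OF W chart_open[OF \<Sigma>]] by auto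
    obtain d :: nat and e \<xi> where e: "\<And>i. i < d \<Longrightarrow> e i \<in> fib U0" "\<And>i. functional (\<xi> i)"
    "\<And>v. v \<in> fib U0 \<Longrightarrow> v = (\<Sum>i<d. scale (\<xi> i v) (e i))"
    "\<And>i j. i < d \<Longrightarrow> j < d \<Longrightarrow> \<xi> i (e j) = (if i = j then 1 else 0)"
    by (rule coordinates[OF fib_subspace[of U0]]) (rule that)
    have s': "?s \<in> tensor_sections X scale ?W"
      using s W' by (intro tensor_sections_restrict[OF _ W]) auto
    \<comment> \<open>The inverse frame moves the values of the section into the constant fibre at
      \<open>U0\<close>, where they have coordinates; these are regular only on \<open>W\<close>
      within the chart.\<close>
    let ?c = "\<lambda>i U. \<xi> i (\<rho> (inv_mat (frame \<Sigma> U)) (?s U))"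
    have c: "?c i \<in> regular X ?W" for i by (rule frame_coordinates_regular[OF \<Sigma> W' s' e(2)])
    have "\<exists>W'\<in>opens X. U \<in> W' \<and> W' \<subseteq> ?W \<and>
        (\<exists>t\<in>N \<Sigma>. \<exists>h\<in>regular X (chart n r x \<Sigma>). \<forall>V\<in>W'. h V \<noteq> 0 \<and> ?s V = scale (inverse (h V)) (t V))"
      if U: "U \<in> ?W" for U
    proof -
      obtain W1 g h where 1: "W1 \<in> opens X" "U \<in> W1" "W1 \<subseteq> ?W" "\<And>i. i < d \<Longrightarrow> g i \<in> regular X (chart n r x \<Sigma>)"
        "h \<in> regular X (chart n r x \<Sigma>)" "\<And>V. V \<in> W1 \<Longrightarrow> h V \<noteq> 0"
        "\<And>V i. V \<in> W1 \<Longrightarrow> i < d \<Longrightarrow> ?c i V = g i V / h V"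
        using regular_chart_common_denominator[where f = ?c, OF \<Sigma> W' c U] by metis
      \<comment> \<open>The numerators alone, regular on the whole chart, are recombined with the
        frame; the result lies in the module by \<open>chart_gen\<close>, and division by
        \<open>h\<close> returns the given section.\<close>
      let ?t = "\<lambda>U. if U \<in> chart n r x \<Sigma> then \<Sum>i<d. scale (g i U) (\<rho> (frame \<Sigma> U) (e i)) else 0"
      have "?t \<in> N \<Sigma>" by (rule chart_gen[OF \<Sigma> e(1) 1(4)])
      moreover have "?s V = scale (inverse (h V)) (?t V)" if V: "V \<in> W1" for V
      proof -
        have V': "V \<in> W" "V \<in> chart n r x \<Sigma>" using V 1(3) by auto
        note fr = frame[OF \<Sigma> V'(2)]
        have "\<rho> (inv_mat (frame \<Sigma> V)) (s V) \<in> fib U0"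
          using fib_frame(2)[OF fr(1)] s V'(1) fr(2) by simp
        then have "\<rho> (inv_mat (frame \<Sigma> V)) (s V) = (\<Sum>i<d. scale (?c i V) (e i))"
          using e(3) V' by simp
        also have "\<dots> = (\<Sum>i<d. scale (g i V / h V) (e i))"
          using 1(7)[OF V] by (intro sum.cong) auto
        finally have "s V = \<rho> (frame \<Sigma> V) (\<Sum>i<d. scale (g i V / h V) (e i))"
          using rho_inv(1)[OF fr(1), of "s V"] by simp
        then show ?thesis
          using V' by (simp add: rho_sum[OF fr(1)] rho_scale[OF fr(1)] M.scale_sum_right divide_inverse mult.commute)
      qed
      ultimately show ?thesis using 1(1,2,3,5,6) by (intro bexI[of _ W1] conjI bexI[of _ ?t] bexI[of _ h]) auto
    qed
    then show ?thesis unfolding assoc_sections_def by simp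
  qed
  then show "s \<in> sections F W" using s by (simp add: glued_subsheaf_def)
qed

lemma F_simps: "sadd F s t = (\<lambda>U. s U + t U)" "smul F f s = (\<lambda>U. scale (f U) (s U))"
  "srestr F W s = (\<lambda>U. if U \<in> W then s U else 0)"
  "g \<in> G \<Longrightarrow> sact F g s = (\<lambda>U. \<rho> g (s (gr_act \<alpha> (inv_mat g) U)))"
  by (simp_all add: glued_subsheaf_def GLn_inv)

lemma L_simps: "sadd L s t = (\<lambda>U. {(g, m + m') |g m m'. (g, m) \<in> s U \<and> (g, m') \<in> t U})"
  "smul L f t = (\<lambda>U. {(g, scale (f U) m) |g m. (g, m) \<in> t U})"
  "srestr L W t = (\<lambda>U. if U \<in> W then t U else {})"
  "h \<in> G \<Longrightarrow> sact L h t = (\<lambda>U. {(h * g, m) |g m. (g, m) \<in> t (gr_act \<alpha> (inv_mat h) U)})"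
  by (simp_all add: L_sheaf_def GLn_inv GLn_mult)

lemma F_locally_free: "locally_free X F"
  unfolding locally_free_def
proof (intro ballI)
  fix U assume "U \<in> pts X"
  then obtain \<Sigma> where \<Sigma>: "\<Sigma> \<in> index_sets n r" "U \<in> chart n r x \<Sigma>" using charts_cover by blast
  obtain d :: nat and e \<xi> where e: "\<And>i. i < d \<Longrightarrow> e i \<in> fib U0" "\<And>i. functional (\<xi> i)"
    "\<And>v. v \<in> fib U0 \<Longrightarrow> v = (\<Sum>i<d. scale (\<xi> i v) (e i))"
    "\<And>i j. i < d \<Longrightarrow> j < d \<Longrightarrow> \<xi> i (e j) = (if i = j then 1 else 0)"
    by (rule coordinates[OF fib_subspace[of U0]]) (rule that)
  \<comment> \<open>The translates of a basis of \<open>fib U0\<close> by the frame are a basis of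
    the fibre at each point of the chart; \<open>\<psi>\<close> reads off the coordinates in
    it.\<close>
  define \<phi> where "\<phi> W s U = (if U \<in> W then \<Sum>i<d. scale (s U i) (\<rho> (frame \<Sigma> U) (e i)) else 0)"
    for W and s :: "('e \<Rightarrow>\<^sub>0 'k) set \<Rightarrow> nat \<Rightarrow> 'k" and U
  define \<psi> where "\<psi> W s U i = (if U \<in> W \<and> i < d then \<xi> i (\<rho> (inv_mat (frame \<Sigma> U)) (s U)) else 0)"
    for W and s :: "('e \<Rightarrow>\<^sub>0 'k) set \<Rightarrow> 'm" and U i
  have "sheaf_iso_on X (chart n r x \<Sigma>) (free_sheaf X d) F \<phi>"
    unfolding sheaf_iso_on_def
  proof (intro ballI impI conjI)
    fix W assume W: "W \<in> opens X" "W \<subseteq> chart n r x \<Sigma>"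
    note fr = frame[OF \<Sigma>(1) subsetD[OF W(2)]]
    have into: "\<phi> W s \<in> sections F W" if "s \<in> sections (free_sheaf X d) W" for s
    proof -
      have "(\<lambda>U. s U i) \<in> regular X W" for i using that by (simp add: free_sheaf_def)
      then have "\<phi> W s \<in> tensor_sections X scale W"
        unfolding \<phi>_def by (intro frame_combination_tensor_section[OF \<Sigma>(1) W])
      moreover have "\<phi> W s V \<in> fib V" if V: "V \<in> W" for V
      proof -
        have "\<rho> (frame \<Sigma> V) (e i) \<in> fib V" if "i < d" for i
          using fib_frame(1)[OF fr(1)[OF V] e(1)[OF that]] fr(2)[OF V] by simp
        then show ?thesis
          unfolding \<phi>_def using V by (auto intro!: M.subspace_sum[OF fib_subspace] M.subspace_scale[OF fib_subspace])
      qed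
      ultimately show ?thesis by (simp add: sections_glued[OF W(1)])
    qed
    show "bij_betw (\<phi> W) (sections (free_sheaf X d) W) (sections F W)"
    proof (rule bij_betw_byWitness[where f' = "\<psi> W"])
      show "\<forall>s\<in>sections (free_sheaf X d) W. \<psi> W (\<phi> W s) = s"
      proof (intro ballI ext)
        fix s V i assume s: "s \<in> sections (free_sheaf X d) W"
        show "\<psi> W (\<phi> W s) V i = s V i"
        proof (cases "V \<in> W \<and> i < d")
          case True
          then have V: "V \<in> W" and i: "i < d" by auto
          have "\<phi> W s V = \<rho> (frame \<Sigma> V) (\<Sum>i<d. scale (s V i) (e i))"
            using V by (simp add: \<phi>_def rho_sum[OF fr(1)[OF V]] rho_scale[OF fr(1)[OF V]])
          then have "\<psi> W (\<phi> W s) V i = \<xi> i (\<Sum>j<d. scale (s V j) (e j))"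
            using True by (simp add: \<psi>_def rho_inv(2)[OF fr(1)[OF V]])
          also have "\<dots> = (\<Sum>j<d. if j = i then s V i else 0)"
            unfolding functional_sum[OF e(2)] using e(4)[OF i] by (intro sum.cong) auto
          finally show ?thesis using i by simp
        next
          case False
          then show ?thesis using s by (auto simp: \<psi>_def free_sheaf_def)
        qed
      qed
      show "\<forall>s\<in>sections F W. \<phi> W (\<psi> W s) = s"
      proof (intro ballI ext)
        fix s V assume "s \<in> sections F W"
        then have s: "s \<in> tensor_sections X scale W" "\<And>U. U \<in> W \<Longrightarrow> s U \<in> fib U"
          by (simp_all add: sections_glued[OF W(1)])
        show "\<phi> W (\<psi> W s) V = s V"
        proof (cases "V \<in> W")
          case True
          have "\<rho> (inv_mat (frame \<Sigma> V)) (s V) \<in> fib U0"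
            using fib_frame(2)[OF fr(1)[OF True]] s(2)[OF True] fr(2)[OF True] by simp
          then have *: "(\<Sum>i<d. scale (\<xi> i (\<rho> (inv_mat (frame \<Sigma> V)) (s V))) (e i)) = \<rho> (inv_mat (frame \<Sigma> V)) (s V)"
            using e(3) by simp
          have "\<phi> W (\<psi> W s) V = \<rho> (frame \<Sigma> V) (\<Sum>i<d. scale (\<xi> i (\<rho> (inv_mat (frame \<Sigma> V)) (s V))) (e i))"
            using True by (simp add: \<phi>_def \<psi>_def rho_sum[OF fr(1)[OF True]] rho_scale[OF fr(1)[OF True]])
          then show ?thesis unfolding * rho_inv(1)[OF fr(1)[OF True]] .
        next
          case False
          then show ?thesis using s(1) by (simp add: \<phi>_def tensor_sections_def)
        qed
      qed
      show "\<phi> W ` sections (free_sheaf X d) W \<subseteq> sections F W" using into by blast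
      show "\<psi> W ` sections F W \<subseteq> sections (free_sheaf X d) W"
      proof (rule image_subsetI)
        fix s assume "s \<in> sections F W"
        then have s: "s \<in> tensor_sections X scale W" by (simp add: sections_glued[OF W(1)])
        have "(\<lambda>U. \<psi> W s U i) \<in> regular X W" for i
        proof (cases "i < d")
          case True
          show ?thesis
            by (rule Gr.reg_cong[OF frame_coordinates_regular[OF \<Sigma>(1) W s e(2)[of i]]]) (simp add: \<psi>_def True)
        next
          case False
          show ?thesis
            by (rule Gr.reg_cong[OF Gr.reg_const[OF W(1), of 0]]) (simp add: \<psi>_def False)
        qed
        then show "\<psi> W s \<in> sections (free_sheaf X d) W" by (auto simp: free_sheaf_def \<psi>_def)
      qed
    qed
    show "\<phi> W (sadd (free_sheaf X d) s t) = sadd F (\<phi> W s) (\<phi> W t)" for s t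
      by (rule ext) (simp add: free_sheaf_def F_simps \<phi>_def M.scale_left_distrib sum.distrib)
    show "\<phi> W (smul (free_sheaf X d) f s) = smul F f (\<phi> W s)" for f s
      by (rule ext) (simp add: free_sheaf_def F_simps \<phi>_def M.scale_sum_right)
    show "\<phi> W' (srestr (free_sheaf X d) W' s) = srestr F W' (\<phi> W s)" if "W' \<subseteq> W" for W' s
      by (rule ext) (use that in \<open>auto simp: free_sheaf_def F_simps \<phi>_def\<close>)
  qed
  then show "\<exists>W\<in>opens X. U \<in> W \<and> (\<exists>d \<phi>. sheaf_iso_on X W (free_sheaf X d) F \<phi>)"
    using chart_open[OF \<Sigma>(1)] \<Sigma>(2) by blast
qed

lemma sact_F:
  assumes g: "g \<in> G" and W: "W \<in> opens X" and "s \<in> sections F W"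
  shows "sact F g s \<in> sections F (gr_act \<alpha> g ` W)"
proof -
  have s: "s \<in> tensor_sections X scale W" "\<And>U. U \<in> W \<Longrightarrow> s U \<in> fib U"
    using assms(3) by (simp_all add: sections_glued[OF W])
  note gW = translate_open[OF g W]
  have "sact F g s \<in> tensor_sections X scale (gr_act \<alpha> g ` W)"
    unfolding tensor_sections_iff[OF gW(1)] F_simps(4)[OF g]
  proof (intro conjI allI impI)
    fix U assume "U \<notin> gr_act \<alpha> g ` W"
    then have "gr_act \<alpha> (inv_mat g) U \<notin> W" using gr_act_inv_mem_iff[OF g Gr.opens_subset[OF W]] by blast
    then show "\<rho> g (s (gr_act \<alpha> (inv_mat g) U)) = 0" using s(1) by (simp add: tensor_sections_def rho_zero[OF g])
  next
    fix \<xi> assume "functional \<xi>"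
    from functional_rho[OF g this] have "(\<lambda>U. \<xi> (\<rho> g (s U))) \<in> regular X W"
      using s(1) tensor_sections_iff[OF W] by blast
    from gW(2)[OF this] show "(\<lambda>U. \<xi> (\<rho> g (s (gr_act \<alpha> (inv_mat g) U)))) \<in> regular X (gr_act \<alpha> g ` W)" .
  qed
  moreover have "sact F g s U \<in> fib U" if U: "U \<in> gr_act \<alpha> g ` W" for U
  proof -
    obtain V where V: "V \<in> W" "U = gr_act \<alpha> g V" using U by blast
    then have "gr_act \<alpha> (inv_mat g) U = V" using gr_act_inv(1)[OF g] Gr.opens_subset[OF W] by blast
    then show ?thesis using fib_equiv[OF g s(2)[OF V(1)]] V(2) by (simp add: F_simps(4)[OF g])
  qed
  ultimately show ?thesis by (simp add: sections_glued[OF gW(1)])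
qed

lemma F_bundle: "equivariant_vector_bundle X G (gr_act \<alpha>) F"
  unfolding equivariant_vector_bundle_def using F_locally_free sact_F by blast

text \<open>The map \<open>[g, m] \<mapsto> (g U0, g m)\<close> embeds the associated bundle into
  the trivial bundle with fibre M. This set consists of all pairs over \<open>U\<close> with image
  \<open>v\<close>, so it is the class lying over \<open>(U, v)\<close> if there is one.\<close>

definition same_point :: "('e \<Rightarrow>\<^sub>0 'k) set \<Rightarrow> 'm \<Rightarrow> ('k mat \<times> 'm) set" where
  "same_point U v = {(g, m). g \<in> G \<and> gr_act \<alpha> g U0 = U \<and> \<rho> g m = v}"

lemma same_point_iff: "(g, m) \<in> same_point U v \<longleftrightarrow> g \<in> G \<and> gr_act \<alpha> g U0 = U \<and> \<rho> g m = v"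
  by (simp add: same_point_def)

text \<open>This is the injectivity of \<open>[g, m] \<mapsto> (g U0, g m)\<close> on
  classes.\<close>

lemma bundle_class_eq:
  assumes g: "g \<in> G"
  shows "bundle_class n P \<rho> (g, m) = same_point (gr_act \<alpha> g U0) (\<rho> g m)"
proof (intro equalityI subsetI)
  fix y assume "y \<in> bundle_class n P \<rho> (g, m)"
  then obtain q where q: "q \<in> P" "y = (g * q, \<rho> (inv\<^bsub>GLn n\<^esub> q) m)"
    by (auto simp: bundle_class_def GLn_mult)
  then have q': "q \<in> G" "gr_act \<alpha> q U0 = U0" by (auto simp: parabolic_def)
  show "y \<in> same_point (gr_act \<alpha> g U0) (\<rho> g m)"
    unfolding q(2) same_point_iff
    using GLn_mult_closed[OF g q'(1)] gr_act_mult[OF g q'(1) U0_in_pts] q'(2)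
      rho_mult[OF g q'(1)] rho_inv(1)[OF q'(1)] by (simp add: GLn_inv[OF q'(1)])
next
  fix y assume "y \<in> same_point (gr_act \<alpha> g U0) (\<rho> g m)"
  then obtain g' m' where y: "y = (g', m')" "g' \<in> G" "gr_act \<alpha> g' U0 = gr_act \<alpha> g U0" "\<rho> g' m' = \<rho> g m"
    by (auto simp: same_point_def)
  note ig = GLn_inv_mat[OF g] and ig' = GLn_inv_mat[OF y(2)]
  \<comment> \<open>The only element that carries \<open>g\<close> to \<open>g'\<close> by right
    multiplication; it fixes \<open>U0\<close> because both move \<open>U0\<close> to the same
    subspace.\<close>
  let ?q = "inv_mat g * g'"
  have q: "?q \<in> G" by (rule GLn_mult_closed[OF ig(1) y(2)])
  have "gr_act \<alpha> ?q U0 = U0"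
    using gr_act_mult[OF ig(1) y(2) U0_in_pts] y(3) gr_act_inv(1)[OF g U0_in_pts] by simp
  then have "?q \<in> P" using q by (simp add: parabolic_def)
  moreover have gq: "g * ?q = g'"
    using assoc_mult_mat[OF G_mat[OF g] G_mat[OF ig(1)] G_mat[OF y(2)]] ig(2) G_mat[OF y(2)] by simp
  moreover have "m' = \<rho> (inv_mat ?q) m"
  proof -
    have "\<rho> g (\<rho> ?q m') = \<rho> g m" using rho_mult[OF g q, of m'] gq y(4) by simp
    then have "\<rho> ?q m' = m" using rho_inv(2)[OF g] by metis
    then show ?thesis using rho_inv(2)[OF q] by metis
  qed
  ultimately show "y \<in> bundle_class n P \<rho> (g, m)"
    unfolding y(1) bundle_class_def using GLn_inv[OF q] by (auto simp: GLn_mult intro!: exI[of _ ?q])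
qed

abbreviation "C \<equiv> {\<lambda>gm. f (fst gm) |f. f \<in> mat_coords n n} \<union> {\<lambda>gm. \<xi> (snd gm) |\<xi>. functional \<xi>}"
abbreviation "T' \<equiv> zariski_space C (G \<times> fib U0)"

sublocale T': space_with_functions "zariski_space C (G \<times> fib U0)"
  by (rule zariski_space_with_functions)

lemma pts_T: "pts T = bundle_class n P \<rho> ` (G \<times> fib U0)"
  by (simp add: total_space_def quotient_pts zariski_pts)

text \<open>The inverse isomorphism sends a section \<open>t\<close> of \<open>L\<close> to \<open>U \<mapsto> eval (t U)\<close>.\<close>

definition eval :: "('k mat \<times> 'm) set \<Rightarrow> 'm" where
  "eval c = (\<rho> (fst (SOME y. y \<in> c)) (snd (SOME y. y \<in> c)))"

lemma eval_same_point:
  assumes "(g, m) \<in> same_point U v" shows "eval (same_point U v) = v"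
proof -
  have "(SOME y. y \<in> same_point U v) \<in> same_point U v" using assms by (rule someI)
  then show ?thesis unfolding eval_def by (metis prod.collapse same_point_iff)
qed

text \<open>Regularity is tested on pairs \<open>(g, m)\<close> before passing to classes. There
  \<open>\<xi> (\<rho> g m)\<close> is a finite sum of coordinates of \<open>m\<close>, which are
  coordinate functions, times matrix coefficients at the fixed vectors \<open>e i\<close>.\<close>

lemma eval_regular:
  assumes \<xi>: "functional \<xi>"
  shows "(\<lambda>c. \<xi> (eval c)) \<in> regular T (pts T)"
proof -
  have op: "pts T' \<in> opens T'" by (rule T'.pts_open)
  obtain d :: nat and e \<epsilon> where e: "\<And>i. i < d \<Longrightarrow> e i \<in> fib U0" "\<And>i. functional (\<epsilon> i)"
    "\<And>v. v \<in> fib U0 \<Longrightarrow> v = (\<Sum>i<d. scale (\<epsilon> i v) (e i))"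
    "\<And>i j. i < d \<Longrightarrow> j < d \<Longrightarrow> \<epsilon> i (e j) = (if i = j then 1 else 0)"
    by (rule coordinates[OF fib_subspace[of U0]]) (rule that)
  have coord: "c \<in> C \<Longrightarrow> c \<in> regular T' (pts T')" for c
    using op unfolding zariski_space_opens by (intro zariski_regular_polyfun polyfuns.coord)
  have "morphism (open_subspace T' (pts T')) (zariski_space (mat_coords n n) G) fst"
  proof (rule T'.morphism_zariski[OF op])
    show "fst ` pts T' \<subseteq> G" by (auto simp: zariski_pts)
    show "(\<lambda>a. c (fst a)) \<in> regular T' (pts T')" if "c \<in> mat_coords n n" for c
      using that by (intro coord) blast
  qed
  then have fst: "morphism T' (zariski_space (mat_coords n n) G) fst" by (simp add: T'.open_subspace_pts)
  interpret GS: space_with_functions "zariski_space (mat_coords n n) G"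
    by (rule zariski_space_with_functions)
  have "G \<in> opens (zariski_space (mat_coords n n) G)" using GS.pts_open by (simp add: zariski_pts)
  from morphism_regular[OF fst this rho_regular[OF \<xi>]]
  have "(\<lambda>gm. \<xi> (\<rho> (fst gm) m)) \<in> regular T' {a \<in> pts T'. fst a \<in> G}" for m .
  moreover have "{a \<in> pts T'. fst a \<in> G} = pts T'" by (auto simp: zariski_pts)
  ultimately have \<rho>_reg: "(\<lambda>gm. \<xi> (\<rho> (fst gm) m)) \<in> regular T' (pts T')" for m by simp
  have "(\<lambda>gm. \<epsilon> i (snd gm)) \<in> regular T' (pts T')" for i using e(2)[of i] by (intro coord) blast
  then have "(\<lambda>gm. \<Sum>i<d. \<epsilon> i (snd gm) * \<xi> (\<rho> (fst gm) (e i))) \<in> regular T' (pts T')"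
    by (intro T'.reg_sum[OF op] T'.reg_mult[OF op] \<rho>_reg)
  then have "(\<lambda>gm. \<xi> (eval (bundle_class n P \<rho> gm))) \<in> regular T' (pts T')"
  proof (rule T'.reg_cong)
    fix gm assume "gm \<in> pts T'"
    then obtain g m where gm: "gm = (g, m)" "g \<in> G" "m \<in> fib U0" by (auto simp: zariski_pts)
    have "\<rho> g m = (\<Sum>i<d. scale (\<epsilon> i m) (\<rho> g (e i)))"
      by (subst e(3)[OF gm(3)]) (simp add: rho_sum[OF gm(2)] rho_scale[OF gm(2)])
    moreover have "eval (bundle_class n P \<rho> gm) = \<rho> g m"
      unfolding gm(1) bundle_class_eq[OF gm(2)]
      by (rule eval_same_point[of g m]) (simp add: same_point_iff gm(2))
    ultimately show "(\<Sum>i<d. \<epsilon> i (snd gm) * \<xi> (\<rho> (fst gm) (e i))) = \<xi> (eval (bundle_class n P \<rho> gm))"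
      by (simp add: gm(1) functional_sum[OF \<xi>])
  qed
  moreover have "{a \<in> pts T'. bundle_class n P \<rho> a \<in> pts T} = pts T'"
    by (auto simp: pts_T zariski_pts)
  ultimately show ?thesis unfolding total_space_def quotient_regular by (simp add: total_space_def)
qed

lemma sections_L_iff: "t \<in> sections L W \<longleftrightarrow> (\<forall>U. U \<notin> W \<longrightarrow> t U = {}) \<and>
    morphism (open_subspace X W) T t \<and> (\<forall>U\<in>W. \<forall>(g, m)\<in>t U. gr_act \<alpha> g U0 = U)"
  by (simp add: L_sheaf_def)

text \<open>As a point of the total space \<open>t U\<close> is some class \<open>[g, m]\<close>.
  The fibre condition on sections speaks about the members of this class, in particular about
  \<open>(g, m)\<close> itself, and so gives \<open>g U0 = U\<close>.\<close>

lemma section_L_value: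
  assumes t: "t \<in> sections L W" and U: "U \<in> W"
  shows "t U = same_point U (eval (t U))" "eval (t U) \<in> fib U"
proof -
  have m: "morphism (open_subspace X W) T t" and over: "\<And>g m. (g, m) \<in> t U \<Longrightarrow> gr_act \<alpha> g U0 = U"
    using t U unfolding sections_L_iff by blast+
  have "t U \<in> pts T" using morphism_pts[OF m, of U] U by (simp add: open_subspace_def)
  then obtain g m where gm: "g \<in> G" "m \<in> fib U0" "t U = same_point (gr_act \<alpha> g U0) (\<rho> g m)"
    using bundle_class_eq by (auto simp: pts_T)
  have mem: "(g, m) \<in> same_point (gr_act \<alpha> g U0) (\<rho> g m)" using gm(1) by (simp add: same_point_iff)
  then have gU: "gr_act \<alpha> g U0 = U" using over gm(3) by simp
  have ev: "eval (t U) = \<rho> g m" unfolding gm(3) by (rule eval_same_point[OF mem])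
  show "t U = same_point U (eval (t U))" unfolding ev using gm(3) gU by simp
  show "eval (t U) \<in> fib U" unfolding ev using fib_frame(1)[OF gm(1,2)] gU by simp
qed

definition to_L :: "('e \<Rightarrow>\<^sub>0 'k) set set \<Rightarrow> (('e \<Rightarrow>\<^sub>0 'k) set \<Rightarrow> 'm) \<Rightarrow> ('e \<Rightarrow>\<^sub>0 'k) set \<Rightarrow> ('k mat \<times> 'm) set" where
  "to_L W s U = (if U \<in> W then same_point U (s U) else {})"

lemma to_L_in_sections:
  assumes W: "W \<in> opens X" and "s \<in> sections F W"
  shows "to_L W s \<in> sections L W"
  unfolding sections_L_iff
proof (intro conjI allI impI ballI)
  have s: "s \<in> tensor_sections X scale W" "\<And>U. U \<in> W \<Longrightarrow> s U \<in> fib U"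
    using assms(2) by (simp_all add: sections_glued[OF W])
  show "to_L W s U = {}" if "U \<notin> W" for U using that by (simp add: to_L_def)
  show "case y of (g, m) \<Rightarrow> gr_act \<alpha> g U0 = U" if "U \<in> W" "y \<in> to_L W s U" for U y
    using that by (auto simp: to_L_def same_point_def)
  show "morphism (open_subspace X W) T (to_L W s)"
  proof (rule Gr.morphism_local[OF W])
    let ?\<W> = "(\<lambda>\<Sigma>. W \<inter> chart n r x \<Sigma>) ` index_sets n r"
    show "W = \<Union>?\<W>" using charts_cover Gr.opens_subset[OF W] by blast
    show "?\<W> \<subseteq> opens X" using Gr.open_Int[OF W chart_open] by blast
    fix W' assume "W' \<in> ?\<W>"
    then obtain \<Sigma> where \<Sigma>: "\<Sigma> \<in> index_sets n r" "W' = W \<inter> chart n r x \<Sigma>" by blast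
    have W': "W' \<in> opens X" "W' \<subseteq> chart n r x \<Sigma>" "W' \<subseteq> W"
      using Gr.open_Int[OF W chart_open[OF \<Sigma>(1)]] \<Sigma>(2) by auto
    note S = chart_subopen[OF \<Sigma>(1) W'(1,2)]
    note fr = frame(2)[OF \<Sigma>(1) subsetD[OF W'(2)]]
    \<comment> \<open>Over a chart the section lifts to a morphism into pairs; composing the lift
      with the quotient map gives back \<open>to_L\<close>.\<close>
    define \<psi> where "\<psi> U = (frame \<Sigma> U, \<rho> (inv_mat (frame \<Sigma> U)) (s U))" for U
    have reg: "(\<lambda>U. \<xi> (\<rho> (inv_mat (frame \<Sigma> U)) (s U))) \<in> regular X W'" if "functional \<xi>" for \<xi>
      by (rule Gr.reg_cong[OF frame_coordinates_regular[OF \<Sigma>(1) W'(1,2)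
              tensor_sections_restrict[OF s(1) W W'(1,3)] that]]) simp
    have "morphism (open_subspace X W') T' \<psi>"
    proof (rule Gr.morphism_zariski[OF W'(1)])
      show "\<psi> ` W' \<subseteq> G \<times> fib U0"
      proof (rule image_subsetI)
        fix U assume U: "U \<in> W'"
        have "s U \<in> fib (gr_act \<alpha> (frame \<Sigma> U) U0)" using s(2) U W'(3) fr[OF U] by auto
        then show "\<psi> U \<in> G \<times> fib U0" unfolding \<psi>_def using fib_frame(2)[OF S(1)[OF U]] S(1)[OF U] by simp
      qed
      fix c assume "c \<in> C"
      then show "(\<lambda>U. c (\<psi> U)) \<in> regular X W'"
        using S(3) reg by (auto simp: \<psi>_def mat_coords_def)
    qed
    from morphism_comp[OF this T'.morphism_to_quotient[of "bundle_class n P \<rho>"]]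
    have "morphism (open_subspace X W') T (\<lambda>U. bundle_class n P \<rho> (\<psi> U))" by (simp add: total_space_def)
    then show "morphism (open_subspace X W') T (to_L W s)"
    proof (rule Gr.morphism_cong)
      fix U assume U: "U \<in> W'"
      show "bundle_class n P \<rho> (\<psi> U) = to_L W s U"
        unfolding \<psi>_def bundle_class_eq[OF S(1)[OF U]] fr[OF U] rho_inv(1)[OF S(1)[OF U]]
        using U W'(3) by (auto simp: to_L_def)
    qed
  qed
qed

lemma point_over:
  assumes "U \<in> pts X"
  obtains g where "g \<in> G" "gr_act \<alpha> g U0 = U"
  using charts_cover[OF assms] frame by blast

lemma same_point_nonempty:
  assumes "U \<in> pts X"
  obtains g where "(g, \<rho> (inv_mat g) v) \<in> same_point U v"
  using point_over[OF assms] rho_inv(1) by (metis same_point_iff)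

lemma eval_to_L: "U \<in> W \<Longrightarrow> W \<subseteq> pts X \<Longrightarrow> eval (to_L W s U) = s U"
  using same_point_nonempty[of U "s U"] eval_same_point by (metis to_L_def subsetD)

text \<open>Since \<open>t\<close> is a morphism, it pulls back the functions
  \<open>\<xi> (eval c)\<close>, regular on the whole total space, to regular functions on
  \<open>W\<close>.\<close>

lemma eval_in_sections:
  assumes W: "W \<in> opens X" and t: "t \<in> sections L W"
  shows "(\<lambda>U. if U \<in> W then eval (t U) else 0) \<in> sections F W"
proof -
  have "(\<lambda>U. if U \<in> W then eval (t U) else 0) \<in> tensor_sections X scale W"
    unfolding tensor_sections_iff[OF W]
  proof (intro conjI allI impI)
    fix \<xi> assume \<xi>: "functional \<xi>"
    have m: "morphism (open_subspace X W) T t" using t by (simp add: sections_L_iff)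
    have "space_with_functions T" unfolding total_space_def by (rule T'.quotient_space_with_functions)
    then have "pts T \<in> opens T" by (rule space_with_functions.pts_open)
    from morphism_regular[OF m this eval_regular[OF \<xi>]]
    have "(\<lambda>U. \<xi> (eval (t U))) \<in> regular X {U \<in> W. t U \<in> pts T}" by (simp add: open_subspace_def)
    moreover have "{U \<in> W. t U \<in> pts T} = W" using morphism_pts[OF m] by (auto simp: open_subspace_def)
    ultimately have "(\<lambda>U. \<xi> (eval (t U))) \<in> regular X W" by simp
    then show "(\<lambda>U. \<xi> (if U \<in> W then eval (t U) else 0)) \<in> regular X W" by (rule Gr.reg_cong) simp
  qed simp
  then show ?thesis using section_L_value(2)[OF t] by (simp add: sections_glued[OF W])
qed

lemma to_L_sheaf_iso: "sheaf_iso_on X (pts X) F L to_L"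
  unfolding sheaf_iso_on_def
proof (intro ballI impI conjI)
  fix W assume W: "W \<in> opens X" "W \<subseteq> pts X"
  show "bij_betw (to_L W) (sections F W) (sections L W)"
  proof (rule bij_betw_byWitness[where f' = "\<lambda>t U. if U \<in> W then eval (t U) else 0"])
    show "\<forall>s\<in>sections F W. (\<lambda>U. if U \<in> W then eval (to_L W s U) else 0) = s"
      using eval_to_L[OF _ W(2)] by (auto simp: sections_glued[OF W(1)] tensor_sections_def fun_eq_iff)
    show "\<forall>t\<in>sections L W. to_L W (\<lambda>U. if U \<in> W then eval (t U) else 0) = t"
      using section_L_value(1) by (auto simp: sections_L_iff fun_eq_iff to_L_def)
  qed (use to_L_in_sections[OF W(1)] eval_in_sections[OF W(1)] in auto)
  show "to_L W (sadd F s t) = sadd L (to_L W s) (to_L W t)" for s t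
  proof (rule ext)
    fix U
    \<comment> \<open>Addition of classes pairs members with the same \<open>g\<close>. A member of
      the left side is split by applying the inverse of \<open>g\<close> to \<open>s U\<close> and
      \<open>t U\<close> separately.\<close>
    have "same_point U (s U + t U) =
        {(g, m + m') |g m m'. (g, m) \<in> same_point U (s U) \<and> (g, m') \<in> same_point U (t U)}" (is "?A = ?B")
    proof (intro equalityI subsetI)
      fix y assume "y \<in> ?A"
      then obtain g m where y: "y = (g, m)" "g \<in> G" "gr_act \<alpha> g U0 = U" "\<rho> g m = s U + t U"
        by (auto simp: same_point_def)
      have ig: "inv_mat g \<in> G" by (rule GLn_inv_mat(1)[OF y(2)])
      have "m = \<rho> (inv_mat g) (s U) + \<rho> (inv_mat g) (t U)"
        using rho_inv(2)[OF y(2), of m] rho_add[OF ig] y(4) by simp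
      moreover have "(g, \<rho> (inv_mat g) v) \<in> same_point U v" for v
        using y rho_inv(1)[OF y(2)] by (simp add: same_point_iff)
      ultimately show "y \<in> ?B" using y(1) by blast
    next
      fix y assume "y \<in> ?B"
      then show "y \<in> ?A" using rho_add by (auto simp: same_point_def)
    qed
    then show "to_L W (sadd F s t) U = sadd L (to_L W s) (to_L W t) U"
      by (simp add: to_L_def F_simps L_simps)
  qed
  show "to_L W (smul F f s) = smul L f (to_L W s)" for f s
  proof (rule ext)
    fix U
    have "same_point U (scale (f U) (s U)) = {(g, scale (f U) m) |g m. (g, m) \<in> same_point U (s U)}" (is "?A = ?B")
    proof (intro equalityI subsetI)
      fix y assume "y \<in> ?A"
      then obtain g m where y: "y = (g, m)" "g \<in> G" "gr_act \<alpha> g U0 = U" "\<rho> g m = scale (f U) (s U)"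
        by (auto simp: same_point_def)
      have "m = scale (f U) (\<rho> (inv_mat g) (s U))"
        using rho_inv(2)[OF y(2), of m] rho_scale[OF GLn_inv_mat(1)[OF y(2)]] y(4) by simp
      moreover have "(g, \<rho> (inv_mat g) (s U)) \<in> same_point U (s U)"
        using y rho_inv(1)[OF y(2)] by (simp add: same_point_iff)
      ultimately show "y \<in> ?B" using y(1) by blast
    next
      fix y assume "y \<in> ?B"
      then show "y \<in> ?A" using rho_scale by (auto simp: same_point_def)
    qed
    then show "to_L W (smul F f s) U = smul L f (to_L W s) U"
      by (simp add: to_L_def F_simps L_simps)
  qed
  show "to_L W' (srestr F W' s) = srestr L W' (to_L W s)" if "W' \<subseteq> W" for W' s
    using that by (auto simp: to_L_def F_simps L_simps fun_eq_iff)
qed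

text \<open>The substitution \<open>h \<mapsto> g * h\<close> matches the pairs over the two points.
  The identity is one of set-valued functions, so \<open>s\<close> may be arbitrary.\<close>

lemma to_L_equivariant:
  assumes g: "g \<in> G" and W: "W \<in> opens X"
  shows "to_L (gr_act \<alpha> g ` W) (sact F g s) = sact L g (to_L W s)"
proof (rule ext)
  fix U
  let ?V = "gr_act \<alpha> (inv_mat g) U"
  note ig = GLn_inv_mat[OF g]
  note W' = Gr.opens_subset[OF W]
  show "to_L (gr_act \<alpha> g ` W) (sact F g s) U = sact L g (to_L W s) U"
  proof (cases "?V \<in> W")
    case False
    then have "U \<notin> gr_act \<alpha> g ` W" using gr_act_inv_mem_iff[OF g W'] by blast
    then show ?thesis using False by (simp add: to_L_def L_simps(4)[OF g])
  next
    case True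
    then have U: "U \<in> gr_act \<alpha> g ` W" using gr_act_inv_mem_iff[OF g W'] by blast
    then have "U \<in> pts X" using gr_act_pts[OF g] W' by blast
    have "same_point U (\<rho> g (s ?V)) = {(g * h, m) |h m. (h, m) \<in> same_point ?V (s ?V)}" (is "?A = ?B")
    proof (intro equalityI subsetI)
      fix y assume "y \<in> ?A"
      then obtain h m where y: "y = (h, m)" "h \<in> G" "gr_act \<alpha> h U0 = U" "\<rho> h m = \<rho> g (s ?V)"
        by (auto simp: same_point_def)
      let ?h = "inv_mat g * h"
      have "g * ?h = h"
        using assoc_mult_mat[OF G_mat[OF g] G_mat[OF ig(1)] G_mat[OF y(2)]] ig(2) G_mat[OF y(2)] by simp
      moreover have "(?h, m) \<in> same_point ?V (s ?V)"
        using GLn_mult_closed[OF ig(1) y(2)] gr_act_mult[OF ig(1) y(2) U0_in_pts] y(3,4)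
          rho_mult[OF ig(1) y(2)] rho_inv(2)[OF g] by (simp add: same_point_iff)
      ultimately show "y \<in> ?B" using y(1) by (intro CollectI exI[of _ ?h] exI[of _ m]) auto
    next
      fix y assume "y \<in> ?B"
      then obtain h m where y: "y = (g * h, m)" "h \<in> G" "gr_act \<alpha> h U0 = ?V" "\<rho> h m = s ?V"
        by (auto simp: same_point_def)
      then show "y \<in> ?A"
        using GLn_mult_closed[OF g y(2)] gr_act_mult[OF g y(2) U0_in_pts] gr_act_inv(2)[OF g \<open>U \<in> pts X\<close>]
          rho_mult[OF g y(2)] by (simp add: same_point_iff)
    qed
    then show ?thesis using True U by (simp add: to_L_def F_simps(4)[OF g] L_simps(4)[OF g])
  qed
qed

text \<open>Local freeness and stability under the group are transported from the subsheaf of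
  M-valued functions along the isomorphism \<open>to_L\<close>.\<close>

lemma L_bundle: "equivariant_vector_bundle X G (gr_act \<alpha>) L"
  unfolding equivariant_vector_bundle_def
proof (intro conjI ballI image_subsetI)
  show "locally_free X L"
    unfolding locally_free_def
  proof (intro ballI)
    fix U assume "U \<in> pts X"
    then obtain W d \<phi> where "W \<in> opens X" "U \<in> W" "sheaf_iso_on X W (free_sheaf X d) F \<phi>"
      using F_locally_free unfolding locally_free_def by blast
    then show "\<exists>W\<in>opens X. U \<in> W \<and> (\<exists>d \<phi>. sheaf_iso_on X W (free_sheaf X d) L \<phi>)"
      using sheaf_iso_on_trans[OF _ to_L_sheaf_iso Gr.opens_subset] by blast
  qed
  fix g W t assume g: "g \<in> G" and W: "W \<in> opens X" and t: "t \<in> sections L W"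
  obtain s where "s \<in> sections F W" "t = to_L W s"
    using sheaf_iso_onD(1)[OF to_L_sheaf_iso W Gr.opens_subset[OF W]] t unfolding bij_betw_def by blast
  then show "sact L g t \<in> sections L (gr_act \<alpha> g ` W)"
    using to_L_equivariant[OF g W] to_L_in_sections[OF translate_open(1)[OF g W] sact_F[OF g W]] by metis
qed

lemma bundle_iso: "equivariant_bundle_iso X G (gr_act \<alpha>) F L"
  unfolding equivariant_bundle_iso_def
  using F_bundle L_bundle to_L_sheaf_iso to_L_equivariant by blast

end

section \<open>The sheaves \<open>Ker\<close> and \<open>Im\<close>\<close>

context equivariant_kE_module
begin

text \<open>The normalised basis of \<open>U\<close>: at the point \<open>U\<close> the operator
  \<open>theta\<close> with index \<open>j\<close> is multiplication by the \<open>j\<close>-th of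
  these elements.\<close>

definition chart_basis :: "nat set \<Rightarrow> ('e \<Rightarrow>\<^sub>0 'k) set \<Rightarrow> nat \<Rightarrow> ('e \<Rightarrow>\<^sub>0 'k)" where
  "chart_basis \<Sigma> U j = (\<Sum>i<n. kscale (Ymat n r x \<Sigma> U $$ (i, j)) (x i))"

lemma span_chart_basis:
  assumes "\<Sigma> \<in> index_sets n r" "U \<in> chart n r x \<Sigma>"
  shows "kE.span (chart_basis \<Sigma> U ` {..<r}) = U"
  using Ymat_chart(2)[OF assms] by (simp add: col_span_def chart_basis_def[abs_def])

text \<open>The frame sends each \<open>x j\<close> with \<open>j < r\<close> to the corresponding
  element of the normalised basis, so equivariance of the module intertwines products of the former
  with products of the latter.\<close>

lemma alpha_frame_prod:
  assumes \<Sigma>: "\<Sigma> \<in> index_sets n r" and U: "U \<in> chart n r x \<Sigma>" and js: "js \<in> multi_indices r l"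
  shows "\<rho> (frame \<Sigma> U) (act (prod_list (map x js)) m) =
    act (prod_list (map (chart_basis \<Sigma> U) js)) (\<rho> (frame \<Sigma> U) m)"
proof -
  note fr = frame[OF \<Sigma> U]
  have "map (\<alpha> (frame \<Sigma> U)) (map x js) = map (chart_basis \<Sigma> U) js"
    using js fr(3) by (auto simp: multi_indices_def chart_basis_def)
  then show ?thesis by (simp only: rho_act[OF fr(1)] alpha_prod_list[OF fr(1)])
qed

text \<open>The operators act point by point, so a composite is multiplication by a product. The
  hypothesis serves the empty list, where \<open>s\<close> itself is not cut off outside the
  chart.\<close>

lemma foldr_theta:
  assumes "\<And>U. U \<notin> chart n r x \<Sigma> \<Longrightarrow> s U = 0"
  shows "foldr (theta n r x act \<Sigma>) js s U =
    (if U \<in> chart n r x \<Sigma> then act (prod_list (map (chart_basis \<Sigma> U) js)) (s U) else 0)"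
proof (induction js)
  case (Cons j js)
  show ?case
  proof (cases "U \<in> chart n r x \<Sigma>")
    case True
    have "act (chart_basis \<Sigma> U j) m = (\<Sum>i<n. scale (Ymat n r x \<Sigma> U $$ (i, j)) (act (x i) m))" for m
      by (simp add: chart_basis_def act.scale_sum_left act_kscale)
    then have "foldr (theta n r x act \<Sigma>) (j # js) s U = act (chart_basis \<Sigma> U j) (foldr (theta n r x act \<Sigma>) js s U)"
      using True by (simp add: theta_def)
    then show ?thesis using True Cons by simp
  qed (simp add: theta_def)
qed (simp add: assms)

text \<open>A word in elements of the translated subspace is the image under
  \<open>\<alpha> g\<close> of a word in elements of \<open>U\<close>, and \<open>\<rho> g\<close>
  carries the action of the latter to that of the former.\<close>

lemma Soc_pow_equiv:
  assumes g: "g \<in> G" and m: "m \<in> Soc_pow act U l"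
  shows "\<rho> g m \<in> Soc_pow act (gr_act \<alpha> g U) l"
  unfolding Soc_pow_def mem_Collect_eq
proof (intro allI impI)
  fix us assume us: "length us = l \<and> set us \<subseteq> gr_act \<alpha> g U"
  then have "us \<in> map (\<alpha> g) ` lists U"
    unfolding lists_image[symmetric] by (simp add: lists_eq_set gr_act_def)
  then obtain vs where vs: "vs \<in> lists U" "us = map (\<alpha> g) vs" by (rule imageE)
  then have "act (prod_list vs) m = 0" using m us by (simp add: Soc_pow_def lists_eq_set)
  then have "\<rho> g (act (prod_list vs) m) = 0" by (simp add: rho_zero[OF g])
  then show "act (prod_list us) (\<rho> g m) = 0" by (simp add: rho_act[OF g] alpha_prod_list[OF g] vs(2))
qed

lemma Rad_pow_equiv:
  assumes g: "g \<in> G" and m: "m \<in> Rad_pow act U l"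
  shows "\<rho> g m \<in> Rad_pow act (gr_act \<alpha> g U) l"
proof -
  let ?S = "{m. \<rho> g m \<in> Rad_pow act (gr_act \<alpha> g U) l}"
  have "{act (prod_list us) m |us m. length us = l \<and> set us \<subseteq> U} \<subseteq> ?S"
  proof
    fix y assume "y \<in> {act (prod_list us) m |us m. length us = l \<and> set us \<subseteq> U}"
    then obtain us m where "y = act (prod_list us) m" "length us = l" "set us \<subseteq> U" by blast
    then show "y \<in> ?S"
      using Rad_powI[of "map (\<alpha> g) us" l "gr_act \<alpha> g U" "\<rho> g m"]
      by (auto simp: rho_act[OF g] alpha_prod_list[OF g] gr_act_def)
  qed
  moreover have "M.subspace ?S"
    using subspace_Rad_pow[of "gr_act \<alpha> g U" l]
    by (simp add: M.subspace_def rho_zero[OF g] rho_add[OF g] rho_scale[OF g])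
  ultimately have "Rad_pow act U l \<subseteq> ?S" unfolding Rad_pow_def[of act U] by (rule M.span_minimal)
  then show ?thesis using m by blast
qed

lemma tensor_sections_outside: "s \<in> tensor_sections X scale W \<Longrightarrow> U \<notin> W \<Longrightarrow> s U = 0"
  by (simp add: tensor_sections_def)

text \<open>Vanishing under all words in the \<open>theta\<close> operators means, point by point,
  that the value is killed by all words in the normalised basis; since this basis spans
  \<open>U\<close>, that is membership in the socle power for \<open>U\<close>.\<close>

lemma Ker_fibres:
  "equivariant_fibres act n r x \<alpha> \<rho> (\<lambda>U. Soc_pow act U l) (ker_chart n r x act l)"
proof unfold_locales
  show "M.subspace (Soc_pow act U l)" for U by (rule subspace_Soc_pow)
  show "\<rho> g m \<in> Soc_pow act (gr_act \<alpha> g U) l" if "g \<in> G" "m \<in> Soc_pow act U l" for g m U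
    using that by (rule Soc_pow_equiv)
  show "t U \<in> Soc_pow act U l"
    if \<Sigma>: "\<Sigma> \<in> index_sets n r" and t: "t \<in> ker_chart n r x act l \<Sigma>" and U: "U \<in> chart n r x \<Sigma>" for \<Sigma> t U
  proof -
    have "t \<in> tensor_sections X scale (chart n r x \<Sigma>)" using t by (simp add: ker_chart_def)
    note out = tensor_sections_outside[OF this]
    have "act (prod_list (map (chart_basis \<Sigma> U) js)) (t U) = 0" if "js \<in> multi_indices r l" for js
      using t that foldr_theta[of \<Sigma> t js U] out U by (simp add: ker_chart_def)
    then have "t U \<in> Soc_pow act (kE.span (chart_basis \<Sigma> U ` {..<r})) l"
      by (simp add: Soc_pow_span Soc_pow_image)
    then show ?thesis by (simp add: span_chart_basis[OF \<Sigma> U])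
  qed
  show "(\<lambda>U. if U \<in> chart n r x \<Sigma> then \<Sum>i<d. scale (c i U) (\<rho> (frame \<Sigma> U) (e i)) else 0)
      \<in> ker_chart n r x act l \<Sigma>" (is "?t \<in> _")
    if \<Sigma>: "\<Sigma> \<in> index_sets n r" and e: "\<And>i. i < d \<Longrightarrow> e i \<in> Soc_pow act U0 l"
      and c: "\<And>i. i < d \<Longrightarrow> c i \<in> regular X (chart n r x \<Sigma>)" for \<Sigma> d e c
  proof -
    have t: "?t \<in> tensor_sections X scale (chart n r x \<Sigma>)"
      by (rule frame_combination_tensor_section[OF \<Sigma> chart_open[OF \<Sigma>] subset_refl]) (simp add: c)
    have "foldr (theta n r x act \<Sigma>) js ?t = (\<lambda>U. 0)" if js: "js \<in> multi_indices r l" for js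
    proof
      fix U
      show "foldr (theta n r x act \<Sigma>) js ?t U = 0"
      proof (cases "U \<in> chart n r x \<Sigma>")
        case True
        note fr = frame[OF \<Sigma> True]
        have "\<rho> (frame \<Sigma> U) (e i) \<in> Soc_pow act U l" if "i < d" for i
          using Soc_pow_equiv[OF fr(1) e[OF that]] fr(2) by simp
        then have "?t U \<in> Soc_pow act U l"
          using True by (auto intro!: M.subspace_sum[OF subspace_Soc_pow] M.subspace_scale[OF subspace_Soc_pow])
        then have "?t U \<in> Soc_pow act (kE.span (chart_basis \<Sigma> U ` {..<r})) l"
          by (simp only: span_chart_basis[OF \<Sigma> True])
        then have "act (prod_list (map (chart_basis \<Sigma> U) js)) (?t U) = 0"
          using js unfolding Soc_pow_span Soc_pow_image by blast
        then show ?thesis by (subst foldr_theta) (simp_all add: True)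
      next
        case False
        then show ?thesis by (subst foldr_theta) simp_all
      qed
    qed
    then show ?thesis using t by (simp add: ker_chart_def)
  qed
qed

text \<open>Values of elements of the image are visibly in the radical powers. The substance is the
  converse: a section built from radical vectors must be an image of sections regular on the entire
  chart.\<close>

lemma Im_fibres:
  "equivariant_fibres act n r x \<alpha> \<rho> (\<lambda>U. Rad_pow act U l) (im_chart n r x act l)"
proof unfold_locales
  show "M.subspace (Rad_pow act U l)" for U by (rule subspace_Rad_pow)
  show "\<rho> g m \<in> Rad_pow act (gr_act \<alpha> g U) l" if "g \<in> G" "m \<in> Rad_pow act U l" for g m U
    using that by (rule Rad_pow_equiv)
  show "s U \<in> Rad_pow act U l"
    if \<Sigma>: "\<Sigma> \<in> index_sets n r" and s: "s \<in> im_chart n r x act l \<Sigma>" and U: "U \<in> chart n r x \<Sigma>" for \<Sigma> s U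
  proof -
    obtain t where t: "\<And>js. js \<in> multi_indices r l \<Longrightarrow> t js \<in> tensor_sections X scale (chart n r x \<Sigma>)"
      "s = (\<lambda>U. \<Sum>js\<in>multi_indices r l. foldr (theta n r x act \<Sigma>) js (t js) U)"
      using s unfolding im_chart_def by blast
    have "s U = (\<Sum>js\<in>multi_indices r l. act (prod_list (map (chart_basis \<Sigma> U) js)) (t js U))"
      unfolding t(2)
      by (intro sum.cong refl) (simp add: foldr_theta[OF tensor_sections_outside[OF t(1)]] U)
    then have "s U \<in> Rad_pow act (kE.span (chart_basis \<Sigma> U ` {..<r})) l"
      unfolding Rad_pow_span Rad_pow_image by (rule range_eqI[of _ _ "\<lambda>js. t js U"])
    then show ?thesis by (simp add: span_chart_basis[OF \<Sigma> U])
  qed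
  show "(\<lambda>U. if U \<in> chart n r x \<Sigma> then \<Sum>i<d. scale (c i U) (\<rho> (frame \<Sigma> U) (e i)) else 0)
      \<in> im_chart n r x act l \<Sigma>" (is "?t \<in> _")
    if \<Sigma>: "\<Sigma> \<in> index_sets n r" and e: "\<And>i. i < d \<Longrightarrow> e i \<in> Rad_pow act U0 l"
      and c: "\<And>i. i < d \<Longrightarrow> c i \<in> regular X (chart n r x \<Sigma>)" for \<Sigma> and d :: nat and e c
  proof -
    have "\<exists>m. e i = (\<Sum>js\<in>multi_indices r l. act (prod_list (map x js)) (m js))" if "i < d" for i
      using e[OF that] unfolding base_subspace_def Rad_pow_span Rad_pow_image by blast
    then obtain m where m: "\<And>i. i < d \<Longrightarrow> e i = (\<Sum>js\<in>multi_indices r l. act (prod_list (map x js)) (m i js))"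
      by metis
    \<comment> \<open>Each \<open>e i\<close> is written at \<open>U0\<close> once and for all
      through constant vectors \<open>m i js\<close>. Translating these by the frame gives sections
      over the chart, and the intertwining property turns products of the \<open>x j\<close> into
      composites of \<open>theta\<close>.\<close>
    define t where "t js = (\<lambda>U. if U \<in> chart n r x \<Sigma> then \<Sum>i<d. scale (c i U) (\<rho> (frame \<Sigma> U) (m i js)) else 0)" for js
    have t: "t js \<in> tensor_sections X scale (chart n r x \<Sigma>)" for js
      unfolding t_def
      by (rule frame_combination_tensor_section[OF \<Sigma> chart_open[OF \<Sigma>] subset_refl]) (simp add: c)
    have "?t U = (\<Sum>js\<in>multi_indices r l. foldr (theta n r x act \<Sigma>) js (t js) U)" for U
    proof (cases "U \<in> chart n r x \<Sigma>")
      case True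
      note fr = frame[OF \<Sigma> True]
      let ?y = "\<lambda>js. prod_list (map (chart_basis \<Sigma> U) js)"
      have "?t U = (\<Sum>i<d. \<Sum>js\<in>multi_indices r l. scale (c i U) (act (?y js) (\<rho> (frame \<Sigma> U) (m i js))))"
        using True m by (simp add: rho_sum[OF fr(1)] alpha_frame_prod[OF \<Sigma> True] M.scale_sum_right)
      also have "\<dots> = (\<Sum>js\<in>multi_indices r l. \<Sum>i<d. act (?y js) (scale (c i U) (\<rho> (frame \<Sigma> U) (m i js))))"
        unfolding act_scale by (rule sum.swap)
      also have "\<dots> = (\<Sum>js\<in>multi_indices r l. act (?y js) (t js U))"
        using True by (simp add: t_def act.scale_sum_right)
      also have "\<dots> = (\<Sum>js\<in>multi_indices r l. foldr (theta n r x act \<Sigma>) js (t js) U)"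
        by (intro sum.cong refl) (simp add: foldr_theta[OF tensor_sections_outside[OF t]] True)
      finally show ?thesis .
    next
      case False
      then show ?thesis by (simp add: foldr_theta[OF tensor_sections_outside[OF t]])
    qed
    then have "?t = (\<lambda>U. \<Sum>js\<in>multi_indices r l. foldr (theta n r x act \<Sigma>) js (t js) U)" by (rule ext)
    then show ?thesis unfolding im_chart_def using t by blast
  qed
qed

end

theorem theorem7p6:
  fixes V :: "('e::{ab_group_add,finite} \<Rightarrow>\<^sub>0 'k::alg_closed_field) set"
    and x :: "nat \<Rightarrow> ('e \<Rightarrow>\<^sub>0 'k)"
    and \<alpha> :: "'k mat \<Rightarrow> ('e \<Rightarrow>\<^sub>0 'k) \<Rightarrow> ('e \<Rightarrow>\<^sub>0 'k)"
    and act :: "('e \<Rightarrow>\<^sub>0 'k) \<Rightarrow> 'm \<Rightarrow> 'm::ab_group_add"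
    and \<rho> :: "'k mat \<Rightarrow> 'm \<Rightarrow> 'm"
    and n p r l :: nat
  assumes char: "CHAR('k) = p" "p > 0"
    and E: "elementary_abelian TYPE('e) p n" "n \<ge> 1"
    and V: "generating_subspace V n x"
    and \<alpha>: "induced_action n x \<alpha>"
    and M: "Modules.module act" "\<exists>B. finite B \<and> Modules.module.span (mscale act) B = UNIV"
    and equivariant: "equivariant_module n \<alpha> act \<rho>"
    and r: "1 \<le> r" "r \<le> n"
    and l: "1 \<le> l" "l \<le> r * (p - 1)"
  shows "equivariant_bundle_iso (Gr n r x) (carrier (GLn n)) (gr_act \<alpha>)
           (Ker_sheaf n r x \<alpha> act \<rho> l)
           (L_sheaf n r x \<alpha> (mscale act) \<rho> (Soc_pow act (base_subspace r x) l)) \<and>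
         equivariant_bundle_iso (Gr n r x) (carrier (GLn n)) (gr_act \<alpha>)
           (Im_sheaf n r x \<alpha> act \<rho> l)
           (L_sheaf n r x \<alpha> (mscale act) \<rho> (Rad_pow act (base_subspace r x) l))"
proof -
  interpret kE_module act by (rule kE_module.intro[OF M(1)])
  interpret equivariant_kE_module act n r x \<alpha> \<rho>
    using V \<alpha> M(2) equivariant r(2)
    by unfold_locales (auto simp: generating_subspace_def)
  show ?thesis
    unfolding Ker_sheaf_def Im_sheaf_def
    using equivariant_fibres.bundle_iso[OF Ker_fibres[of l]] equivariant_fibres.bundle_iso[OF Im_fibres[of l]] by blast
qed

end
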